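(* There exists a universal constant $C>0$ such that the following holds. Let $\mathcal X,\mathcal Y$ be separable real Hilbert spaces, $\gamma$ a Borel probability measure on $\mathcal X$, $\sigma>0$, and $G_0:\mathcal X\to\mathcal Y$ measurable with $\|G_0\|_{\infty,\mathrm{supp}(\gamma)}<\infty$. For $n\in\mathbb N$ let $x_1,\dots,x_n$ be i.i.d. with law $\gamma$ and $y_i=G_0(x_i)+\sigma\varepsilon_i$, $i=1,\dots,n$, either with white noise or with sub-Gaussian noise (see context). Let $\mathbf G$ be a class of measurable maps $\mathcal X\to\mathcal Y$ and $G^*\in\mathbf G$ such that (a) $\mathbf G$ is compact with respect to $\|\cdot\|_{\infty,\mathrm{supp}(\gamma)}$; (b) there is a deterministic function $\Psi_n:(0,\infty)\to[0,\infty)$ such that for $\gamma^n$-a.e. $\boldsymbol x=(x_1,\dots,x_n)$ one has $\Psi_n(\delta)\ge J(\mathbf G_n^*(\delta),\|\cdot\|_n)$ for all $\delta>0$, and $\delta\mapsto\Psi_n(\delta)/\delta^2$ is non-increasing on $(0,\infty)$. Let $F_\infty<\infty$ be such that $\sup_{G\in\mathbf G}\|G-G_0\|_{\infty,\mathrm{supp}(\gamma)}\le F_\infty$, and let $\hat G_n$ be any measurable minimizer over $\mathbf G$ of the empirical risk $I_n$. Then for all positive sequences $(\delta_n)_{n\in\mathbb N}$, $(\tilde\delta_n)_{n\in\mathbb N}$ with $$\sqrt n\,\delta_n^2\ge C\sigma\Psi_n(\delta_n)\quad\text{and}\quad n\tilde\delta_n^2\ge CF_\infty^2\,H(\mathbf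 G,\|\cdot\|_{\infty,\mathrm{supp}(\gamma)},\tilde\delta_n),$$ and all $$R\ge C\max\Big\{\delta_n,\ \tilde\delta_n,\ \|G^*-G_0\|_{\infty,\mathrm{supp}(\gamma)},\ \frac{\sigma+F_\infty}{\sqrt n}\Big\},$$ it holds that $$\mathbb P_{G_0}\big(\|\hat G_n-G_0\|_{L^2(\gamma)}\ge R\big)\le 2\exp\Big(-\frac{nR^2}{C^2(\sigma^2+F_\infty^2)}\Big).$$
   Context: Noise models (the noise is independent of the $x_i$). White noise: $\varepsilon_1,\dots,\varepsilon_n$ are independent copies of the $\mathcal Y$-Gaussian white noise process, i.e. the centered Gaussian process $(\mathbb W(y))_{y\in\mathcal Y}$ with $\mathrm{Cov}(\mathbb W(y),\mathbb W(y'))=\langle y,y'\rangle_{\mathcal Y}$; one writes $\langle\varepsilon_i,y\rangle_{\mathcal Y}:=\varepsilon_i(y)$, and $y_i$ is understood as the process $\langle y_i,f\rangle_{\mathcal Y}:=\langle G_0(x_i),f\rangle_{\mathcal Y}+\sigma\langle\varepsilon_i,f\rangle_{\mathcal Y}$, $f\in\mathcal Y$. Sub-Gaussian noise: $\varepsilon_1,\dots,\varepsilon_n$ are independent $\mathcal Y$-valued random variables with $\mathbb E[\varepsilon_i]=0$ and $\mathbb P(\|\varepsilon_i\|_{\mathcal Y}\ge t)\le 2\exp(-t^2/2)$ for all $t\ge0$. $\mathbb P_{G_0}$ denotes probability with respect to the random data $(x_i,y_i)_{i=1}^n$. Empirical risk: $I_n(G)=\frac1n\sum_{i=1}^n\big(-2\langle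 G(x_i),y_i\rangle_{\mathcal Y}+\|G(x_i)\|_{\mathcal Y}^2\big)$, $G\in\mathbf G$. Norms: $\|G\|_{\infty,D}=\sup_{x\in D}\|G(x)\|_{\mathcal Y}$, $\|G\|_{L^2(\gamma)}^2=\int_{\mathcal X}\|G(x)\|_{\mathcal Y}^2\,d\gamma(x)$, $\|G\|_n^2=\frac1n\sum_{i=1}^n\|G(x_i)\|_{\mathcal Y}^2$. Localized class: $\mathbf G_n^*(\delta)=\{G\in\mathbf G:\|G-G^*\|_n\le\delta\}$. For a pseudometric space $(T,d)$, $N(T,d,\rho)$ is the minimal number of open $\rho$-balls needed to cover $T$ and $H(T,d,\rho)=\log N(T,d,\rho)$. Entropy integral: $J(\mathbf G_n^*(\delta),\|\cdot\|_n)=\int_0^\delta H(\mathbf G_n^*(\delta),\|\cdot\|_n,\rho)^{1/2}\,d\rho$.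
   Formalization: White noise is taken in a version whose noise term is a.s. sup-norm continuous on the class (else a modification at a random point breaks the claim); Hilbert spaces are closed subspaces of l², the noise space has a fixed large type, and the data law is the product of design and noise. *)

theory Defs
  imports "HOL-Probability.Probability"
begin

section \<open>The Hilbert space of square-summable real sequences\<close>

text \<open>
  The constant of the theorem does not depend on the Hilbert spaces, and HOL cannot quantify over
  types below an existential quantifier.  Separable real Hilbert spaces are therefore quantified
  over as the closed linear subspaces of the one space \<open>l2\<close>.  The theorem
  \<open>separable_Hilbert_embeds_l2\<close> below shows that nothing is lost: every type that is a separable
  real Hilbert space is linearly isometric to such a subspace.
\<close>

typedef l2 = "{f :: nat \<Rightarrow> real. summable (\<lambda>k. (f k)\<^sup>2)}"
  morphisms coord Abs_l2
  by (rule exI[of _ "\<lambda>_. 0"]) simp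

setup_lifting type_definition_l2

lemma summable_coord_sq: "summable (\<lambda>k. (coord x k)\<^sup>2)"
  using coord[of x] by simp

lemma summable_mult_sq:
  fixes f g :: "nat \<Rightarrow> real"
  assumes "summable (\<lambda>k. (f k)\<^sup>2)" "summable (\<lambda>k. (g k)\<^sup>2)"
  shows "summable (\<lambda>k. f k * g k)"
proof (rule summable_comparison_test')
  show "summable (\<lambda>k. (f k)\<^sup>2 + (g k)\<^sup>2)" using assms by (rule summable_add)
  show "norm (f k * g k) \<le> (f k)\<^sup>2 + (g k)\<^sup>2" if "k \<ge> 0" for k
  proof -
    have "2 * (\<bar>f k\<bar> * \<bar>g k\<bar>) \<le> (f k)\<^sup>2 + (g k)\<^sup>2"
      using sum_squares_bound[of "\<bar>f k\<bar>" "\<bar>g k\<bar>"] by (simp add: mult.assoc)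
    moreover have "0 \<le> \<bar>f k\<bar> * \<bar>g k\<bar>" by simp
    ultimately have "\<bar>f k\<bar> * \<bar>g k\<bar> \<le> (f k)\<^sup>2 + (g k)\<^sup>2" by linarith
    then show ?thesis by (simp add: abs_mult)
  qed
qed

lemma summable_add_sq:
  fixes f g :: "nat \<Rightarrow> real"
  assumes "summable (\<lambda>k. (f k)\<^sup>2)" "summable (\<lambda>k. (g k)\<^sup>2)"
  shows "summable (\<lambda>k. (f k + g k)\<^sup>2)"
proof -
  have "summable (\<lambda>k. (f k)\<^sup>2 + (g k)\<^sup>2 + 2 * (f k * g k))"
    using assms by (intro summable_add summable_mult summable_mult_sq)
  then show ?thesis by (simp add: power2_sum mult.assoc)
qed

instantiation l2 :: real_vector
begin

lift_definition zero_l2 :: l2 is "\<lambda>_. 0" by simp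

lift_definition plus_l2 :: "l2 \<Rightarrow> l2 \<Rightarrow> l2" is "\<lambda>f g k. f k + g k"
  by (simp add: summable_add_sq)

lift_definition uminus_l2 :: "l2 \<Rightarrow> l2" is "\<lambda>f k. - f k" by simp

lift_definition minus_l2 :: "l2 \<Rightarrow> l2 \<Rightarrow> l2" is "\<lambda>f g k. f k - g k"
proof -
  fix f g :: "nat \<Rightarrow> real"
  assume "summable (\<lambda>k. (f k)\<^sup>2)" "summable (\<lambda>k. (g k)\<^sup>2)"
  then show "summable (\<lambda>k. (f k - g k)\<^sup>2)"
    using summable_add_sq[of f "\<lambda>k. - g k"] by simp
qed

lift_definition scaleR_l2 :: "real \<Rightarrow> l2 \<Rightarrow> l2" is "\<lambda>c f k. c * f k"
  by (simp add: power_mult_distrib summable_mult)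

instance
  by standard (transfer; simp add: algebra_simps fun_eq_iff)+

end

instantiation l2 :: real_inner
begin

lift_definition inner_l2 :: "l2 \<Rightarrow> l2 \<Rightarrow> real" is "\<lambda>f g. \<Sum>k. f k * g k" .

definition norm_l2 :: "l2 \<Rightarrow> real" where "norm_l2 x = sqrt (inner x x)"

definition dist_l2 :: "l2 \<Rightarrow> l2 \<Rightarrow> real" where "dist_l2 x y = norm (x - y)"

definition sgn_l2 :: "l2 \<Rightarrow> l2" where "sgn_l2 x = x /\<^sub>R norm x"

definition uniformity_l2 :: "(l2 \<times> l2) filter" where
  "uniformity_l2 = (INF e\<in>{0 <..}. principal {(x, y). dist x y < e})"

definition open_l2 :: "l2 set \<Rightarrow> bool" where
  "open_l2 U = (\<forall>x\<in>U. \<forall>\<^sub>F (x', y) in uniformity. x' = x \<longrightarrow> y \<in> U)"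

instance
proof
  fix x y z :: l2 and r :: real
  show "dist x y = norm (x - y)" by (rule dist_l2_def)
  show "sgn x = x /\<^sub>R norm x" by (rule sgn_l2_def)
  show "norm x = sqrt (inner x x)" by (rule norm_l2_def)
  show "inner x y = inner y x" by transfer (simp add: mult.commute)
  show "inner (x + y) z = inner x z + inner y z"
    by transfer (simp add: suminf_add summable_mult_sq algebra_simps)
  show "inner (r *\<^sub>R x) y = r * inner x y"
    by transfer (simp add: suminf_mult summable_mult_sq mult.assoc)
  show "0 \<le> inner x x"
    by transfer (simp add: suminf_nonneg summable_mult_sq)
  show "inner x x = 0 \<longleftrightarrow> x = 0"
    by transfer (auto simp: suminf_eq_zero_iff summable_mult_sq fun_eq_iff)
  show "uniformity = (INF e\<in>{0 <..}. principal {(x :: l2, y). dist x y < e})"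
    by (rule uniformity_l2_def)
  show "open U = (\<forall>x\<in>U. \<forall>\<^sub>F (x', y) in uniformity. x' = x \<longrightarrow> y \<in> U)" for U :: "l2 set"
    by (rule open_l2_def)
qed

end

lemma l2_norm_sq: "(norm (x :: l2))\<^sup>2 = (\<Sum>k. (coord x k)\<^sup>2)"
  unfolding power2_norm_eq_inner inner_l2.rep_eq by (simp add: power2_eq_square)

lemma l2_partial_sum_le: "(\<Sum>k<K. (coord x k)\<^sup>2) \<le> (norm x)\<^sup>2"
  unfolding l2_norm_sq by (rule sum_le_suminf[OF summable_coord_sq]) auto

lemma l2_norm_le:
  assumes "\<And>K. (\<Sum>k<K. (coord x k)\<^sup>2) \<le> e\<^sup>2" "0 \<le> e"
  shows "norm x \<le> e"
proof -
  have "(norm x)\<^sup>2 \<le> e\<^sup>2"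
    unfolding l2_norm_sq by (rule suminf_le_const[OF summable_coord_sq]) (use assms in auto)
  then show ?thesis using assms(2) by (rule power2_le_imp_le)
qed

lemma l2_coord_le: "\<bar>coord x k\<bar> \<le> norm x"
proof -
  have "(coord x k)\<^sup>2 \<le> (\<Sum>j<Suc k. (coord x j)\<^sup>2)"
    by (simp add: sum_nonneg)
  also have "\<dots> \<le> (norm x)\<^sup>2" by (rule l2_partial_sum_le)
  finally show ?thesis by (metis abs_le_square_iff abs_norm_cancel)
qed

instance l2 :: complete_space
proof
  fix X :: "nat \<Rightarrow> l2"
  assume X: "Cauchy X"
  have "convergent (\<lambda>m. coord (X m) k)" for k
    unfolding Cauchy_convergent_iff[symmetric]
  proof (rule metric_CauchyI)
    fix e :: real assume "0 < e"
    then obtain N where N: "\<And>m n. m \<ge> N \<Longrightarrow> n \<ge> N \<Longrightarrow> dist (X m) (X n) < e"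
      using X unfolding Cauchy_def by meson
    have "dist (coord (X m) k) (coord (X n) k) < e" if "m \<ge> N" "n \<ge> N" for m n
      using l2_coord_le[of "X m - X n" k] N[OF that]
      by (simp add: dist_norm minus_l2.rep_eq)
    then show "\<exists>N. \<forall>m\<ge>N. \<forall>n\<ge>N. dist (coord (X m) k) (coord (X n) k) < e" by blast
  qed
  then obtain f where f: "\<And>k. (\<lambda>m. coord (X m) k) \<longlonglongrightarrow> f k"
    unfolding convergent_def by metis
  have key: "\<exists>N. \<forall>n\<ge>N. \<forall>K. (\<Sum>k<K. (f k - coord (X n) k)\<^sup>2) \<le> e\<^sup>2" if "0 < e" for e
  proof -
    obtain N where N: "\<And>m n. m \<ge> N \<Longrightarrow> n \<ge> N \<Longrightarrow> dist (X m) (X n) < e"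
      using X \<open>0 < e\<close> unfolding Cauchy_def by meson
    have "(\<Sum>k<K. (f k - coord (X n) k)\<^sup>2) \<le> e\<^sup>2" if "n \<ge> N" for n K
    proof (rule LIMSEQ_le_const2)
      show "(\<lambda>m. \<Sum>k<K. (coord (X m) k - coord (X n) k)\<^sup>2) \<longlonglongrightarrow> (\<Sum>k<K. (f k - coord (X n) k)\<^sup>2)"
        by (intro tendsto_intros f)
      have "(\<Sum>k<K. (coord (X m) k - coord (X n) k)\<^sup>2) \<le> e\<^sup>2" if "m \<ge> N" for m
      proof -
        have "(\<Sum>k<K. (coord (X m) k - coord (X n) k)\<^sup>2) \<le> (norm (X m - X n))\<^sup>2"
          using l2_partial_sum_le[of "X m - X n" K] by (simp add: minus_l2.rep_eq)
        also have "\<dots> \<le> e\<^sup>2"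
          using N[OF \<open>m \<ge> N\<close> \<open>n \<ge> N\<close>] by (intro power_mono) (auto simp: dist_norm)
        finally show ?thesis .
      qed
      then show "\<exists>N. \<forall>m\<ge>N. (\<Sum>k<K. (coord (X m) k - coord (X n) k)\<^sup>2) \<le> e\<^sup>2" by blast
    qed
    then show ?thesis by blast
  qed
  obtain N1 where N1: "\<And>K. (\<Sum>k<K. (f k - coord (X N1) k)\<^sup>2) \<le> 1\<^sup>2"
    using key[of 1] by auto
  have "summable (\<lambda>k. (f k - coord (X N1) k)\<^sup>2)"
    by (rule bounded_imp_summable[where B = "1"])
       (use N1[of "Suc _"] in \<open>auto simp: lessThan_Suc_atMost\<close>)
  from summable_add_sq[OF this summable_coord_sq[of "X N1"]]
  have "summable (\<lambda>k. (f k)\<^sup>2)" by simp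
  then have L: "coord (Abs_l2 f) = f" by (simp add: Abs_l2_inverse)
  have "X \<longlonglongrightarrow> Abs_l2 f"
  proof (rule metric_LIMSEQ_I)
    fix e :: real assume "0 < e"
    then obtain N where N: "\<And>n K. n \<ge> N \<Longrightarrow> (\<Sum>k<K. (f k - coord (X n) k)\<^sup>2) \<le> (e/2)\<^sup>2"
      using key[of "e/2"] by auto
    have "dist (X n) (Abs_l2 f) < e" if "n \<ge> N" for n
    proof -
      have "norm (Abs_l2 f - X n) \<le> e/2"
        by (rule l2_norm_le) (use N[OF that] \<open>0 < e\<close> in \<open>auto simp: minus_l2.rep_eq L\<close>)
      then show ?thesis using \<open>0 < e\<close> by (simp add: dist_norm norm_minus_commute)
    qed
    then show "\<exists>N. \<forall>n\<ge>N. dist (X n) (Abs_l2 f) < e" by blast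
  qed
  then show "convergent X" unfolding convergent_def by blast
qed

instance l2 :: banach ..

instance l2 :: second_countable_topology
proof
  define D where "D = (\<lambda>qs. Abs_l2 (\<lambda>k. if k < length qs then real_of_rat (qs ! k) else 0)) ` UNIV"
  have fin: "coord (Abs_l2 (\<lambda>k. if k < n then g k else 0)) = (\<lambda>k. if k < n then g k else 0)"
    for n :: nat and g
    by (rule Abs_l2_inverse, simp, rule summable_finite[of "{..<n}"]) auto
  have "countable D" unfolding D_def by simp
  have dense: "\<exists>d\<in>D. dist x d < e" if "0 < e" for x and e :: real
  proof -
    have "(\<lambda>n. \<Sum>k. (coord x (k + n))\<^sup>2) \<longlonglongrightarrow> 0"
      using suminf_exist_split2[OF summable_coord_sq[of x]] by simp
    then obtain n where n: "\<bar>\<Sum>k. (coord x (k + n))\<^sup>2\<bar> < (e/2)\<^sup>2"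
      using LIMSEQ_D[of _ 0 "(e/2)\<^sup>2"] \<open>0 < e\<close> by force
    define r where "r = e / (2 * sqrt (real (Suc n)))"
    have "r > 0" using \<open>0 < e\<close> by (simp add: r_def)
    have "\<exists>q. \<bar>coord x k - real_of_rat q\<bar> < r" for k
    proof -
      obtain q where "coord x k - r < real_of_rat q" "real_of_rat q < coord x k"
        using of_rat_dense[of "coord x k - r" "coord x k"] \<open>r > 0\<close> by auto
      then have "\<bar>coord x k - real_of_rat q\<bar> < r" by linarith
      then show ?thesis ..
    qed
    then obtain q where q: "\<And>k. \<bar>coord x k - real_of_rat (q k)\<bar> < r" by metis
    define d where "d = Abs_l2 (\<lambda>k. if k < n then real_of_rat (q k) else 0)"
    have "d = Abs_l2 (\<lambda>k. if k < length (map q [0..<n]) then real_of_rat (map q [0..<n] ! k) else 0)"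
      unfolding d_def by (rule arg_cong[where f = Abs_l2]) auto
    then have "d \<in> D" unfolding D_def by blast
    have cd: "coord d k = (if k < n then real_of_rat (q k) else 0)" for k
      unfolding d_def by (simp add: fin)
    have "(norm (x - d))\<^sup>2 = (\<Sum>k. (coord (x - d) (k + n))\<^sup>2) + (\<Sum>k<n. (coord (x - d) k)\<^sup>2)"
      unfolding l2_norm_sq by (rule suminf_split_initial_segment[OF summable_coord_sq])
    also have "(\<Sum>k. (coord (x - d) (k + n))\<^sup>2) = (\<Sum>k. (coord x (k + n))\<^sup>2)"
      by (simp add: minus_l2.rep_eq cd)
    also have "(\<Sum>k<n. (coord (x - d) k)\<^sup>2) \<le> (\<Sum>k<n. r\<^sup>2)"
    proof (rule sum_mono)
      fix k assume "k \<in> {..<n}"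
      then have "\<bar>coord (x - d) k\<bar> \<le> \<bar>r\<bar>"
        using q[of k] by (simp add: minus_l2.rep_eq cd)
      then show "(coord (x - d) k)\<^sup>2 \<le> r\<^sup>2" by (rule abs_le_square_iff[THEN iffD1])
    qed
    also have "(\<Sum>k<n. r\<^sup>2) \<le> (e/2)\<^sup>2"
      by (simp add: r_def power_divide power_mult_distrib field_simps)
    finally have "(norm (x - d))\<^sup>2 < (e/2)\<^sup>2 + (e/2)\<^sup>2" using n by linarith
    also have "\<dots> \<le> e\<^sup>2" by (simp add: power_divide)
    finally have "norm (x - d) < e" using \<open>0 < e\<close> by (simp add: power_less_imp_less_base)
    then show ?thesis using \<open>d \<in> D\<close> by (auto simp: dist_norm)
  qed
  define B where "B = (\<lambda>(d, r). ball d (real_of_rat r)) ` (D \<times> UNIV)"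
  have "countable B" unfolding B_def using \<open>countable D\<close> by simp
  moreover have "topological_basis B"
  proof (rule topological_basisI)
    show "open b" if "b \<in> B" for b using that by (auto simp: B_def)
    fix U :: "l2 set" and x assume "open U" "x \<in> U"
    then obtain e where e: "e > 0" "ball x e \<subseteq> U" by (meson openE)
    obtain d where d: "d \<in> D" "dist x d < e/3" using dense[of "e/3" x] e by auto
    obtain q where q: "e/3 < real_of_rat q" "real_of_rat q < e/2"
      using of_rat_dense[of "e/3" "e/2"] e by auto
    have "x \<in> ball d (real_of_rat q)" using d q by (simp add: dist_commute)
    moreover have "ball d (real_of_rat q) \<subseteq> ball x e"
    proof
      fix z assume "z \<in> ball d (real_of_rat q)"
      then show "z \<in> ball x e" using dist_triangle[of x z d] d q by simp
    qed
    ultimately show "\<exists>b\<in>B. x \<in> b \<and> b \<subseteq> U" using e d unfolding B_def by blast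
  qed
  ultimately show "\<exists>B :: l2 set set. countable B \<and> open = generate_topology B"
    using topological_basis_imp_subbasis by blast
qed

fun gram_schmidt :: "(nat \<Rightarrow> 'a :: real_inner) \<Rightarrow> nat \<Rightarrow> 'a" where
  "gram_schmidt d k = sgn (d k - (\<Sum>j<k. inner (d k) (gram_schmidt d j) *\<^sub>R gram_schmidt d j))"

declare gram_schmidt.simps[simp del]

lemma gram_schmidt_norm: "inner (gram_schmidt d k) (gram_schmidt d k) \<in> {0, 1}"
  by (subst (1 2) gram_schmidt.simps) (auto simp: dot_square_norm norm_sgn)

lemma gram_schmidt_orth_less: "j < k \<Longrightarrow> inner (gram_schmidt d k) (gram_schmidt d j) = 0"
proof (induction k arbitrary: j rule: less_induct)
  case (less k)
  let ?e = "gram_schmidt d"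
  have orth: "inner (?e i) (?e j) = 0" if "i < k" "i \<noteq> j" for i
    using less.IH[of i j] less.IH[of j i] less.prems that
    by (metis inner_commute nat_neq_iff)
  have "inner (\<Sum>i<k. inner (d k) (?e i) *\<^sub>R ?e i) (?e j)
      = (\<Sum>i<k. if i = j then inner (d k) (?e j) * inner (?e j) (?e j) else 0)"
    unfolding inner_sum_left by (rule sum.cong) (auto simp: orth)
  also have "\<dots> = inner (d k) (?e j) * inner (?e j) (?e j)" using less.prems by simp
  also have "\<dots> = inner (d k) (?e j)"
    using gram_schmidt_norm[of d j] by auto
  finally have "inner (d k - (\<Sum>i<k. inner (d k) (?e i) *\<^sub>R ?e i)) (?e j) = 0"
    by (simp add: inner_diff_left)
  then show ?case by (subst gram_schmidt.simps) (simp add: sgn_div_norm)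
qed

lemma gram_schmidt_orth: "j \<noteq> k \<Longrightarrow> inner (gram_schmidt d k) (gram_schmidt d j) = 0"
  by (metis gram_schmidt_orth_less inner_commute nat_neq_iff)

lemma gram_schmidt_inner_sum:
  assumes "j < K"
  shows "inner (\<Sum>i<K. c i *\<^sub>R gram_schmidt d i) (gram_schmidt d j)
    = c j * inner (gram_schmidt d j) (gram_schmidt d j)"
proof -
  have "inner (\<Sum>i<K. c i *\<^sub>R gram_schmidt d i) (gram_schmidt d j)
    = (\<Sum>i<K. if i = j then c j * inner (gram_schmidt d j) (gram_schmidt d j) else 0)"
    unfolding inner_sum_left by (rule sum.cong) (auto simp: gram_schmidt_orth)
  then show ?thesis using assms by simp
qed

lemma gram_schmidt_expand: "\<exists>c. d k = (\<Sum>i<Suc k. c i *\<^sub>R gram_schmidt d i)"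
proof -
  let ?u = "d k - (\<Sum>j<k. inner (d k) (gram_schmidt d j) *\<^sub>R gram_schmidt d j)"
  have "gram_schmidt d k = sgn ?u" by (rule gram_schmidt.simps)
  then have "?u = norm ?u *\<^sub>R gram_schmidt d k"
    by (cases "?u = 0") (simp_all add: sgn_div_norm)
  then have "d k = (\<Sum>i<Suc k. (if i = k then norm ?u else inner (d k) (gram_schmidt d i)) *\<^sub>R
      gram_schmidt d i)"
    by (simp add: algebra_simps)
  then show ?thesis by (rule exI[where x = "\<lambda>i. if i = k then norm ?u else inner (d k) (gram_schmidt d i)"])
qed

lemma gram_schmidt_bessel:
  fixes v :: "'a :: real_inner" and d :: "nat \<Rightarrow> 'a"
  defines "P K \<equiv> \<Sum>i<K. inner v (gram_schmidt d i) *\<^sub>R gram_schmidt d i"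
  shows "(norm (v - P K))\<^sup>2 = (norm v)\<^sup>2 - (\<Sum>i<K. (inner v (gram_schmidt d i))\<^sup>2)"
proof -
  have "inner (P K) (gram_schmidt d j) = inner v (gram_schmidt d j)" if "j < K" for j
    unfolding P_def gram_schmidt_inner_sum[OF that] using gram_schmidt_norm[of d j] by auto
  then have PP: "inner (P K) (P K) = (\<Sum>i<K. (inner v (gram_schmidt d i))\<^sup>2)"
    by (subst (2) P_def) (simp add: inner_sum_right power2_eq_square)
  have vP: "inner v (P K) = (\<Sum>i<K. (inner v (gram_schmidt d i))\<^sup>2)"
    by (simp add: P_def inner_sum_right power2_eq_square)
  show ?thesis
    unfolding power2_norm_eq_inner
    by (simp add: inner_diff_left inner_diff_right PP vP inner_commute[of "P K" v])
qed

theorem separable_Hilbert_embeds_l2: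
  "\<exists>T :: 'a :: {real_inner, complete_space, second_countable_topology} \<Rightarrow> l2.
     linear T \<and> (\<forall>x y. inner (T x) (T y) = inner x y) \<and> subspace (range T) \<and> closed (range T)"
proof -
  obtain D :: "'a set" where D: "countable D" "\<And>U. open U \<Longrightarrow> U \<noteq> {} \<Longrightarrow> \<exists>d\<in>D. d \<in> U"
    using countable_dense_exists by blast
  have "D \<noteq> {}" using D(2)[of UNIV] by auto
  define d where "d = from_nat_into D"
  have dense: "\<exists>k. norm (v - d k) < e" if "0 < e" for v e
  proof -
    obtain x where "x \<in> D" "x \<in> ball v e"
      using D(2)[of "ball v e"] \<open>0 < e\<close> by auto
    then show ?thesis using from_nat_into_surj[OF D(1), of x]
      by (auto simp: d_def dist_norm)
  qed
  let ?e = "gram_schmidt d"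
  let ?P = "\<lambda>v K. \<Sum>i<K. inner v (?e i) *\<^sub>R ?e i"
  have part: "(\<Sum>i<K. (inner v (?e i))\<^sup>2) \<le> (norm v)\<^sup>2" for v K
    using gram_schmidt_bessel[of v d K] by (smt (verit) zero_le_power2)
  have sm: "summable (\<lambda>i. (inner v (?e i))\<^sup>2)" for v
    by (rule bounded_imp_summable[where B = "(norm v)\<^sup>2"])
       (use part[of v "Suc _"] in \<open>auto simp: lessThan_Suc_atMost\<close>)
  have lower: "(norm v)\<^sup>2 \<le> (\<Sum>i. (inner v (?e i))\<^sup>2)" for v
  proof (rule field_le_epsilon)
    fix r :: real assume "0 < r"
    then obtain k where k: "norm (v - d k) < sqrt r" using dense[of "sqrt r" v] by auto
    let ?K = "Suc k"
    let ?Q = "v - ?P v ?K"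
    obtain c where c: "d k = (\<Sum>i<?K. c i *\<^sub>R ?e i)" using gram_schmidt_expand by blast
    have Q0: "inner ?Q (?e j) = 0" if "j < ?K" for j
      using gram_schmidt_inner_sum[OF that, of "\<lambda>i. inner v (?e i)" d] gram_schmidt_norm[of d j]
      by (auto simp: inner_diff_left)
    have "inner ?Q (?P v ?K - d k) = 0"
      unfolding c inner_diff_right inner_sum_right inner_scaleR_right
      by (simp add: Q0 del: sum.lessThan_Suc)
    then have "(norm (v - d k))\<^sup>2 = (norm ?Q)\<^sup>2 + (norm (?P v ?K - d k))\<^sup>2"
      using norm_add_Pythagorean[of ?Q "?P v ?K - d k"]
      by (simp add: orthogonal_def del: sum.lessThan_Suc)
    then have "(norm ?Q)\<^sup>2 \<le> (norm (v - d k))\<^sup>2" by simp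
    also have "\<dots> \<le> (sqrt r)\<^sup>2" using k by (intro power_mono) auto
    finally have "(norm v)\<^sup>2 \<le> (\<Sum>i<?K. (inner v (?e i))\<^sup>2) + r"
      using gram_schmidt_bessel[of v d ?K] \<open>0 < r\<close> by (simp del: sum.lessThan_Suc)
    also have "(\<Sum>i<?K. (inner v (?e i))\<^sup>2) \<le> (\<Sum>i. (inner v (?e i))\<^sup>2)"
      by (rule sum_le_suminf[OF sm]) auto
    finally show "(norm v)\<^sup>2 \<le> (\<Sum>i. (inner v (?e i))\<^sup>2) + r" by simp
  qed
  define T where "T v = Abs_l2 (\<lambda>i. inner v (?e i))" for v
  have cT: "coord (T v) i = inner v (?e i)" for v i
    unfolding T_def by (simp add: Abs_l2_inverse sm)
  have nT: "norm (T v) = norm v" for v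
  proof -
    have "(\<Sum>i. (inner v (?e i))\<^sup>2) \<le> (norm v)\<^sup>2"
      by (rule suminf_le_const[OF sm part])
    then have "(norm (T v))\<^sup>2 = (norm v)\<^sup>2" using lower[of v] by (simp add: l2_norm_sq cT)
    then show ?thesis by simp
  qed
  have lin: "linear T"
    by (rule linearI; rule coord_inject[THEN iffD1])
       (auto simp: cT plus_l2.rep_eq scaleR_l2.rep_eq inner_add_left fun_eq_iff)
  have inT: "inner (T x) (T y) = inner x y" for x y
  proof -
    have "(norm (T x + T y))\<^sup>2 = (norm (x + y))\<^sup>2" by (metis lin linear_add nT)
    moreover have "inner (T z) (T z) = inner z z" for z
      unfolding power2_norm_eq_inner[symmetric] nT ..
    ultimately show ?thesis unfolding power2_norm_eq_inner
      by (simp add: inner_add_left inner_add_right inner_commute[of y x]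
          inner_commute[of "T y" "T x"])
  qed
  have "bounded_linear T"
    using lin by (rule bounded_linear.intro) (auto simp: bounded_linear_axioms_def nT intro!: exI[of _ 1])
  then have "Topological_Spaces.complete (T ` UNIV)"
    by (intro complete_isometric_image[where e = 1]) (simp_all add: nT complete_UNIV)
  then have "closed (range T)" by (rule complete_imp_closed)
  moreover have "subspace (range T)" using lin by (rule linear_subspace_image) (rule subspace_UNIV)
  ultimately show ?thesis using lin inT by blast
qed

section \<open>Norms on classes of maps\<close>

definition measure_support :: "'a :: topological_space measure \<Rightarrow> 'a set" where
  "measure_support \<gamma> =
    {x \<in> space \<gamma>. \<forall>U. open U \<longrightarrow> x \<in> U \<longrightarrow> 0 < emeasure \<gamma> (U \<inter> space \<gamma>)}"

definition sup_norm :: "'a set \<Rightarrow> ('a \<Rightarrow> 'b :: real_normed_vector) \<Rightarrow> ennreal" where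
  "sup_norm D G = (SUP x\<in>D. ennreal (norm (G x)))"

definition L2_norm :: "'a measure \<Rightarrow> ('a \<Rightarrow> 'b :: real_normed_vector) \<Rightarrow> real" where
  "L2_norm \<gamma> G = sqrt (\<integral>x. (norm (G x))\<^sup>2 \<partial>\<gamma>)"

definition emp_norm :: "nat \<Rightarrow> (nat \<Rightarrow> 'a) \<Rightarrow> ('a \<Rightarrow> 'b :: real_normed_vector) \<Rightarrow> real" where
  "emp_norm n x G = sqrt (1 / n * (\<Sum>i<n. (norm (G (x i)))\<^sup>2))"

text \<open>Pseudometrics are \<^typ>\<open>ennreal\<close>-valued because maps in a class may be unbounded.\<close>

definition sup_dist :: "'a set \<Rightarrow> ('a \<Rightarrow> 'b :: real_normed_vector) \<Rightarrow> ('a \<Rightarrow> 'b) \<Rightarrow> ennreal" where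
  "sup_dist D G H = sup_norm D (\<lambda>x. G x - H x)"

definition emp_dist ::
  "nat \<Rightarrow> (nat \<Rightarrow> 'a) \<Rightarrow> ('a \<Rightarrow> 'b :: real_normed_vector) \<Rightarrow> ('a \<Rightarrow> 'b) \<Rightarrow> ennreal" where
  "emp_dist n x G H = ennreal (emp_norm n x (\<lambda>z. G z - H z))"

definition local_class ::
  "('a \<Rightarrow> 'b :: real_normed_vector) set \<Rightarrow> ('a \<Rightarrow> 'b) \<Rightarrow> nat \<Rightarrow> (nat \<Rightarrow> 'a) \<Rightarrow> real \<Rightarrow> ('a \<Rightarrow> 'b) set"
where
  "local_class GG Gst n x \<delta> = {G \<in> GG. emp_norm n x (\<lambda>z. G z - Gst z) \<le> \<delta>}"

section \<open>Pseudometric topology and metric entropy\<close>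

definition pm_ball :: "'t set \<Rightarrow> ('t \<Rightarrow> 't \<Rightarrow> ennreal) \<Rightarrow> 't \<Rightarrow> real \<Rightarrow> 't set" where
  "pm_ball T d s \<rho> = {t \<in> T. d s t < ennreal \<rho>}"

definition pm_topology :: "'t set \<Rightarrow> ('t \<Rightarrow> 't \<Rightarrow> ennreal) \<Rightarrow> 't topology" where
  "pm_topology T d = topology (\<lambda>U. U \<subseteq> T \<and> (\<forall>s\<in>U. \<exists>\<rho>>0. pm_ball T d s \<rho> \<subseteq> U))"

lemma openin_pm_topology:
  "openin (pm_topology T d) U \<longleftrightarrow> U \<subseteq> T \<and> (\<forall>s\<in>U. \<exists>\<rho>>0. pm_ball T d s \<rho> \<subseteq> U)"
proof -
  have "istopology (\<lambda>U. U \<subseteq> T \<and> (\<forall>s\<in>U. \<exists>\<rho>>0. pm_ball T d s \<rho> \<subseteq> U))"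
    unfolding istopology_def
  proof (intro conjI allI impI)
    fix U V
    assume U: "U \<subseteq> T \<and> (\<forall>s\<in>U. \<exists>\<rho>>0. pm_ball T d s \<rho> \<subseteq> U)"
      and V: "V \<subseteq> T \<and> (\<forall>s\<in>V. \<exists>\<rho>>0. pm_ball T d s \<rho> \<subseteq> V)"
    show "U \<inter> V \<subseteq> T" using U by blast
    show "\<forall>s\<in>U \<inter> V. \<exists>\<rho>>0. pm_ball T d s \<rho> \<subseteq> U \<inter> V"
    proof
      fix s assume "s \<in> U \<inter> V"
      then obtain a b where "a > 0" "pm_ball T d s a \<subseteq> U" "b > 0" "pm_ball T d s b \<subseteq> V"
        using U V by blast
      moreover have "pm_ball T d s (min a b) \<subseteq> pm_ball T d s a \<inter> pm_ball T d s b"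
        by (auto simp: pm_ball_def intro: less_le_trans[OF _ ennreal_leI])
      ultimately show "\<exists>\<rho>>0. pm_ball T d s \<rho> \<subseteq> U \<inter> V"
        by (intro exI[of _ "min a b"]) auto
    qed
  next
    fix \<U>
    assume *: "\<forall>U\<in>\<U>. U \<subseteq> T \<and> (\<forall>s\<in>U. \<exists>\<rho>>0. pm_ball T d s \<rho> \<subseteq> U)"
    then show "\<Union>\<U> \<subseteq> T" by blast
    show "\<forall>s\<in>\<Union>\<U>. \<exists>\<rho>>0. pm_ball T d s \<rho> \<subseteq> \<Union>\<U>"
    proof
      fix s assume "s \<in> \<Union>\<U>"
      then obtain U where "U \<in> \<U>" "s \<in> U" by blast
      then show "\<exists>\<rho>>0. pm_ball T d s \<rho> \<subseteq> \<Union>\<U>" using * by (meson Union_upper subset_trans)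
    qed
  qed
  then show ?thesis unfolding pm_topology_def by (simp add: topology_inverse')
qed

lemma topspace_pm_topology [simp]: "topspace (pm_topology T d) = T"
proof
  show "topspace (pm_topology T d) \<subseteq> T"
    using openin_pm_topology[of T d "topspace (pm_topology T d)"] by simp
  have "openin (pm_topology T d) T"
    unfolding openin_pm_topology by (auto simp: pm_ball_def intro!: exI[of _ 1])
  then show "T \<subseteq> topspace (pm_topology T d)" by (rule openin_subset)
qed

definition pm_borel :: "'t set \<Rightarrow> ('t \<Rightarrow> 't \<Rightarrow> ennreal) \<Rightarrow> 't measure" where
  "pm_borel T d = sigma T {U. openin (pm_topology T d) U}"

text \<open>Centres of covering balls lie in the covered space itself; the value is \<open>\<infinity>\<close> if there is no
  finite cover.\<close>

definition covering_number :: "'t set \<Rightarrow> ('t \<Rightarrow> 't \<Rightarrow> ennreal) \<Rightarrow> real \<Rightarrow> enat" where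
  "covering_number T d \<rho> =
    (INF S\<in>{S. finite S \<and> S \<subseteq> T \<and> T \<subseteq> (\<Union>s\<in>S. pm_ball T d s \<rho>)}. enat (card S))"

definition metric_entropy :: "'t set \<Rightarrow> ('t \<Rightarrow> 't \<Rightarrow> ennreal) \<Rightarrow> real \<Rightarrow> ennreal" where
  "metric_entropy T d \<rho> =
    (case covering_number T d \<rho> of enat N \<Rightarrow> ennreal (ln (real N)) | \<infinity> \<Rightarrow> \<infinity>)"

definition ennreal_sqrt :: "ennreal \<Rightarrow> ennreal" where
  "ennreal_sqrt h = (if h = \<infinity> then \<infinity> else ennreal (sqrt (enn2real h)))"

definition entropy_integral :: "'t set \<Rightarrow> ('t \<Rightarrow> 't \<Rightarrow> ennreal) \<Rightarrow> real \<Rightarrow> ennreal" where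
  "entropy_integral T d \<delta> = (\<integral>\<^sup>+\<rho>\<in>{0<..\<delta>}. ennreal_sqrt (metric_entropy T d \<rho>) \<partial>lborel)"

section \<open>Noise models and empirical risk\<close>

text \<open>
  In both noise models the noise enters as a functional: \<open>\<epsilon> i \<omega> f\<close> is the value of the pairing
  of the \<open>i\<close>-th noise variable with \<open>f \<in> Y\<close> at the sample point \<open>\<omega>\<close> of the noise space \<open>M\<close>.
  Indices run over \<open>{..<n}\<close>.  Gaussian laws may be degenerate.
\<close>

definition centered_gaussian :: "'w measure \<Rightarrow> ('w \<Rightarrow> real) \<Rightarrow> bool" where
  "centered_gaussian M Z \<longleftrightarrow>
    Z \<in> borel_measurable M \<and>
    ((AE \<omega> in M. Z \<omega> = 0) \<or> (\<exists>s>0. distributed M lborel Z (normal_density 0 s)))"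

definition white_noise_process ::
  "'w measure \<Rightarrow> 'b :: real_inner set \<Rightarrow> ('w \<Rightarrow> 'b \<Rightarrow> real) \<Rightarrow> bool" where
  "white_noise_process M Y W \<longleftrightarrow>
    (\<forall>A a. finite A \<longrightarrow> A \<subseteq> Y \<longrightarrow> centered_gaussian M (\<lambda>\<omega>. \<Sum>y\<in>A. a y * W \<omega> y)) \<and>
    (\<forall>y\<in>Y. \<forall>y'\<in>Y. (\<integral>\<omega>. W \<omega> y * W \<omega> y' \<partial>M) = inner y y')"

definition white_noise ::
  "'w measure \<Rightarrow> 'b :: real_inner set \<Rightarrow> nat \<Rightarrow> (nat \<Rightarrow> 'w \<Rightarrow> 'b \<Rightarrow> real) \<Rightarrow> bool" where
  "white_noise M Y n \<epsilon> \<longleftrightarrow>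
    prob_space M \<and>
    (\<forall>i<n. white_noise_process M Y (\<epsilon> i)) \<and>
    prob_space.indep_vars M (\<lambda>_. Pi\<^sub>M Y (\<lambda>_. borel)) (\<lambda>i \<omega>. restrict (\<epsilon> i \<omega>) Y) {..<n}"

definition subgaussian_noise ::
  "'w measure \<Rightarrow> 'b :: {real_inner, banach, second_countable_topology} set \<Rightarrow> nat \<Rightarrow>
    (nat \<Rightarrow> 'w \<Rightarrow> 'b \<Rightarrow> real) \<Rightarrow> bool" where
  "subgaussian_noise M Y n \<epsilon> \<longleftrightarrow>
    prob_space M \<and>
    (\<exists>e. prob_space.indep_vars M (\<lambda>_. restrict_space borel Y) e {..<n} \<and>
      (\<forall>i<n. integrable M (e i) \<and> (\<integral>\<omega>. e i \<omega> \<partial>M) = 0 \<and>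
        (\<forall>t\<ge>0. measure M {\<omega> \<in> space M. t \<le> norm (e i \<omega>)} \<le> 2 * exp (- t\<^sup>2 / 2)) \<and>
        (\<forall>\<omega>\<in>space M. \<forall>y\<in>Y. \<epsilon> i \<omega> y = inner (e i \<omega>) y)))"

text \<open>
  The sample space carries the design points and, independently of them, the noise.  The product
  form (rather than independence of processes on an abstract sample space) is what gives a
  meaning to \<open>\<epsilon> i \<omega> (G (x i))\<close>, the white noise process evaluated at a random point.
\<close>

definition sample_measure :: "nat \<Rightarrow> 'a measure \<Rightarrow> 'w measure \<Rightarrow> ((nat \<Rightarrow> 'a) \<times> 'w) measure" where
  "sample_measure n \<gamma> M = Pi\<^sub>M {..<n} (\<lambda>_. \<gamma>) \<Otimes>\<^sub>M M"

definition observation ::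
  "('a \<Rightarrow> 'b :: real_inner) \<Rightarrow> real \<Rightarrow> (nat \<Rightarrow> 'w \<Rightarrow> 'b \<Rightarrow> real) \<Rightarrow>
    (nat \<Rightarrow> 'a) \<times> 'w \<Rightarrow> nat \<Rightarrow> 'b \<Rightarrow> real" where
  "observation G0 \<sigma> \<epsilon> = (\<lambda>(x, \<omega>) i f. inner (G0 (x i)) f + \<sigma> * \<epsilon> i \<omega> f)"

definition empirical_risk ::
  "nat \<Rightarrow> (nat \<Rightarrow> 'a) \<Rightarrow> (nat \<Rightarrow> 'b \<Rightarrow> real) \<Rightarrow> ('a \<Rightarrow> 'b :: real_normed_vector) \<Rightarrow> real" where
  "empirical_risk n x y G = 1 / n * (\<Sum>i<n. - 2 * y i (G (x i)) + (norm (G (x i)))\<^sup>2)"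

text \<open>
  A Gaussian process is determined by its finite-dimensional laws only up to modification, and
  the modification matters for a minimizer over an uncountable class.  As usual, the white noise is
  taken in a version for which the noise term of the risk has continuous sample paths on the
  class; under the entropy bound of the theorem such a version exists by Dudley's theorem.
\<close>

definition continuous_noise_paths ::
  "nat \<Rightarrow> 'a :: topological_space measure \<Rightarrow> 'w measure \<Rightarrow> (nat \<Rightarrow> 'w \<Rightarrow> 'b \<Rightarrow> real) \<Rightarrow>
    ('a \<Rightarrow> 'b :: real_normed_vector) set \<Rightarrow> bool" where
  "continuous_noise_paths n \<gamma> M \<epsilon> GG \<longleftrightarrow>
    (AE (x, \<omega>) in sample_measure n \<gamma> M.
      continuous_map (pm_topology GG (sup_dist (measure_support \<gamma>))) euclideanreal
        (\<lambda>G. \<Sum>i<n. \<epsilon> i \<omega> (G (x i))))"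

definition risk_minimizer ::
  "nat \<Rightarrow> 'a :: topological_space measure \<Rightarrow> 'w measure \<Rightarrow> (nat \<Rightarrow> 'w \<Rightarrow> 'b \<Rightarrow> real) \<Rightarrow>
    ('a \<Rightarrow> 'b :: real_inner) \<Rightarrow> real \<Rightarrow> ('a \<Rightarrow> 'b) set \<Rightarrow>
    ((nat \<Rightarrow> 'a) \<times> 'w \<Rightarrow> 'a \<Rightarrow> 'b) \<Rightarrow> bool" where
  "risk_minimizer n \<gamma> M \<epsilon> G0 \<sigma> GG Ghat \<longleftrightarrow>
    Ghat \<in> sample_measure n \<gamma> M \<rightarrow>\<^sub>M pm_borel GG (sup_dist (measure_support \<gamma>)) \<and>
    (AE p in sample_measure n \<gamma> M. \<forall>G\<in>GG.
      empirical_risk n (fst p) (observation G0 \<sigma> \<epsilon> p) (Ghat p)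
        \<le> empirical_risk n (fst p) (observation G0 \<sigma> \<epsilon> p) G)"

text \<open>
  For the same reason as for the Hilbert spaces, the noise sample space has a fixed type, the
  sequences of paths on \<^typ>\<open>l2\<close>.  The measure on it, its sigma-algebra, its underlying set and
  the noise variables are arbitrary, so every probability space that injects into this type
  (path space itself and all Polish spaces among them) is covered by renaming sample points.
\<close>

type_synonym noise_sample = "nat \<Rightarrow> l2 \<Rightarrow> real"

end

theory Submission
  imports Defs
begin

text \<open>
  Everything is done conditionally on the design points \<open>x\<close>, where the noise term
  \<open>Z G = (\<Sum>i<n. \<epsilon> i \<omega> (G (x i)))\<close> has sub-Gaussian increments with respect to \<open>sqrt n\<close> times the
  empirical norm, for both noise models.  Dudley's chaining bounds \<open>Z G - Z Gst\<close> on a localized class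
  by the entropy integral; it runs over a sequence that is dense in the compact class, and continuity
  of the sample paths transfers the bound to the whole class.  Peeling over dyadic shells gives
  \<open>Z G - Z Gst < n u\<^sup>2 / (4 \<sigma>)\<close> with \<open>u = emp_norm (G - Gst)\<close>, simultaneously for all \<open>G\<close> with
  \<open>u \<ge> R / 8\<close>.  Comparing the empirical risks of \<open>Ghat\<close> and \<open>Gst\<close> contradicts this as soon as
  \<open>emp_norm (Ghat - G0) \<ge> R / 4\<close>.  A Chernoff bound for the lower tail of \<open>emp_norm (G - G0)\<close> at the
  centres of a sup-norm net of radius \<open>\<delta>'\<close> shows that this holds, up to an event of small
  probability in the design, whenever the \<open>L2\<close> norm of \<open>Ghat - G0\<close> is at least \<open>R\<close>.
\<close>

section \<open>Sub-Gaussian noise functionals\<close>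

text \<open>The entropy bound is centred at \<open>Gst\<close>, the loss at \<open>G0\<close>. A
  large constant reconciles them: the bias \<open>emp_norm (Gst - G0)\<close> is at most R / 64, so
  the empirical distances of the minimizer from \<open>G0\<close> and from \<open>Gst\<close> differ
  by a factor close to 1, and their squares lose only a fixed fraction. A supremum of the noise over
  an uncountable class need not be measurable, and the noise model controls increments only for
  given pairs of points. The exceptional events are therefore built from countably many increments,
  and all bounds are kept strict, so that a violation is an open condition on the class and is seen
  by a dense sequence. Empirical and \<open>L2\<close> norms are compared in one direction only. For
  bounded nonnegative variables the lower tail has an exponent linear in the mean, which gives the
  rate n R^2 / F^2, and one net suffices, since sup-norm closeness controls both norms at once; only
  the noise needs chaining. The factor 2 of the conclusion counts two events, one in the design and
  one in the noise given the design.\<close>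

lemma exp_le_linear_plus_exp_square: "exp x \<le> x + exp (x\<^sup>2)" for x :: real
proof -
  have sq: "1 + x\<^sup>2 \<le> exp (x\<^sup>2)" by (rule exp_ge_add_one_self)
  consider "1 \<le> x" | "0 \<le> x" "x \<le> 1" | "- 1 \<le> x" "x \<le> 0" | "x \<le> - 1" by linarith
  then show ?thesis
  proof cases
    case 1
    then have "x \<le> x\<^sup>2" by (simp add: power2_eq_square)
    then have "exp x \<le> exp (x\<^sup>2)" by simp
    then show ?thesis using 1 by linarith
  next
    case 2
    then show ?thesis using exp_bound[of x] sq by linarith
  next
    case 3
    \<comment> \<open>Here exp (-y) is at most 1 - y + y^2: the quadratic Taylor lower bound of exp
      y, multiplied by the positive factor 1 - y + y^2, is at least 1.\<close>
    define y where "y = - x"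
    have y: "0 \<le> y" using 3 by (simp add: y_def)
    have "1 + y + y\<^sup>2 / 2 \<le> exp y" using y by (rule exp_lower_Taylor_quadratic)
    then have "(1 - y + y\<^sup>2) * (1 + y + y\<^sup>2 / 2) \<le> (1 - y + y\<^sup>2) * exp y"
      by (rule mult_left_mono) (use zero_le_power2[of "y - 1 / 2"] in \<open>simp add: power2_eq_square field_simps\<close>)
    moreover have "(1 - y + y\<^sup>2) * (1 + y + y\<^sup>2 / 2) = 1 + y\<^sup>2 / 2 + y ^ 3 / 2 + y ^ 4 / 2"
      by (simp add: field_simps power2_eq_square power3_eq_cube power4_eq_xxxx)
    ultimately have "1 \<le> (1 - y + y\<^sup>2) * exp y" using y by (smt (verit) divide_nonneg_pos zero_le_power)
    then have "exp (- y) * 1 \<le> exp (- y) * ((1 - y + y\<^sup>2) * exp y)" by (rule mult_left_mono) simp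
    also have "\<dots> = 1 - y + y\<^sup>2" by (simp add: exp_minus field_simps)
    finally have "exp x \<le> 1 + x + x\<^sup>2" by (simp add: y_def)
    then show ?thesis using sq by linarith
  next
    case 4
    then have "1 * (- x) \<le> (- x) * (- x)" by (intro mult_right_mono) auto
    then have "- x \<le> x\<^sup>2" by (simp add: power2_eq_square)
    moreover have "exp x \<le> 1" using 4 by simp
    ultimately show ?thesis using sq by linarith
  qed
qed

text \<open>Rounding U down to an integer k bounds the integrand by exp ((k+1)^2 / 4), while the
  tail at k contributes 2 exp (- k^2 / 2). The combined exponent is at most 3 - k, so the series is
  dominated by a geometric one of ratio 1/2 with sum 4 exp 3.\<close>

lemma subgaussian_exp_square_moment:
  fixes U :: "'w \<Rightarrow> real"
  assumes M: "prob_space M" and U[measurable]: "U \<in> borel_measurable M"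
    and U0: "\<And>\<omega>. \<omega> \<in> space M \<Longrightarrow> 0 \<le> U \<omega>"
    and tail: "\<And>t. 0 \<le> t \<Longrightarrow> measure M {\<omega> \<in> space M. t \<le> U \<omega>} \<le> 2 * exp (- t\<^sup>2 / 2)"
  shows "(\<integral>\<^sup>+\<omega>. ennreal (exp ((U \<omega>)\<^sup>2 / 4)) \<partial>M) \<le> ennreal (4 * exp 3)"
proof -
  interpret prob_space M by fact
  define A where "A k = {\<omega> \<in> space M. real k \<le> U \<omega>}" for k :: nat
  have A[measurable]: "A k \<in> sets M" for k unfolding A_def by measurable
  define f where "f k \<omega> = ennreal (exp ((real k + 1)\<^sup>2 / 4)) * indicator (A k) \<omega>" for k \<omega>
  have "(\<integral>\<^sup>+\<omega>. ennreal (exp ((U \<omega>)\<^sup>2 / 4)) \<partial>M) \<le> (\<integral>\<^sup>+\<omega>. (\<Sum>k. f k \<omega>) \<partial>M)"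
  proof (rule nn_integral_mono)
    fix \<omega> assume \<omega>: "\<omega> \<in> space M"
    define k where "k = nat \<lfloor>U \<omega>\<rfloor>"
    have k: "real k \<le> U \<omega>" "U \<omega> \<le> real k + 1" using U0[OF \<omega>] unfolding k_def by linarith+
    have "ennreal (exp ((U \<omega>)\<^sup>2 / 4)) \<le> f k \<omega>"
      using k \<omega> U0[OF \<omega>] by (auto simp: f_def A_def intro!: ennreal_leI power_mono)
    also have "\<dots> = (\<Sum>i\<in>{k}. f i \<omega>)" by simp
    also have "\<dots> \<le> (\<Sum>i. f i \<omega>)" by (rule sum_le_suminf) auto
    finally show "ennreal (exp ((U \<omega>)\<^sup>2 / 4)) \<le> (\<Sum>i. f i \<omega>)" .
  qed
  also have "\<dots> = (\<Sum>k. \<integral>\<^sup>+\<omega>. f k \<omega> \<partial>M)"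
    unfolding f_def by (rule nn_integral_suminf) measurable
  also have "\<dots> \<le> (\<Sum>k. ennreal (2 * exp 3 * (1 / 2) ^ k))"
  proof (rule suminf_le)
    fix k :: nat
    have "(\<integral>\<^sup>+\<omega>. f k \<omega> \<partial>M) = ennreal (exp ((real k + 1)\<^sup>2 / 4) * measure M (A k))"
      unfolding f_def by (simp add: nn_integral_cmult emeasure_eq_measure ennreal_mult)
    also have "\<dots> \<le> ennreal (exp ((real k + 1)\<^sup>2 / 4) * (2 * exp (- (real k)\<^sup>2 / 2)))"
      unfolding A_def by (intro ennreal_leI mult_left_mono tail) auto
    also have "exp ((real k + 1)\<^sup>2 / 4) * (2 * exp (- (real k)\<^sup>2 / 2))
        = 2 * exp ((real k + 1)\<^sup>2 / 4 - (real k)\<^sup>2 / 2)"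
      by (simp only: exp_diff exp_minus minus_divide_left[symmetric]) (simp only: divide_inverse mult_ac)
    also have "(real k + 1)\<^sup>2 / 4 - (real k)\<^sup>2 / 2 \<le> 3 - real k"
      using zero_le_power2[of "real k - 3"] by (simp add: power2_eq_square field_simps)
    also have "2 * exp (3 - real k) = 2 * exp 3 * exp (- 1) ^ k"
      by (simp add: exp_diff exp_of_nat_mult[symmetric] exp_minus field_simps)
    also have "\<dots> \<le> 2 * exp 3 * (1 / 2) ^ k"
      using exp_ge_add_one_self[of 1] by (intro mult_left_mono power_mono) (auto simp: exp_minus field_simps)
    finally show "(\<integral>\<^sup>+\<omega>. f k \<omega> \<partial>M) \<le> ennreal (2 * exp 3 * (1 / 2) ^ k)"
      by (simp add: ennreal_leI)
  qed auto
  also have "\<dots> = ennreal (2 * exp 3 * (1 / (1 - 1 / 2)))"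
    using sums_mult[OF geometric_sums[of "1 / 2 :: real"], of "2 * exp 3"]
    by (intro suminf_ennreal_eq) auto
  finally show ?thesis by simp
qed

text \<open>Two regimes in a = \<bar>l\<bar> \<open>norm v\<close>. For small a the mean-zero
  property removes the linear term, so that the bound tends to 1 like 1 + O(a^2). For large a,
  Young's inequality separates a from the norm of e, and the prefactor B is absorbed into the
  exponent because 4 a^2 > 1. The constant 16 exp 3 is 4 B, with B the exponential square
  moment.\<close>

lemma subgaussian_inner_mgf:
  fixes e :: "'w \<Rightarrow> 'b :: {real_inner, banach, second_countable_topology}"
  assumes M: "prob_space M" and int: "integrable M e" and mean: "(\<integral>\<omega>. e \<omega> \<partial>M) = 0"
    and tail: "\<And>t. 0 \<le> t \<Longrightarrow> measure M {\<omega> \<in> space M. t \<le> norm (e \<omega>)} \<le> 2 * exp (- t\<^sup>2 / 2)"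
  shows "(\<integral>\<^sup>+\<omega>. ennreal (exp (l * inner (e \<omega>) v)) \<partial>M) \<le> ennreal (exp (16 * exp 3 * l\<^sup>2 * (norm v)\<^sup>2))"
proof -
  interpret prob_space M by fact
  have [measurable]: "e \<in> borel_measurable M" using int by simp
  define a where "a = \<bar>l\<bar> * norm v"
  have a0: "0 \<le> a" by (simp add: a_def)
  have a2: "a\<^sup>2 = l\<^sup>2 * (norm v)\<^sup>2" by (simp add: a_def power_mult_distrib)
  define V where "V \<omega> = exp ((norm (e \<omega>))\<^sup>2 / 4)" for \<omega>
  define B :: real where "B = 4 * exp 3"
  have B: "4 \<le> B" by (simp add: B_def)
  have [measurable]: "V \<in> borel_measurable M" unfolding V_def by measurable
  have V: "(\<integral>\<^sup>+\<omega>. ennreal (V \<omega>) \<partial>M) \<le> ennreal B"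
    unfolding V_def B_def by (rule subgaussian_exp_square_moment[OF M]) (use tail in auto)
  have bound: "\<bar>l * inner (e \<omega>) v\<bar> \<le> a * norm (e \<omega>)" for \<omega>
    using Cauchy_Schwarz_ineq2[of "e \<omega>" v]
    by (simp add: abs_mult a_def mult_left_mono mult.assoc mult.commute[of "norm v"])
  have "(\<integral>\<^sup>+\<omega>. ennreal (exp (l * inner (e \<omega>) v)) \<partial>M) \<le> ennreal (exp (4 * B * a\<^sup>2))"
  proof (cases "4 * a\<^sup>2 \<le> 1")
    case True
    have iV: "integrable M V"
      by (rule integrableI_bounded) (use V in \<open>auto simp: V_def less_top[symmetric] top_unique\<close>)
    have "(\<integral>\<^sup>+\<omega>. ennreal (V \<omega>) \<partial>M) = ennreal (\<integral>\<omega>. V \<omega> \<partial>M)"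
      by (rule nn_integral_eq_integral[OF iV]) (simp add: V_def)
    then have EV: "(\<integral>\<omega>. V \<omega> \<partial>M) \<le> B" using V B by simp
    \<comment> \<open>The linear term is kept because it integrates to 0. In the quadratic one, a^2
      \<open>norm (e \<omega>)\<close>^2 is the convex combination with weight 4 a^2 of 0 and the
      exponent of \<open>V\<close>, so convexity of exp gives a bound linear in
      \<open>V\<close>.\<close>
    have pt: "exp (l * inner (e \<omega>) v) \<le> l * inner (e \<omega>) v + (1 + 4 * a\<^sup>2 * (V \<omega> - 1))" for \<omega>
    proof -
      have "(l * inner (e \<omega>) v)\<^sup>2 \<le> (a * norm (e \<omega>))\<^sup>2"
        using bound[of \<omega>] a0 by (subst abs_le_square_iff[symmetric]) simp
      then have "exp ((l * inner (e \<omega>) v)\<^sup>2) \<le> exp ((1 - 4 * a\<^sup>2) * 0 + 4 * a\<^sup>2 * ((norm (e \<omega>))\<^sup>2 / 4))"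
        by (simp add: power_mult_distrib)
      also have "\<dots> \<le> (1 - 4 * a\<^sup>2) * exp 0 + 4 * a\<^sup>2 * V \<omega>"
        unfolding V_def using convex_onD[OF exp_convex, of "4 * a\<^sup>2" 0 "(norm (e \<omega>))\<^sup>2 / 4"] True by simp
      finally show ?thesis using exp_le_linear_plus_exp_square[of "l * inner (e \<omega>) v"]
        by (simp add: algebra_simps)
    qed
    have ii: "integrable M (\<lambda>\<omega>. l * inner (e \<omega>) v + (1 + 4 * a\<^sup>2 * (V \<omega> - 1)))"
      using int iV by auto
    have "(\<integral>\<^sup>+\<omega>. ennreal (exp (l * inner (e \<omega>) v)) \<partial>M)
        \<le> (\<integral>\<^sup>+\<omega>. ennreal (l * inner (e \<omega>) v + (1 + 4 * a\<^sup>2 * (V \<omega> - 1))) \<partial>M)"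
      by (intro nn_integral_mono ennreal_leI pt)
    also have "\<dots> = ennreal (\<integral>\<omega>. l * inner (e \<omega>) v + (1 + 4 * a\<^sup>2 * (V \<omega> - 1)) \<partial>M)"
    proof (rule nn_integral_eq_integral[OF ii])
      show "AE \<omega> in M. 0 \<le> l * inner (e \<omega>) v + (1 + 4 * a\<^sup>2 * (V \<omega> - 1))"
        using pt by (intro AE_I2) (meson exp_ge_zero order_trans)
    qed
    also have "(\<integral>\<omega>. l * inner (e \<omega>) v + (1 + 4 * a\<^sup>2 * (V \<omega> - 1)) \<partial>M)
        = 1 + 4 * a\<^sup>2 * ((\<integral>\<omega>. V \<omega> \<partial>M) - 1)"
      using int iV by (simp add: mean prob_space)
    also have "\<dots> \<le> 1 + 4 * a\<^sup>2 * B"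
      using EV by (intro add_left_mono mult_left_mono) auto
    also have "\<dots> \<le> exp (4 * a\<^sup>2 * B)" by (rule exp_ge_add_one_self)
    finally show ?thesis by (simp add: ennreal_leI mult_ac)
  next
    case False
    have pt: "exp (l * inner (e \<omega>) v) \<le> exp (a\<^sup>2) * V \<omega>" for \<omega>
    proof -
      have "a * norm (e \<omega>) \<le> a\<^sup>2 + (norm (e \<omega>))\<^sup>2 / 4"
        using zero_le_power2[of "a - norm (e \<omega>) / 2"] by (simp add: power2_eq_square field_simps)
      then have "l * inner (e \<omega>) v \<le> a\<^sup>2 + (norm (e \<omega>))\<^sup>2 / 4" using bound[of \<omega>] by linarith
      then show ?thesis by (simp add: V_def exp_add[symmetric])
    qed
    have "(\<integral>\<^sup>+\<omega>. ennreal (exp (l * inner (e \<omega>) v)) \<partial>M) \<le> (\<integral>\<^sup>+\<omega>. ennreal (exp (a\<^sup>2)) * ennreal (V \<omega>) \<partial>M)"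
      using pt by (intro nn_integral_mono) (auto simp: ennreal_mult[symmetric] V_def intro!: ennreal_leI)
    also have "\<dots> \<le> ennreal (exp (a\<^sup>2)) * ennreal B"
      using V by (simp add: nn_integral_cmult mult_left_mono)
    also have "\<dots> = ennreal (exp (a\<^sup>2) * B)" using B by (simp add: ennreal_mult)
    also have "exp (a\<^sup>2) * B \<le> exp (4 * B * a\<^sup>2)"
    proof -
      have "B \<le> exp (B - 1)" using exp_ge_add_one_self[of "B - 1"] by simp
      also have "B - 1 \<le> (B - 1) * (4 * a\<^sup>2)" using False B by (simp add: mult_le_cancel_left1)
      finally have "exp (a\<^sup>2) * B \<le> exp (a\<^sup>2) * exp ((B - 1) * (4 * a\<^sup>2))" by simp
      also have "\<dots> \<le> exp (4 * B * a\<^sup>2)" by (simp add: exp_add[symmetric] algebra_simps)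
      finally show ?thesis .
    qed
    finally show ?thesis by (simp add: ennreal_leI)
  qed
  then show ?thesis by (simp add: a2 B_def mult_ac)
qed

section \<open>Gaussian moments and the increment condition shared by both noise models\<close>

lemma normal_mgf:
  assumes "0 < s"
  shows "(\<integral>\<^sup>+x. ennreal (normal_density 0 s x) * ennreal (exp (l * x)) \<partial>lborel) = ennreal (exp (l\<^sup>2 * s\<^sup>2 / 2))"
proof -
  have eq: "normal_density 0 s x * exp (l * x) = exp (l\<^sup>2 * s\<^sup>2 / 2) * normal_density (l * s\<^sup>2) s x" for x
  proof -
    have "- x\<^sup>2 / (2 * s\<^sup>2) + l * x = l\<^sup>2 * s\<^sup>2 / 2 + - (x - l * s\<^sup>2)\<^sup>2 / (2 * s\<^sup>2)"
      using assms by (simp add: field_simps power2_eq_square)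
    then have "exp (- x\<^sup>2 / (2 * s\<^sup>2)) * exp (l * x) = exp (l\<^sup>2 * s\<^sup>2 / 2) * exp (- (x - l * s\<^sup>2)\<^sup>2 / (2 * s\<^sup>2))"
      by (simp only: exp_add[symmetric])
    then show ?thesis by (simp add: normal_density_def)
  qed
  have "(\<integral>\<^sup>+x. ennreal (normal_density 0 s x) * ennreal (exp (l * x)) \<partial>lborel)
      = (\<integral>\<^sup>+x. ennreal (exp (l\<^sup>2 * s\<^sup>2 / 2)) * ennreal (normal_density (l * s\<^sup>2) s x) \<partial>lborel)"
    by (intro nn_integral_cong) (simp add: ennreal_mult[symmetric] normal_density_nonneg eq)
  also have "\<dots> = ennreal (exp (l\<^sup>2 * s\<^sup>2 / 2))"
    using assms by (simp add: nn_integral_cmult nn_integral_eq_integral normal_density_nonneg)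
  finally show ?thesis .
qed

lemma centered_gaussian_square_integrable:
  assumes "prob_space M" "centered_gaussian M Z"
  shows "integrable M (\<lambda>\<omega>. (Z \<omega>)\<^sup>2)"
proof -
  interpret prob_space M by fact
  have [measurable]: "Z \<in> borel_measurable M" using assms by (simp add: centered_gaussian_def)
  from assms consider "AE \<omega> in M. Z \<omega> = 0" | s where "0 < s" "distributed M lborel Z (normal_density 0 s)"
    by (auto simp: centered_gaussian_def)
  then show ?thesis
  proof cases
    case 1
    then have "integrable M (\<lambda>\<omega>. (Z \<omega>)\<^sup>2) \<longleftrightarrow> integrable M (\<lambda>_. 0 :: real)"
      by (intro integrable_cong_AE) auto
    then show ?thesis by simp
  next
    case 2
    have "integrable lborel (\<lambda>x. normal_density 0 s x * (x - 0) ^ (2 * 1))"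
      using normal_moment_even[OF 2(1), of 0 1] by (simp add: has_bochner_integral_iff)
    then show ?thesis
      by (subst distributed_integrable[OF 2(2), symmetric]) (auto simp: normal_density_nonneg)
  qed
qed

lemma centered_gaussian_mgf:
  assumes "prob_space M" "centered_gaussian M Z"
  shows "(\<integral>\<^sup>+\<omega>. ennreal (exp (l * Z \<omega>)) \<partial>M) = ennreal (exp (l\<^sup>2 * (\<integral>\<omega>. (Z \<omega>)\<^sup>2 \<partial>M) / 2))"
proof -
  interpret prob_space M by fact
  have [measurable]: "Z \<in> borel_measurable M" using assms by (simp add: centered_gaussian_def)
  from assms consider "AE \<omega> in M. Z \<omega> = 0" | s where "0 < s" "distributed M lborel Z (normal_density 0 s)"
    by (auto simp: centered_gaussian_def)
  then show ?thesis
  proof cases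
    case 1
    then have "(\<integral>\<^sup>+\<omega>. ennreal (exp (l * Z \<omega>)) \<partial>M) = (\<integral>\<^sup>+\<omega>. 1 \<partial>M)"
      by (intro nn_integral_cong_AE) auto
    moreover have "(\<integral>\<omega>. (Z \<omega>)\<^sup>2 \<partial>M) = (\<integral>\<omega>. 0 \<partial>M)"
      using 1 by (intro integral_cong_AE) auto
    ultimately show ?thesis by (simp add: emeasure_space_1)
  next
    case 2
    have "(\<integral>\<^sup>+\<omega>. ennreal (exp (l * Z \<omega>)) \<partial>M) = ennreal (exp (l\<^sup>2 * s\<^sup>2 / 2))"
      by (subst distributed_nn_integral[OF 2(2), symmetric]) (simp_all add: normal_mgf 2(1))
    moreover have "(\<integral>\<omega>. (Z \<omega>)\<^sup>2 \<partial>M) = s\<^sup>2"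
      using normal_distributed_variance[OF 2(1) 2(2)] normal_distributed_expectation[OF 2(1) 2(2)] by simp
    ultimately show ?thesis by simp
  qed
qed

text \<open>The common interface of the two noise models. It speaks of differences of values, not of
  the value at a - b: white noise is linear in its argument only almost surely for each fixed
  combination, and \<open>Y\<close> need not be closed under subtraction here. Gaussian increments
  satisfy it with K = 1/2.\<close>

definition subgaussian_functionals ::
  "'w measure \<Rightarrow> 'b :: real_normed_vector set \<Rightarrow> nat \<Rightarrow> (nat \<Rightarrow> 'w \<Rightarrow> 'b \<Rightarrow> real) \<Rightarrow> real \<Rightarrow> bool" where
  "subgaussian_functionals M Y n \<epsilon> K \<longleftrightarrow>
    (\<forall>i<n. \<forall>y\<in>Y. (\<lambda>\<omega>. \<epsilon> i \<omega> y) \<in> borel_measurable M) \<and>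
    (\<forall>a b l. (\<forall>i<n. a i \<in> Y \<and> b i \<in> Y) \<longrightarrow>
      (\<integral>\<^sup>+\<omega>. ennreal (exp (l * (\<Sum>i<n. \<epsilon> i \<omega> (a i) - \<epsilon> i \<omega> (b i)))) \<partial>M)
        \<le> ennreal (exp (K * l\<^sup>2 * (\<Sum>i<n. (norm (a i - b i))\<^sup>2))))"

lemma independent_mgf_sum_le:
  fixes D :: "nat \<Rightarrow> 'w \<Rightarrow> real"
  assumes M: "prob_space M" and ind: "prob_space.indep_vars M (\<lambda>_. borel) D {..<n}"
    and le: "\<And>i. i < n \<Longrightarrow> (\<integral>\<^sup>+\<omega>. ennreal (exp (l * D i \<omega>)) \<partial>M) \<le> ennreal (exp (c i))"
  shows "(\<integral>\<^sup>+\<omega>. ennreal (exp (l * (\<Sum>i<n. D i \<omega>))) \<partial>M) \<le> ennreal (exp (\<Sum>i<n. c i))"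
proof -
  interpret prob_space M by fact
  have "indep_vars (\<lambda>_. borel) (\<lambda>i \<omega>. ennreal (exp (l * D i \<omega>))) {..<n}"
    by (rule indep_vars_compose2[OF ind]) measurable
  then have "(\<integral>\<^sup>+\<omega>. (\<Prod>i<n. ennreal (exp (l * D i \<omega>))) \<partial>M)
      = (\<Prod>i<n. \<integral>\<^sup>+\<omega>. ennreal (exp (l * D i \<omega>)) \<partial>M)"
    by (intro indep_vars_nn_integral) auto
  also have "\<dots> \<le> (\<Prod>i<n. ennreal (exp (c i)))"
    using le by (intro prod_mono_ennreal) auto
  finally show ?thesis by (simp add: prod_ennreal exp_sum sum_distrib_left)
qed

lemma white_noise_increment_variance:
  assumes M: "prob_space M" and W: "white_noise_process M Y W" and "a \<in> Y" "b \<in> Y"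
  shows "centered_gaussian M (\<lambda>\<omega>. W \<omega> a - W \<omega> b)"
    and "(\<integral>\<omega>. (W \<omega> a - W \<omega> b)\<^sup>2 \<partial>M) = (norm (a - b))\<^sup>2"
proof -
  interpret prob_space M by fact
  have lin: "finite A \<Longrightarrow> A \<subseteq> Y \<Longrightarrow> centered_gaussian M (\<lambda>\<omega>. \<Sum>y\<in>A. c y * W \<omega> y)" for A c
    using W by (simp add: white_noise_process_def)
  have cov: "y \<in> Y \<Longrightarrow> z \<in> Y \<Longrightarrow> (\<integral>\<omega>. W \<omega> y * W \<omega> z \<partial>M) = inner y z" for y z
    using W by (simp add: white_noise_process_def)
  have g: "centered_gaussian M (\<lambda>\<omega>. W \<omega> y)" if "y \<in> Y" for y
    using lin[of "{y}" "\<lambda>_. 1"] that by simp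
  \<comment> \<open>For a = b the set \<open>{a, b}\<close> collapses to one point and the
    coefficients 1 and -1 no longer describe the difference, which is then the degenerate Gaussian
    0.\<close>
  show "centered_gaussian M (\<lambda>\<omega>. W \<omega> a - W \<omega> b)"
  proof (cases "a = b")
    case True
    then show ?thesis by (simp add: centered_gaussian_def)
  next
    case False
    then show ?thesis
      using lin[of "{a, b}" "\<lambda>y. if y = a then 1 else - 1"] assms(3,4) by simp
  qed
  have sq: "integrable M (\<lambda>\<omega>. (W \<omega> y)\<^sup>2)" if "y \<in> Y" for y
    using centered_gaussian_square_integrable[OF M g[OF that]] .
  have [measurable]: "(\<lambda>\<omega>. W \<omega> a) \<in> borel_measurable M" "(\<lambda>\<omega>. W \<omega> b) \<in> borel_measurable M"
    using g assms(3,4) by (auto simp: centered_gaussian_def)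
  have ab: "integrable M (\<lambda>\<omega>. W \<omega> a * W \<omega> b)"
  proof (rule Bochner_Integration.integrable_bound)
    show "integrable M (\<lambda>\<omega>. (W \<omega> a)\<^sup>2 + (W \<omega> b)\<^sup>2)" using sq assms(3,4) by simp
    show "AE \<omega> in M. norm (W \<omega> a * W \<omega> b) \<le> norm ((W \<omega> a)\<^sup>2 + (W \<omega> b)\<^sup>2)"
    proof (rule AE_I2)
      fix \<omega>
      have "2 * (\<bar>W \<omega> a\<bar> * \<bar>W \<omega> b\<bar>) \<le> (W \<omega> a)\<^sup>2 + (W \<omega> b)\<^sup>2"
        using sum_squares_bound[of "\<bar>W \<omega> a\<bar>" "\<bar>W \<omega> b\<bar>"] by (simp add: mult.assoc)
      moreover have "0 \<le> \<bar>W \<omega> a\<bar> * \<bar>W \<omega> b\<bar>" by simp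
      ultimately show "norm (W \<omega> a * W \<omega> b) \<le> norm ((W \<omega> a)\<^sup>2 + (W \<omega> b)\<^sup>2)"
        unfolding real_norm_def abs_mult by linarith
    qed
  qed measurable
  have "(\<integral>\<omega>. (W \<omega> a - W \<omega> b)\<^sup>2 \<partial>M)
      = (\<integral>\<omega>. ((W \<omega> a)\<^sup>2 + (W \<omega> b)\<^sup>2) - 2 * (W \<omega> a * W \<omega> b) \<partial>M)"
    by (simp add: power2_diff mult.assoc)
  also have "\<dots> = inner a a + inner b b - 2 * inner a b"
    using sq assms(3,4) ab cov by (simp add: power2_eq_square)
  also have "\<dots> = (norm (a - b))\<^sup>2"
    unfolding power2_norm_eq_inner by (simp add: inner_diff_left inner_diff_right inner_commute)
  finally show "(\<integral>\<omega>. (W \<omega> a - W \<omega> b)\<^sup>2 \<partial>M) = (norm (a - b))\<^sup>2" .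
qed

lemma white_noise_subgaussian:
  assumes wn: "white_noise M Y n \<epsilon>" and K: "1 / 2 \<le> K"
  shows "subgaussian_functionals M Y n \<epsilon> K"
proof -
  have M: "prob_space M" and W: "\<And>i. i < n \<Longrightarrow> white_noise_process M Y (\<epsilon> i)"
    and ind: "prob_space.indep_vars M (\<lambda>_. Pi\<^sub>M Y (\<lambda>_. borel)) (\<lambda>i \<omega>. restrict (\<epsilon> i \<omega>) Y) {..<n}"
    using wn unfolding white_noise_def by blast+
  interpret prob_space M by fact
  show ?thesis
    unfolding subgaussian_functionals_def
  proof (intro conjI allI impI ballI)
    fix i y assume "i < n" "y \<in> Y"
    then have "centered_gaussian M (\<lambda>\<omega>. \<Sum>z\<in>{y}. (\<lambda>_. 1) z * \<epsilon> i \<omega> z)"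
      using W[unfolded white_noise_process_def, THEN conjunct1, rule_format, OF \<open>i < n\<close>, of "{y}" "\<lambda>_. 1"]
      by simp
    then show "(\<lambda>\<omega>. \<epsilon> i \<omega> y) \<in> borel_measurable M" by (simp add: centered_gaussian_def)
  next
    fix a b :: "nat \<Rightarrow> 'b" and l :: real
    assume Y: "\<forall>i<n. a i \<in> Y \<and> b i \<in> Y"
    \<comment> \<open>Evaluation at a point of \<open>Y\<close> is a coordinate of the product space
      and so measurable; independence thus passes from the processes to their increments.\<close>
    have "indep_vars (\<lambda>_. borel)
        (\<lambda>i \<omega>. restrict (\<epsilon> i \<omega>) Y (a i) - restrict (\<epsilon> i \<omega>) Y (b i)) {..<n}"
      by (rule indep_vars_compose2[OF ind, where Y = "\<lambda>i w. w (a i) - w (b i)"])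
         (use Y in \<open>auto intro!: borel_measurable_diff measurable_component_singleton\<close>)
    also have "?this \<longleftrightarrow> indep_vars (\<lambda>_. borel) (\<lambda>i \<omega>. \<epsilon> i \<omega> (a i) - \<epsilon> i \<omega> (b i)) {..<n}"
      using Y by (intro indep_vars_cong) auto
    finally have ind': "indep_vars (\<lambda>_. borel) (\<lambda>i \<omega>. \<epsilon> i \<omega> (a i) - \<epsilon> i \<omega> (b i)) {..<n}" .
    have "(\<integral>\<^sup>+\<omega>. ennreal (exp (l * (\<Sum>i<n. \<epsilon> i \<omega> (a i) - \<epsilon> i \<omega> (b i)))) \<partial>M)
        \<le> ennreal (exp (\<Sum>i<n. K * l\<^sup>2 * (norm (a i - b i))\<^sup>2))"
    proof (rule independent_mgf_sum_le[OF M ind'])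
      fix i assume i: "i < n"
      have "(\<integral>\<^sup>+\<omega>. ennreal (exp (l * (\<epsilon> i \<omega> (a i) - \<epsilon> i \<omega> (b i)))) \<partial>M)
          = ennreal (exp (l\<^sup>2 * (norm (a i - b i))\<^sup>2 / 2))"
        using white_noise_increment_variance[OF M W[OF i], of "a i" "b i"] Y i
        by (subst centered_gaussian_mgf[OF M]) auto
      also have "l\<^sup>2 * (norm (a i - b i))\<^sup>2 / 2 \<le> K * l\<^sup>2 * (norm (a i - b i))\<^sup>2"
        using mult_right_mono[OF K, of "l\<^sup>2 * (norm (a i - b i))\<^sup>2"] by (simp add: mult_ac)
      finally show "(\<integral>\<^sup>+\<omega>. ennreal (exp (l * (\<epsilon> i \<omega> (a i) - \<epsilon> i \<omega> (b i)))) \<partial>M)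
          \<le> ennreal (exp (K * l\<^sup>2 * (norm (a i - b i))\<^sup>2))" by (simp add: ennreal_leI)
    qed
    then show "(\<integral>\<^sup>+\<omega>. ennreal (exp (l * (\<Sum>i<n. \<epsilon> i \<omega> (a i) - \<epsilon> i \<omega> (b i)))) \<partial>M)
        \<le> ennreal (exp (K * l\<^sup>2 * (\<Sum>i<n. (norm (a i - b i))\<^sup>2)))"
      by (simp add: sum_distrib_left)
  qed
qed

lemma subgaussian_noise_subgaussian:
  assumes sg: "subgaussian_noise M Y n \<epsilon>"
  shows "subgaussian_functionals M Y n \<epsilon> (16 * exp 3)"
proof -
  obtain e where M: "prob_space M"
    and ind: "prob_space.indep_vars M (\<lambda>_. restrict_space borel Y) e {..<n}"
    and e: "\<And>i. i < n \<Longrightarrow> integrable M (e i)" "\<And>i. i < n \<Longrightarrow> (\<integral>\<omega>. e i \<omega> \<partial>M) = 0"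
      "\<And>i t. i < n \<Longrightarrow> 0 \<le> t \<Longrightarrow> measure M {\<omega> \<in> space M. t \<le> norm (e i \<omega>)} \<le> 2 * exp (- t\<^sup>2 / 2)"
    and eq: "\<And>i \<omega> y. i < n \<Longrightarrow> \<omega> \<in> space M \<Longrightarrow> y \<in> Y \<Longrightarrow> \<epsilon> i \<omega> y = inner (e i \<omega>) y"
    using sg unfolding subgaussian_noise_def by blast
  interpret prob_space M by fact
  show ?thesis
    unfolding subgaussian_functionals_def
  proof (intro conjI allI impI ballI)
    fix i y assume "i < n" "y \<in> Y"
    moreover have "(\<lambda>\<omega>. inner (e i \<omega>) y) \<in> borel_measurable M"
      using borel_measurable_integrable[OF e(1)[OF \<open>i < n\<close>]] by measurable
    ultimately show "(\<lambda>\<omega>. \<epsilon> i \<omega> y) \<in> borel_measurable M"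
      using eq by (subst measurable_cong[of M _ "\<lambda>\<omega>. inner (e i \<omega>) y"]) auto
  next
    fix a b :: "nat \<Rightarrow> 'b" and l :: real
    assume Y: "\<forall>i<n. a i \<in> Y \<and> b i \<in> Y"
    have "indep_vars (\<lambda>_. borel) (\<lambda>i \<omega>. inner (e i \<omega>) (a i - b i)) {..<n}"
      by (rule indep_vars_compose2[OF ind, where Y = "\<lambda>i w. inner w (a i - b i)"])
         (auto intro!: measurable_restrict_space1)
    then have "(\<integral>\<^sup>+\<omega>. ennreal (exp (l * (\<Sum>i<n. inner (e i \<omega>) (a i - b i)))) \<partial>M)
        \<le> ennreal (exp (\<Sum>i<n. 16 * exp 3 * l\<^sup>2 * (norm (a i - b i))\<^sup>2))"
      by (rule independent_mgf_sum_le[OF M]) (rule subgaussian_inner_mgf[OF M e])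
    also have "(\<integral>\<^sup>+\<omega>. ennreal (exp (l * (\<Sum>i<n. inner (e i \<omega>) (a i - b i)))) \<partial>M)
        = (\<integral>\<^sup>+\<omega>. ennreal (exp (l * (\<Sum>i<n. \<epsilon> i \<omega> (a i) - \<epsilon> i \<omega> (b i)))) \<partial>M)"
      using Y by (intro nn_integral_cong) (simp add: eq inner_diff_right)
    finally show "(\<integral>\<^sup>+\<omega>. ennreal (exp (l * (\<Sum>i<n. \<epsilon> i \<omega> (a i) - \<epsilon> i \<omega> (b i)))) \<partial>M)
        \<le> ennreal (exp (16 * exp 3 * l\<^sup>2 * (\<Sum>i<n. (norm (a i - b i))\<^sup>2)))"
      by (simp add: sum_distrib_left)
  qed
qed

text \<open>Chernoff's bound, with the deviation parametrised by its exponent \<open>q\<close>.\<close>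

lemma subgaussian_functionals_tail:
  assumes M: "prob_space M" and sg: "subgaussian_functionals M Y n \<epsilon> K" and K: "0 < K"
    and Y: "\<And>i. i < n \<Longrightarrow> a i \<in> Y" "\<And>i. i < n \<Longrightarrow> b i \<in> Y"
    and S: "(\<Sum>i<n. (norm (a i - b i))\<^sup>2) \<le> V\<^sup>2" and V: "0 < V" and q: "0 \<le> q"
  shows "measure M {\<omega> \<in> space M. 2 * sqrt K * V * sqrt q
      \<le> (\<Sum>i<n. \<epsilon> i \<omega> (a i)) - (\<Sum>i<n. \<epsilon> i \<omega> (b i))} \<le> exp (- q)"
proof -
  interpret prob_space M by fact
  define D where "D \<omega> = (\<Sum>i<n. \<epsilon> i \<omega> (a i) - \<epsilon> i \<omega> (b i))" for \<omega>
  have [measurable]: "D \<in> borel_measurable M"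
    unfolding D_def using sg Y
    by (auto simp: subgaussian_functionals_def intro!: borel_measurable_sum borel_measurable_diff)
  \<comment> \<open>The minimizer of K l^2 V^2 - l u for u = 2 sqrt K V sqrt q; the minimum is q - 2
    q = - q.\<close>
  define l where "l = sqrt q / (sqrt K * V)"
  have l: "0 \<le> l" using K V q by (simp add: l_def)
  define u where "u = 2 * sqrt K * V * sqrt q"
  have lu: "l * u = 2 * q" using K V q by (simp add: l_def u_def)
  have lV: "K * l\<^sup>2 * V\<^sup>2 = q" using K V q by (simp add: l_def power_divide power_mult_distrib)
  have "emeasure M {\<omega> \<in> space M. u \<le> D \<omega>} \<le> ennreal (exp (- (l * u))) * (\<integral>\<^sup>+\<omega>. ennreal (exp (l * D \<omega>)) \<partial>M)"
  proof -
    have "emeasure M {\<omega> \<in> space M. u \<le> D \<omega>} = (\<integral>\<^sup>+\<omega>. indicator {\<omega> \<in> space M. u \<le> D \<omega>} \<omega> \<partial>M)"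
      by simp
    also have "\<dots> \<le> (\<integral>\<^sup>+\<omega>. ennreal (exp (- (l * u))) * ennreal (exp (l * D \<omega>)) \<partial>M)"
      using l by (intro nn_integral_mono)
        (auto simp: ennreal_mult[symmetric] exp_add[symmetric] mult_left_mono split: split_indicator)
    finally show ?thesis by (simp add: nn_integral_cmult)
  qed
  also have "(\<integral>\<^sup>+\<omega>. ennreal (exp (l * D \<omega>)) \<partial>M) \<le> ennreal (exp (K * l\<^sup>2 * (\<Sum>i<n. (norm (a i - b i))\<^sup>2)))"
    using sg Y unfolding subgaussian_functionals_def D_def by blast
  also have "\<dots> \<le> ennreal (exp q)"
    using mult_left_mono[OF S, of "K * l\<^sup>2"] K lV by (simp add: ennreal_leI)
  finally have "emeasure M {\<omega> \<in> space M. u \<le> D \<omega>} \<le> ennreal (exp (- (l * u))) * ennreal (exp q)"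
    by (simp add: mult_left_mono)
  also have "\<dots> = ennreal (exp (- q))" by (simp add: ennreal_mult[symmetric] exp_add[symmetric] lu)
  finally have "measure M {\<omega> \<in> space M. u \<le> D \<omega>} \<le> exp (- q)"
    by (simp add: emeasure_eq_measure)
  then show ?thesis by (simp add: u_def D_def sum_subtractf)
qed

section \<open>Chaining\<close>

lemma sum_Suc_over_power2_le: "(\<Sum>i<m. real (Suc i) / 2 ^ i) \<le> 4"
proof -
  have "(\<Sum>i<m. real (Suc i) / 2 ^ i) = 4 - (2 * real m + 4) / 2 ^ m"
    by (induction m) (simp_all add: add_divide_distrib diff_divide_distrib)
  then show ?thesis by simp
qed

lemma sum_inverse_power2_le: "(\<Sum>i<m. 1 / 2 ^ i) \<le> (2 :: real)"
proof -
  have "(\<Sum>i<m. 1 / 2 ^ i) = 2 - 2 / (2 :: real) ^ m"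
    by (induction m) (auto simp: field_simps)
  then show ?thesis by simp
qed

text \<open>
  Every point of the net at level \<open>Suc k\<close> is linked to a single parent at level \<open>k\<close>, so a union
  bound over the links of that level costs only the logarithm of the cardinality of its net.  The
  \<open>j\<close>-th point of the countable family enters the chain at level \<open>j\<close>; since this is one further
  link per level, no passage to the limit along the chain is needed.
\<close>

lemma chaining_bound:
  fixes Z :: "'t \<Rightarrow> 'w \<Rightarrow> real" and d :: "'t \<Rightarrow> 't \<Rightarrow> real" and S :: "nat \<Rightarrow> 't set" and g :: "nat \<Rightarrow> 't"
  assumes M: "prob_space M"
    and Z: "\<And>a. a \<in> T \<Longrightarrow> Z a \<in> borel_measurable M"
    and tail: "\<And>a b D q. a \<in> T \<Longrightarrow> b \<in> T \<Longrightarrow> d a b \<le> D \<Longrightarrow> 0 < D \<Longrightarrow> 0 \<le> q \<Longrightarrow>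
      measure M {\<omega> \<in> space M. v * D * sqrt q \<le> Z a \<omega> - Z b \<omega>} \<le> exp (- q)"
    and r: "0 < r" and v: "0 < v" and q: "0 \<le> q"
    and S0: "S 0 = {t0}" and S: "\<And>k. S k \<subseteq> T" "\<And>k. finite (S k)"
    and net: "\<And>k t. t \<in> T \<Longrightarrow> \<exists>s\<in>S k. d t s \<le> r / 2 ^ k"
    and entropy: "\<And>m. (\<Sum>k=1..m. r / 2 ^ k * sqrt (ln (card (S k)))) \<le> P"
  obtains B where "B \<in> sets M" "measure M B \<le> 2 * exp (- q)"
    "\<And>\<omega> j. \<omega> \<in> space M - B \<Longrightarrow> g j \<in> T \<Longrightarrow> Z (g j) \<omega> - Z t0 \<omega> \<le> v * (2 * P + 4 * r + 2 * r * sqrt q)"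
proof -
  interpret prob_space M by fact
  have t0: "t0 \<in> T" using S(1)[of 0] S0 by simp
  obtain p where p: "\<And>k t. t \<in> T \<Longrightarrow> p k t \<in> S k" "\<And>k t. t \<in> T \<Longrightarrow> d t (p k t) \<le> r / 2 ^ k"
  proof -
    have "\<forall>k t. \<exists>s. t \<in> T \<longrightarrow> s \<in> S k \<and> d t s \<le> r / 2 ^ k" using net by blast
    then obtain p where "\<forall>k t. t \<in> T \<longrightarrow> p k t \<in> S k \<and> d t (p k t) \<le> r / 2 ^ k" by metis
    then show thesis using that by blast
  qed
  have card: "1 \<le> card (S k)" for k
    using p(1)[OF t0, of k] S(2)[of k] by (metis One_nat_def Suc_leI card_gt_0_iff empty_iff)
  have ln0: "0 \<le> ln (real (card (S k)))" for k using card[of k] by simp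
  define link where "link k s w = {\<omega> \<in> space M. v * (r / 2 ^ k) * sqrt w \<le> Z s \<omega> - Z (p k s) \<omega>}" for k s w
  have pT: "p k t \<in> T" if "t \<in> T" for k t using p(1)[OF that] S(1) by blast
  have link_sets: "link k s w \<in> sets M" if "s \<in> T" for k s w
  proof -
    have [measurable]: "Z s \<in> borel_measurable M" "Z (p k s) \<in> borel_measurable M"
      using Z that pT by auto
    show ?thesis unfolding link_def by measurable
  qed
  have link_le: "measure M (link k s w) \<le> exp (- w)" if "s \<in> T" "0 \<le> w" for k s w
    unfolding link_def using that r p pT by (intro tail) auto
  \<comment> \<open>The three parts of the exponent: the logarithm of the cardinality pays for the
    union bound within a level, \<open>Suc k\<close> makes the sum over levels converge, and q is
    the overall confidence. The event \<open>E k\<close> concerns a single link and so carries no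
    logarithm.\<close>
  define wt where "wt k = ln (real (card (S (Suc k)))) + real (Suc k) + q" for k
  define A where "A k = (\<Union>s\<in>S (Suc k). link k s (wt k))" for k
  define E where "E k = (if g k \<in> T then link k (g k) (real (Suc k) + q) else {})" for k
  have A_sets[measurable]: "A k \<in> sets M" for k
    unfolding A_def using S subsetD[OF S(1)] link_sets by (intro sets.finite_UN) auto
  have E_sets[measurable]: "E k \<in> sets M" for k unfolding E_def using link_sets by auto
  have pw: "exp (- (real (Suc k) + q)) \<le> exp (- q) * (1 / 2) ^ Suc k" for k
  proof -
    have "exp (- (real (Suc k) + q)) = exp (- q) * exp (- 1) ^ Suc k"
      by (simp only: exp_of_nat_mult[symmetric] exp_add[symmetric]) simp
    also have "\<dots> \<le> exp (- q) * (1 / 2) ^ Suc k"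
      using exp_ge_add_one_self[of 1]
      by (intro mult_left_mono power_mono) (auto simp: exp_minus field_simps)
    finally show ?thesis .
  qed
  have A_le: "measure M (A k) \<le> exp (- q) * (1 / 2) ^ Suc k" for k
  proof -
    have "measure M (A k) \<le> (\<Sum>s\<in>S (Suc k). measure M (link k s (wt k)))"
      unfolding A_def using S(2) subsetD[OF S(1)] link_sets
      by (intro finite_measure_subadditive_finite) auto
    also have "\<dots> \<le> (\<Sum>s\<in>S (Suc k). exp (- wt k))"
      using subsetD[OF S(1)] ln0[of "Suc k"] q by (intro sum_mono link_le) (auto simp: wt_def)
    also have "\<dots> = exp (- (real (Suc k) + q))"
      using card[of "Suc k"] by (simp add: wt_def exp_diff exp_minus exp_add field_simps)
    finally show ?thesis using pw[of k] by linarith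
  qed
  have E_le: "measure M (E k) \<le> exp (- q) * (1 / 2) ^ Suc k" for k
  proof (cases "g k \<in> T")
    case True
    have "measure M (E k) \<le> exp (- (real (Suc k) + q))"
      using link_le[OF True, of "real (Suc k) + q" k] q True by (simp add: E_def)
    then show ?thesis using pw[of k] by linarith
  qed (simp add: E_def)
  define B where "B = (\<Union>k. A k \<union> E k)"
  show thesis
  proof (rule that[of B])
    show "B \<in> sets M" unfolding B_def by measurable
    \<comment> \<open>The two events of level k cost exp (- q) / 2^(k+1) each, hence exp (- q) / 2^k
      together, with total 2 exp (- q).\<close>
    have le: "measure M (A k \<union> E k) \<le> exp (- q) * (1 / 2) ^ k" for k
      using measure_Un_le[of "A k" M "E k"] A_le[of k] E_le[of k] by simp
    have sm: "summable (\<lambda>k. exp (- q) * (1 / 2) ^ k)"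
      by (intro summable_mult summable_geometric) simp
    have sm': "summable (\<lambda>k. measure M (A k \<union> E k))"
      by (rule summable_comparison_test'[OF sm]) (use le in simp)
    have "measure M B \<le> (\<Sum>k. measure M (A k \<union> E k))"
      unfolding B_def by (rule finite_measure_subadditive_countably[OF _ sm']) auto
    also have "\<dots> \<le> (\<Sum>k. exp (- q) * (1 / 2) ^ k)" by (rule suminf_le[OF le sm' sm])
    also have "\<dots> = 2 * exp (- q)" using suminf_geometric[of "1 / 2 :: real"] by (simp add: suminf_mult)
    finally show "measure M B \<le> 2 * exp (- q)" .
  next
    fix \<omega> j assume \<omega>: "\<omega> \<in> space M - B" and j: "g j \<in> T"
    define h where "h k = sqrt (ln (real (card (S k))))" for k
    have h2: "(h k)\<^sup>2 = ln (real (card (S k)))" "0 \<le> h k" for k using ln0[of k] by (simp_all add: h_def)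
    \<comment> \<open>y \<ge> 1 gives y \<le> y^2, so the square of the right-hand side dominates;
      the entropy, level and confidence parts of a link can then be summed separately.\<close>
    have root: "sqrt (x\<^sup>2 + y + q) \<le> x + y + sqrt q" if "0 \<le> x" "1 \<le> y" for x y
    proof (rule real_le_lsqrt)
      have "y * 1 \<le> y * y" using that by (intro mult_left_mono) auto
      moreover have eq: "(x + y + sqrt q)\<^sup>2 = x\<^sup>2 + y * y + q + 2 * (x * y + x * sqrt q + y * sqrt q)"
        using q by (simp add: power2_eq_square algebra_simps)
      moreover have "0 \<le> x * y + x * sqrt q + y * sqrt q"
        using that q by (intro add_nonneg_nonneg mult_nonneg_nonneg) auto
      ultimately show "x\<^sup>2 + y + q \<le> (x + y + sqrt q)\<^sup>2" unfolding eq by simp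
    qed (use that q in auto)
    have step: "Z s \<omega> - Z (p k s) \<omega> \<le> v * (r / 2 ^ k) * (h (Suc k) + real (Suc k) + sqrt q)"
      if s: "s \<in> S (Suc k)" for k s
    proof -
      have "\<omega> \<notin> link k s (wt k)" using \<omega> s unfolding B_def A_def by blast
      then have "Z s \<omega> - Z (p k s) \<omega> \<le> v * (r / 2 ^ k) * sqrt ((h (Suc k))\<^sup>2 + real (Suc k) + q)"
        using \<omega> unfolding link_def wt_def h2 by auto
      also have "\<dots> \<le> v * (r / 2 ^ k) * (h (Suc k) + real (Suc k) + sqrt q)"
        using r v h2 by (intro mult_left_mono root) auto
      finally show ?thesis .
    qed
    \<comment> \<open>Descent through the parents ends at level 0, whose net is the single point
      \<open>t0\<close>.\<close>
    have chain: "Z s \<omega> - Z t0 \<omega> \<le> (\<Sum>i<k. v * (r / 2 ^ i) * (h (Suc i) + real (Suc i) + sqrt q))"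
      if "s \<in> S k" for k s
      using that
    proof (induction k arbitrary: s)
      case 0
      then show ?case using S0 by simp
    next
      case (Suc k)
      then have "p k s \<in> S k" using S p by blast
      from Suc.IH[OF this] step[OF Suc.prems] show ?case by simp
    qed
    have "\<omega> \<notin> link j (g j) (real (Suc j) + q)"
      using \<omega> j unfolding B_def E_def by (auto dest: spec[of _ j] simp del: of_nat_Suc)
    then have "Z (g j) \<omega> - Z (p j (g j)) \<omega> \<le> v * (r / 2 ^ j) * sqrt (0\<^sup>2 + real (Suc j) + q)"
      using \<omega> unfolding link_def by auto
    also have "\<dots> \<le> v * (r / 2 ^ j) * (0 + real (Suc j) + sqrt q)"
      using r v by (intro mult_left_mono root) auto
    finally have "Z (g j) \<omega> - Z t0 \<omega> \<le> v * (r / 2 ^ j) * (real (Suc j) + sqrt q)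
        + (\<Sum>i<j. v * (r / 2 ^ i) * (h (Suc i) + real (Suc i) + sqrt q))"
      using chain[OF p(1)[OF j, of j]] by simp
    also have eq: "(\<Sum>i<j. v * (r / 2 ^ i) * (h (Suc i) + real (Suc i) + sqrt q))
        = v * (2 * (\<Sum>i<j. r / 2 ^ Suc i * h (Suc i)) + r * (\<Sum>i<j. real (Suc i) / 2 ^ i)
          + r * sqrt q * (\<Sum>i<j. 1 / 2 ^ i))"
      unfolding sum_distrib_left sum.distrib[symmetric]
      by (intro sum.cong) (simp_all add: field_simps)
    \<comment> \<open>The entry link of the j-th point is the missing term i = j of the two
      convergent series. The factor 2 before the entropy sum comes from r / 2^i = 2 r / 2^(i+1): a
      link of length r / 2^i is paid for with the entropy of the finer level.\<close>
    also have "v * (r / 2 ^ j) * (real (Suc j) + sqrt q) + v * (2 * (\<Sum>i<j. r / 2 ^ Suc i * h (Suc i))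
          + r * (\<Sum>i<j. real (Suc i) / 2 ^ i) + r * sqrt q * (\<Sum>i<j. 1 / 2 ^ i))
        = v * (2 * (\<Sum>i<j. r / 2 ^ Suc i * h (Suc i)) + r * (\<Sum>i<Suc j. real (Suc i) / 2 ^ i)
        + r * sqrt q * (\<Sum>i<Suc j. 1 / 2 ^ i))"
      by (simp add: algebra_simps add_divide_distrib)
    also have "(\<Sum>i<j. r / 2 ^ Suc i * h (Suc i)) = (\<Sum>k=1..j. r / 2 ^ k * h k)"
      by (simp add: sum.atLeast1_atMost_eq)
    also have "v * (2 * (\<Sum>k=1..j. r / 2 ^ k * h k) + r * (\<Sum>i<Suc j. real (Suc i) / 2 ^ i)
        + r * sqrt q * (\<Sum>i<Suc j. 1 / 2 ^ i)) \<le> v * (2 * P + r * 4 + r * sqrt q * 2)"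
      using entropy[of j] r v q sum_Suc_over_power2_le[of "Suc j"] sum_inverse_power2_le[of "Suc j"]
      by (intro mult_left_mono add_mono) (auto simp: h_def)
    finally show "Z (g j) \<omega> - Z t0 \<omega> \<le> v * (2 * P + 4 * r + 2 * r * sqrt q)"
      by (simp add: mult_ac)
  qed
qed

section \<open>Covering numbers and the entropy integral\<close>

lemma covering_number_antimono:
  assumes "\<rho> \<le> \<rho>'" shows "covering_number T d \<rho>' \<le> covering_number T d \<rho>"
proof -
  have "pm_ball T d s \<rho> \<subseteq> pm_ball T d s \<rho>'" for s
    using assms by (auto simp: pm_ball_def intro: less_le_trans ennreal_leI)
  then show ?thesis
    unfolding covering_number_def by (intro INF_superset_mono) blast+
qed

lemma metric_entropy_antimono:
  assumes "\<rho> \<le> \<rho>'" shows "metric_entropy T d \<rho>' \<le> metric_entropy T d \<rho>"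
proof (cases "covering_number T d \<rho>")
  case (enat N)
  then obtain N' where N': "covering_number T d \<rho>' = enat N'" "N' \<le> N"
    using covering_number_antimono[OF assms, of T d] by (metis enat_ile enat_ord_simps(1))
  \<comment> \<open>A covering number can be 0, for empty \<open>T\<close>; there
    \<open>ln 0 = 0\<close> keeps the inequality true.\<close>
  have "ln (real N') \<le> ln (real N)" using N'(2) by (cases "N' = 0"; cases "N = 0") auto
  then show ?thesis using enat N' by (simp add: metric_entropy_def ennreal_leI)
qed (simp add: metric_entropy_def)

lemma ennreal_sqrt_mono: "a \<le> b \<Longrightarrow> ennreal_sqrt a \<le> ennreal_sqrt b"
  unfolding ennreal_sqrt_def
  by (auto simp: top_unique intro!: ennreal_leI enn2real_mono simp: less_top)

text \<open>A finite infimum in \<open>enat\<close> is taken over a nonempty set, and by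
  well-ordering it is a minimum.\<close>

lemma covering_number_attained:
  assumes "covering_number T d \<rho> = enat N"
  obtains S where "finite S" "S \<subseteq> T" "T \<subseteq> (\<Union>s\<in>S. pm_ball T d s \<rho>)" "card S = N"
proof -
  let ?X = "(\<lambda>S. enat (card S)) ` {S. finite S \<and> S \<subseteq> T \<and> T \<subseteq> (\<Union>s\<in>S. pm_ball T d s \<rho>)}"
  have eq: "Inf ?X = enat N" using assms by (simp add: covering_number_def)
  then have "?X \<noteq> {}" by (metis Inf_enat_def enat.distinct(2) infinity_enat_def)
  then have "Inf ?X \<in> ?X" unfolding Inf_enat_def by (auto intro: LeastI)
  then show thesis using that unfolding eq by auto
qed

text \<open>A lower Riemann sum: the intervals from r / 2^(k+1) to r / 2^k are disjoint, and on each
  of them the entropy is at least its value at the right end point. The sum starts at k = 1 because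
  level 0 of the chain is a single point.\<close>

lemma dyadic_entropy_sum_le:
  assumes r: "0 < r"
  shows "(\<Sum>k=1..m. ennreal (r / 2 ^ Suc k) * ennreal_sqrt (metric_entropy T d (r / 2 ^ k)))
    \<le> entropy_integral T d r"
proof -
  define I where "I k = {r / 2 ^ Suc k <.. r / 2 ^ k}" for k
  define c where "c k = ennreal_sqrt (metric_entropy T d (r / 2 ^ k))" for k
  have "(\<Sum>k=1..m. ennreal (r / 2 ^ Suc k) * c k) = (\<Sum>k=1..m. \<integral>\<^sup>+\<rho>. c k * indicator (I k) \<rho> \<partial>lborel)"
  proof (rule sum.cong[OF refl])
    fix k
    have "emeasure lborel (I k) = ennreal (r / 2 ^ Suc k)"
      unfolding I_def using r by (subst emeasure_lborel_Ioc) (auto simp: field_simps)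
    then show "ennreal (r / 2 ^ Suc k) * c k = (\<integral>\<^sup>+\<rho>. c k * indicator (I k) \<rho> \<partial>lborel)"
      by (subst nn_integral_cmult_indicator) (auto simp: I_def mult.commute)
  qed
  also have "\<dots> = (\<integral>\<^sup>+\<rho>. (\<Sum>k=1..m. c k * indicator (I k) \<rho>) \<partial>lborel)"
    by (rule nn_integral_sum[symmetric]) (auto simp: I_def)
  also have "\<dots> \<le> entropy_integral T d r"
    unfolding entropy_integral_def
  proof (rule nn_integral_mono)
    fix \<rho> :: real
    show "(\<Sum>k=1..m. c k * indicator (I k) \<rho>) \<le> ennreal_sqrt (metric_entropy T d \<rho>) * indicator {0<..r} \<rho>"
    proof (cases "\<exists>k\<in>{1..m}. \<rho> \<in> I k")
      case True
      then obtain k where k: "k \<in> {1..m}" "\<rho> \<in> I k" by blast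
      have "\<rho> \<notin> I i" if "i \<noteq> k" for i
      proof
        assume i: "\<rho> \<in> I i"
        have "r / 2 ^ b \<le> r / 2 ^ Suc a" if "a < b" for a b
          using r that by (intro divide_left_mono power_increasing) auto
        then show False using i k \<open>i \<noteq> k\<close> unfolding I_def
          by (metis greaterThanAtMost_iff linorder_neqE_nat not_less order_trans)
      qed
      then have "(\<Sum>k=1..m. c k * indicator (I k) \<rho>) = (\<Sum>i=1..m. if i = k then c k else 0)"
        using k by (intro sum.cong) (auto split: split_indicator)
      also have "\<dots> = c k" using k by simp
      also have "\<dots> \<le> ennreal_sqrt (metric_entropy T d \<rho>)"
        unfolding c_def using k by (intro ennreal_sqrt_mono metric_entropy_antimono) (auto simp: I_def)
      also have "\<rho> \<in> {0<..r}"
      proof -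
        have "r / 2 ^ k \<le> r" using r by (simp add: divide_le_eq)
        moreover have "0 < r / 2 ^ Suc k" using r by simp
        ultimately show ?thesis using k unfolding I_def by auto
      qed
      ultimately show ?thesis by simp
    next
      case False
      then have "(\<Sum>k=1..m. c k * indicator (I k) \<rho>) = 0"
        by (intro sum.neutral) (auto split: split_indicator)
      then show ?thesis by simp
    qed
  qed
  finally show ?thesis unfolding c_def .
qed

text \<open>An infinite covering number at one dyadic radius would make a whole summand of the
  dyadic sum infinite, so a finite entropy integral already provides finite nets. The interval
  belonging to radius r / 2^k has length r / 2^(k+1), whence 2 P.\<close>

lemma entropy_integral_nets:
  assumes r: "0 < r" and P: "entropy_integral T d r \<le> ennreal P" "0 \<le> P" and T: "T \<noteq> {}"
  obtains S where "\<And>k. 1 \<le> k \<Longrightarrow> finite (S k)" "\<And>k. 1 \<le> k \<Longrightarrow> S k \<subseteq> T"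
    "\<And>k. 1 \<le> k \<Longrightarrow> T \<subseteq> (\<Union>s\<in>S k. pm_ball T d s (r / 2 ^ k))"
    "\<And>m. (\<Sum>k=1..m. r / 2 ^ k * sqrt (ln (card (S k)))) \<le> 2 * P"
proof -
  have "\<exists>N. covering_number T d (r / 2 ^ k) = enat N" if "1 \<le> k" for k
  proof (rule ccontr)
    assume "\<not> ?thesis"
    then have "covering_number T d (r / 2 ^ k) = \<infinity>" by simp
    then have "ennreal (r / 2 ^ Suc k) * ennreal_sqrt (metric_entropy T d (r / 2 ^ k)) = \<infinity>"
      using r by (simp add: metric_entropy_def ennreal_sqrt_def ennreal_mult_top)
    moreover have "ennreal (r / 2 ^ Suc k) * ennreal_sqrt (metric_entropy T d (r / 2 ^ k))
        \<le> (\<Sum>k=1..k. ennreal (r / 2 ^ Suc k) * ennreal_sqrt (metric_entropy T d (r / 2 ^ k)))"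
      using that by (intro sum_nonneg_leq_bound[where s = "{1..k}", OF _ _ refl]) auto
    ultimately have "\<infinity> \<le> ennreal P"
      using dyadic_entropy_sum_le[OF r, of T d k] P(1) by (metis order_trans)
    then show False by (simp add: top_unique)
  qed
  then obtain N where N: "\<And>k. 1 \<le> k \<Longrightarrow> covering_number T d (r / 2 ^ k) = enat (N k)" by metis
  have "\<exists>S. finite S \<and> S \<subseteq> T \<and> T \<subseteq> (\<Union>s\<in>S. pm_ball T d s (r / 2 ^ k)) \<and> card S = N k" if "1 \<le> k" for k
    using covering_number_attained[OF N[OF that]] by metis
  then obtain S where S: "\<And>k. 1 \<le> k \<Longrightarrow> finite (S k)" "\<And>k. 1 \<le> k \<Longrightarrow> S k \<subseteq> T"
    "\<And>k. 1 \<le> k \<Longrightarrow> T \<subseteq> (\<Union>s\<in>S k. pm_ball T d s (r / 2 ^ k))" "\<And>k. 1 \<le> k \<Longrightarrow> card (S k) = N k"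
    by metis
  have N1: "1 \<le> N k" if "1 \<le> k" for k
  proof -
    have "S k \<noteq> {}" using S(3)[OF that] T by auto
    then show ?thesis using S(1,4)[OF that] by (metis One_nat_def Suc_leI card_gt_0_iff)
  qed
  show thesis
  proof (rule that[OF S(1-3)])
    fix m
    have "ennreal (\<Sum>k=1..m. r / 2 ^ Suc k * sqrt (ln (real (N k))))
        = (\<Sum>k=1..m. ennreal (r / 2 ^ Suc k) * ennreal_sqrt (metric_entropy T d (r / 2 ^ k)))"
      using r N1 N by (subst sum_ennreal[symmetric])
        (auto simp: metric_entropy_def ennreal_sqrt_def ennreal_mult[symmetric] intro!: sum.cong)
    also have "\<dots> \<le> ennreal P" using dyadic_entropy_sum_le[OF r] P(1) by (rule order_trans)
    finally have "(\<Sum>k=1..m. r / 2 ^ Suc k * sqrt (ln (real (N k)))) \<le> P" using P(2) by simp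
    moreover have "(\<Sum>k=1..m. r / 2 ^ k * sqrt (ln (card (S k))))
        = 2 * (\<Sum>k=1..m. r / 2 ^ Suc k * sqrt (ln (real (N k))))"
      using S(4) by (simp add: sum_distrib_left)
    ultimately show "(\<Sum>k=1..m. r / 2 ^ k * sqrt (ln (card (S k)))) \<le> 2 * P" by simp
  qed
qed

section \<open>Sup-norm topology, empirical norm and design\<close>

lemma sup_dist_triangle: "sup_dist D f h \<le> sup_dist D f g + sup_dist D g h"
  unfolding sup_dist_def sup_norm_def
proof (rule SUP_least)
  fix x assume x: "x \<in> D"
  have "ennreal (norm (f x - h x)) \<le> ennreal (norm (f x - g x)) + ennreal (norm (g x - h x))"
    using norm_triangle_ineq[of "f x - g x" "g x - h x"] by (simp flip: ennreal_plus)
  also have "\<dots> \<le> (SUP x\<in>D. ennreal (norm (f x - g x))) + (SUP x\<in>D. ennreal (norm (g x - h x)))"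
    using x by (intro add_mono SUP_upper)
  finally show "ennreal (norm (f x - h x))
    \<le> (SUP x\<in>D. ennreal (norm (f x - g x))) + (SUP x\<in>D. ennreal (norm (g x - h x)))" .
qed

lemma sup_dist_commute: "sup_dist D f g = sup_dist D g f"
  by (simp add: sup_dist_def sup_norm_def norm_minus_commute)

lemma sup_dist_self [simp]: "sup_dist D f f = 0"
  by (cases "D = {}") (simp_all add: sup_dist_def sup_norm_def bot_ennreal)

lemma norm_le_of_sup_norm:
  assumes "sup_norm D f \<le> ennreal e" "0 \<le> e" "x \<in> D"
  shows "norm (f x) \<le> e"
proof -
  have "ennreal (norm (f x)) \<le> sup_norm D f"
    unfolding sup_norm_def using assms(3) by (intro SUP_upper2) auto
  then have "ennreal (norm (f x)) \<le> ennreal e" using assms(1) by (rule order_trans)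
  then show ?thesis using assms(2) by simp
qed

lemma openin_pm_ball_sup_dist: "openin (pm_topology T (sup_dist D)) (pm_ball T (sup_dist D) c \<rho>)"
  unfolding openin_pm_topology
proof (intro conjI ballI)
  show "pm_ball T (sup_dist D) c \<rho> \<subseteq> T" by (auto simp: pm_ball_def)
  fix t assume t: "t \<in> pm_ball T (sup_dist D) c \<rho>"
  define m where "m = enn2real (sup_dist D c t)"
  have "sup_dist D c t < ennreal \<rho>" using t by (simp add: pm_ball_def)
  then have m: "sup_dist D c t = ennreal m" "0 \<le> m" "m < \<rho>"
    unfolding m_def by (cases "sup_dist D c t"; simp add: ennreal_less_iff)+
  show "\<exists>\<rho>'>0. pm_ball T (sup_dist D) t \<rho>' \<subseteq> pm_ball T (sup_dist D) c \<rho>"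
  proof (intro exI[of _ "\<rho> - m"] conjI subsetI)
    show "0 < \<rho> - m" using m by simp
    fix u assume u: "u \<in> pm_ball T (sup_dist D) t (\<rho> - m)"
    have "sup_dist D c u \<le> sup_dist D c t + sup_dist D t u" by (rule sup_dist_triangle)
    also have "\<dots> < ennreal m + ennreal (\<rho> - m)"
      using u unfolding m(1) by (intro ennreal_add_left_cancel_less[THEN iffD2]) (auto simp: pm_ball_def)
    also have "\<dots> = ennreal \<rho>" using m by (simp flip: ennreal_plus)
    finally show "u \<in> pm_ball T (sup_dist D) c \<rho>" using u by (simp add: pm_ball_def)
  qed
qed

text \<open>The sequence enumerates the union of finite 1 / (m+1)-nets, which compactness provides.
  Density is phrased by open sets because it is applied to an open set of maps on which the noise
  term is too large.\<close>

lemma compact_pm_topology_dense_sequence: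
  assumes compact: "compact_space (pm_topology T (sup_dist D))" and T: "T \<noteq> {}"
  obtains g :: "nat \<Rightarrow> 'a \<Rightarrow> 'b :: real_normed_vector"
  where "\<And>U. openin (pm_topology T (sup_dist D)) U \<Longrightarrow> U \<noteq> {} \<Longrightarrow> \<exists>j. g j \<in> U"
proof -
  have "\<forall>m. \<exists>F. finite F \<and> F \<subseteq> T \<and> T \<subseteq> (\<Union>s\<in>F. pm_ball T (sup_dist D) s (1 / real (Suc m)))"
  proof
    fix m
    let ?B = "\<lambda>s. pm_ball T (sup_dist D) s (1 / real (Suc m))"
    have "T \<subseteq> \<Union> (?B ` T)" by (auto simp: pm_ball_def)
    then obtain \<F> where "finite \<F>" "\<F> \<subseteq> ?B ` T" "T \<subseteq> \<Union>\<F>"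
      using compact openin_pm_ball_sup_dist unfolding compact_space_alt
      by (metis (no_types, lifting) imageE topspace_pm_topology)
    then show "\<exists>F. finite F \<and> F \<subseteq> T \<and> T \<subseteq> \<Union> (?B ` F)" by (metis finite_subset_image)
  qed
  from choice[OF this] obtain F where F: "\<And>m. finite (F m)" "\<And>m. F m \<subseteq> T"
    "\<And>m. T \<subseteq> (\<Union>s\<in>F m. pm_ball T (sup_dist D) s (1 / real (Suc m)))" by blast
  have "(\<Union>m. F m) \<noteq> {}" using F(3)[of 0] T by auto
  then have range: "range (from_nat_into (\<Union>m. F m)) = (\<Union>m. F m)"
    using F(1) by (intro range_from_nat_into) (auto intro: countable_finite)
  show thesis
  proof (rule that[of "from_nat_into (\<Union>m. F m)"])
    fix U assume U: "openin (pm_topology T (sup_dist D)) U" "U \<noteq> {}"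
    then obtain s \<rho> where s: "s \<in> U" "s \<in> T" "0 < \<rho>" "pm_ball T (sup_dist D) s \<rho> \<subseteq> U"
      unfolding openin_pm_topology by blast
    obtain m where m: "1 / real (Suc m) < \<rho>" using reals_Archimedean[OF s(3)] by (auto simp: inverse_eq_divide)
    obtain t where t: "t \<in> F m" "sup_dist D t s < ennreal (1 / real (Suc m))"
      using F(3)[of m] s(2) by (auto simp: pm_ball_def)
    have "t \<in> T"
      using t(1) F(2) by blast
    moreover have "sup_dist D t s < ennreal \<rho>"
      using t(2) by (rule order.strict_trans2) (use m in \<open>intro ennreal_leI, simp\<close>)
    ultimately have "t \<in> pm_ball T (sup_dist D) s \<rho>"
      by (simp add: pm_ball_def sup_dist_commute[of D s])
    then show "\<exists>j. from_nat_into (\<Union>m. F m) j \<in> U" using s t range by (metis UN_I UNIV_I rangeE subsetD)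
  qed
qed

section \<open>Empirical norm, support of the design law, lower tail of empirical means\<close>

lemma emp_norm_eq_L2_set: "emp_norm n x f = sqrt (1 / n) * L2_set (\<lambda>i. norm (f (x i))) {..<n}"
  by (simp add: emp_norm_def L2_set_def real_sqrt_mult real_sqrt_divide)

lemma emp_norm_nonneg [simp]: "0 \<le> emp_norm n x f"
  by (simp add: emp_norm_def sum_nonneg)

lemma emp_norm_square: "1 \<le> n \<Longrightarrow> real n * (emp_norm n x f)\<^sup>2 = (\<Sum>i<n. (norm (f (x i)))\<^sup>2)"
  by (simp add: emp_norm_def sum_nonneg)

lemma emp_norm_triangle:
  "emp_norm n x (\<lambda>z. f z - h z) \<le> emp_norm n x (\<lambda>z. f z - g z) + emp_norm n x (\<lambda>z. g z - h z)"
proof -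
  have "L2_set (\<lambda>i. norm (f (x i) - h (x i))) {..<n}
      \<le> L2_set (\<lambda>i. norm (f (x i) - g (x i)) + norm (g (x i) - h (x i))) {..<n}"
    using norm_triangle_ineq[of "f (x i) - g (x i)" "g (x i) - h (x i)" for i]
    by (intro L2_set_mono) auto
  also have "\<dots> \<le> L2_set (\<lambda>i. norm (f (x i) - g (x i))) {..<n} + L2_set (\<lambda>i. norm (g (x i) - h (x i))) {..<n}"
    by (rule L2_set_triangle_ineq)
  finally show ?thesis
    unfolding emp_norm_eq_L2_set by (simp add: distrib_left[symmetric] mult_left_mono)
qed

lemma emp_norm_commute: "emp_norm n x (\<lambda>z. f z - g z) = emp_norm n x (\<lambda>z. g z - f z)"
  by (simp add: emp_norm_def norm_minus_commute)

lemma emp_norm_le: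
  assumes "\<And>i. i < n \<Longrightarrow> norm (f (x i)) \<le> e" "0 \<le> e"
  shows "emp_norm n x f \<le> e"
proof -
  have "(\<Sum>i<n. (norm (f (x i)))\<^sup>2) \<le> (\<Sum>i<n. e\<^sup>2)"
    using assms by (intro sum_mono power_mono) auto
  then have "1 / real n * (\<Sum>i<n. (norm (f (x i)))\<^sup>2) \<le> e\<^sup>2"
    by (cases "n = 0") (auto simp: field_simps)
  then show ?thesis unfolding emp_norm_def using assms(2) by (intro real_le_lsqrt) auto
qed

text \<open>Every point outside the support lies in a basic open set of measure 0, and a countable
  basis has only countably many of these. The hypothesis takes traces on
  \<open>space \<gamma>\<close> because the measure may live on a proper subspace of the
  type.\<close>

lemma AE_measure_support:
  fixes \<gamma> :: "'a :: second_countable_topology measure"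
  assumes sets: "\<And>U. open U \<Longrightarrow> U \<inter> space \<gamma> \<in> sets \<gamma>"
  shows "AE x in \<gamma>. x \<in> measure_support \<gamma>"
proof -
  obtain B :: "'a set set" where B: "countable B" "topological_basis B"
    using ex_countable_basis by blast
  define N where "N = {b \<in> B. emeasure \<gamma> (b \<inter> space \<gamma>) = 0}"
  have null: "(\<Union>b\<in>N. b \<inter> space \<gamma>) \<in> null_sets \<gamma>"
  proof (rule null_sets_UN')
    show "countable N" unfolding N_def using B(1) by simp
    fix b assume "b \<in> N"
    then show "b \<inter> space \<gamma> \<in> null_sets \<gamma>"
      using sets topological_basis_open[OF B(2)] by (auto simp: N_def null_sets_def)
  qed
  show ?thesis
  proof (rule AE_I'[OF null], rule subsetI)
    fix x assume "x \<in> {x \<in> space \<gamma>. x \<notin> measure_support \<gamma>}"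
    then obtain U where U: "x \<in> space \<gamma>" "open U" "x \<in> U" "emeasure \<gamma> (U \<inter> space \<gamma>) = 0"
      by (auto simp: measure_support_def zero_less_iff_neq_zero)
    obtain b where b: "b \<in> B" "x \<in> b" "b \<subseteq> U" using topological_basisE[OF B(2) U(2,3)] by blast
    have "emeasure \<gamma> (b \<inter> space \<gamma>) \<le> emeasure \<gamma> (U \<inter> space \<gamma>)"
      using b sets[OF U(2)] by (intro emeasure_mono) auto
    then show "x \<in> (\<Union>b\<in>N. b \<inter> space \<gamma>)" using b U by (auto simp: N_def)
  qed
qed

text \<open>Chernoff's bound with parameter 1 / b. On [0, 1] the chord of exp (- y) lies below 1 - 3
  y / 5, since exp (- 1) \<le> 2/5; halving the mean leaves the exponent 1/2 - 3/5 = - 1/10 times n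
  times the mean over b. It is linear in the mean, where a Hoeffding bound would be
  quadratic.\<close>

lemma empirical_mean_lower_tail:
  fixes Z :: "'a \<Rightarrow> real" and n :: nat
  assumes \<gamma>: "prob_space \<gamma>" and [measurable]: "Z \<in> borel_measurable \<gamma>"
    and Z0: "\<And>x. 0 \<le> Z x" and ZF: "AE x in \<gamma>. Z x \<le> b" and b: "0 < b"
  shows "measure (Pi\<^sub>M {..<n} (\<lambda>_. \<gamma>)) {x \<in> space (Pi\<^sub>M {..<n} (\<lambda>_. \<gamma>)).
      (\<Sum>i<n. Z (x i)) \<le> n * (\<integral>x. Z x \<partial>\<gamma>) / 2} \<le> exp (- (n * (\<integral>x. Z x \<partial>\<gamma>) / (10 * b)))"
proof -
  interpret g: prob_space \<gamma> by fact
  interpret P: product_prob_space "\<lambda>_. \<gamma>" "{..<n}" by unfold_locales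
  let ?P = "Pi\<^sub>M {..<n} (\<lambda>_. \<gamma>)"
  define \<mu> where "\<mu> = (\<integral>x. Z x \<partial>\<gamma>)"
  have intZ: "integrable \<gamma> Z"
    using ZF Z0 by (intro g.integrable_const_bound[of _ b]) auto
  have mgf: "(\<integral>\<^sup>+x. ennreal (exp (- Z x / b)) \<partial>\<gamma>) \<le> ennreal (exp (- (3 / 5) * \<mu> / b))"
  proof -
    have pt: "exp (- Z x / b) \<le> 1 - 3 / 5 * (Z x / b)" if "Z x \<le> b" for x
    proof -
      define y where "y = Z x / b"
      have y: "0 \<le> y" "y \<le> 1" using that Z0[of x] b by (auto simp: y_def)
      have "exp (- y) \<le> (1 - y) * exp 0 + y * exp (- 1)"
        using convex_onD[OF exp_convex, of y 0 "- 1"] y by simp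
      moreover have "exp (- 1) \<le> (2 / 5 :: real)"
        using exp_lower_Taylor_quadratic[of 1] by (simp add: exp_minus field_simps)
      then have "y * exp (- 1) \<le> y * (2 / 5)" using y by (intro mult_left_mono)
      ultimately show ?thesis by (simp add: y_def)
    qed
    have "(\<integral>\<^sup>+x. ennreal (exp (- Z x / b)) \<partial>\<gamma>) \<le> (\<integral>\<^sup>+x. ennreal (1 - 3 / 5 * (Z x / b)) \<partial>\<gamma>)"
      using ZF by (intro nn_integral_mono_AE) (erule eventually_mono, intro ennreal_leI pt)
    also have "\<dots> = ennreal (\<integral>x. 1 - 3 / 5 * (Z x / b) \<partial>\<gamma>)"
    proof (rule nn_integral_eq_integral)
      show "integrable \<gamma> (\<lambda>x. 1 - 3 / 5 * (Z x / b))" using intZ by simp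
      show "AE x in \<gamma>. 0 \<le> 1 - 3 / 5 * (Z x / b)"
        using ZF by eventually_elim (use pt exp_ge_zero order_trans in blast)
    qed
    also have "(\<integral>x. 1 - 3 / 5 * (Z x / b) \<partial>\<gamma>) = 1 + - (3 / 5) * \<mu> / b"
      using intZ by (simp add: g.prob_space \<mu>_def)
    also have "\<dots> \<le> exp (- (3 / 5) * \<mu> / b)" by (rule exp_ge_add_one_self)
    finally show ?thesis by (simp add: ennreal_leI)
  qed
  let ?A = "{x \<in> space ?P. (\<Sum>i<n. Z (x i)) \<le> n * \<mu> / 2}"
  have "emeasure ?P ?A = (\<integral>\<^sup>+x. indicator ?A x \<partial>?P)" by simp
  also have "\<dots> \<le> (\<integral>\<^sup>+x. ennreal (exp (n * \<mu> / (2 * b))) * (\<Prod>i<n. ennreal (exp (- Z (x i) / b))) \<partial>?P)"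
  proof (rule nn_integral_mono)
    fix x assume "x \<in> space ?P"
    have "exp (\<Sum>i<n. - Z (x i) / b) = (\<Prod>i<n. exp (- Z (x i) / b))"
      by (rule exp_sum) simp
    moreover have "(\<Sum>i<n. - Z (x i) / b) = - (\<Sum>i<n. Z (x i)) / b"
      by (simp add: sum_divide_distrib sum_negf)
    ultimately have "(\<Prod>i<n. exp (- Z (x i) / b)) = exp (- (\<Sum>i<n. Z (x i)) / b)" by simp
    then have eq: "ennreal (exp (n * \<mu> / (2 * b))) * (\<Prod>i<n. ennreal (exp (- Z (x i) / b)))
        = ennreal (exp (n * \<mu> / (2 * b) - (\<Sum>i<n. Z (x i)) / b))"
      by (simp add: prod_ennreal ennreal_mult[symmetric] exp_add[symmetric])
    show "indicator ?A x \<le> ennreal (exp (n * \<mu> / (2 * b))) * (\<Prod>i<n. ennreal (exp (- Z (x i) / b)))"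
      unfolding eq using b by (auto simp: field_simps split: split_indicator)
  qed
  also have "\<dots> = ennreal (exp (n * \<mu> / (2 * b))) * (\<integral>\<^sup>+x. ennreal (exp (- Z x / b)) \<partial>\<gamma>) ^ n"
    using P.product_nn_integral_prod[of "{..<n}" "\<lambda>_ z. ennreal (exp (- Z z / b))"]
    by (subst nn_integral_cmult) auto
  also have "\<dots> \<le> ennreal (exp (n * \<mu> / (2 * b))) * ennreal (exp (- (3 / 5) * \<mu> / b)) ^ n"
    using mgf by (intro mult_left_mono power_mono) auto
  also have "\<dots> = ennreal (exp (n * \<mu> / (2 * b) + n * (- (3 / 5) * \<mu> / b)))"
    by (simp only: ennreal_power[OF exp_ge_zero] ennreal_mult[OF exp_ge_zero exp_ge_zero]
        exp_of_nat_mult[symmetric] exp_add)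
  also have "n * \<mu> / (2 * b) + n * (- (3 / 5) * \<mu> / b) = - (n * \<mu> / (10 * b))"
    using b by (simp add: field_simps)
  finally show ?thesis by (simp add: P.emeasure_eq_measure \<mu>_def)
qed

section \<open>Localization and peeling\<close>

lemma emp_norm_le_sup_dist:
  assumes "\<And>i. i < n \<Longrightarrow> x i \<in> D"
  shows "ennreal (emp_norm n x (\<lambda>z. f z - g z)) \<le> sup_dist D f g"
proof (cases "sup_dist D f g")
  case (real m)
  have "emp_norm n x (\<lambda>z. f z - g z) \<le> m"
    using norm_le_of_sup_norm[of D "\<lambda>z. f z - g z" m] real assms
    by (intro emp_norm_le) (auto simp: sup_dist_def)
  then show ?thesis using real by (simp add: ennreal_leI)
qed simp

lemma openin_emp_norm_ball:
  assumes "\<And>i. i < n \<Longrightarrow> x i \<in> D"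
  shows "openin (pm_topology T (sup_dist D)) {f \<in> T. emp_norm n x (\<lambda>z. f z - c z) < r}"
  unfolding openin_pm_topology
proof (intro conjI ballI)
  fix f assume f: "f \<in> {f \<in> T. emp_norm n x (\<lambda>z. f z - c z) < r}"
  let ?\<rho> = "r - emp_norm n x (\<lambda>z. f z - c z)"
  show "\<exists>\<rho>>0. pm_ball T (sup_dist D) f \<rho> \<subseteq> {f \<in> T. emp_norm n x (\<lambda>z. f z - c z) < r}"
  proof (intro exI[of _ ?\<rho>] conjI subsetI)
    show "0 < ?\<rho>" using f by simp
    fix h assume h: "h \<in> pm_ball T (sup_dist D) f ?\<rho>"
    then have "ennreal (emp_norm n x (\<lambda>z. f z - h z)) < ennreal ?\<rho>"
      using emp_norm_le_sup_dist[of n x D f h] assms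
      by (auto simp: pm_ball_def intro: order.strict_trans1)
    then have "emp_norm n x (\<lambda>z. h z - f z) < ?\<rho>"
      by (simp add: ennreal_less_iff emp_norm_commute[of n x h f])
    then show "h \<in> {f \<in> T. emp_norm n x (\<lambda>z. f z - c z) < r}"
      using h emp_norm_triangle[of n x h c f] by (simp add: pm_ball_def)
  qed
qed auto

text \<open>Increments of the noise are sub-Gaussian for \<open>sqrt n\<close> times the empirical
  norm, which explains the chaining parameter \<open>v\<close>. The class has radius r around
  \<open>Gst\<close>, so \<open>{Gst}\<close> serves as the net of level 0; the nets from the
  entropy integral begin at level 1 and turn the 2 P of the chaining bound into 4 P.\<close>

lemma local_class_chaining:
  fixes GG :: "('a \<Rightarrow> 'b :: real_normed_vector) set" and g :: "nat \<Rightarrow> 'a \<Rightarrow> 'b"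
  assumes M: "prob_space M" and n: "1 \<le> n" and sg: "subgaussian_functionals M Y n \<epsilon> K" and K: "0 < K"
    and Y: "\<And>G i. G \<in> GG \<Longrightarrow> i < n \<Longrightarrow> G (x i) \<in> Y" and Gst: "Gst \<in> GG"
    and r: "0 < r" and q: "0 \<le> q"
    and J: "entropy_integral (local_class GG Gst n x r) (emp_dist n x) r \<le> ennreal P" "0 \<le> P"
  obtains B where "B \<in> sets M" "measure M B \<le> 2 * exp (- q)"
    "\<And>\<omega> j. \<omega> \<in> space M - B \<Longrightarrow> g j \<in> local_class GG Gst n x r \<Longrightarrow>
      (\<Sum>i<n. \<epsilon> i \<omega> (g j (x i))) - (\<Sum>i<n. \<epsilon> i \<omega> (Gst (x i)))
        \<le> 2 * sqrt K * sqrt n * (4 * P + 4 * r + 2 * r * sqrt q)"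
proof -
  let ?T = "local_class GG Gst n x r"
  let ?d = "\<lambda>f g. emp_norm n x (\<lambda>z. f z - g z)"
  let ?Z = "\<lambda>G \<omega>. \<Sum>i<n. \<epsilon> i \<omega> (G (x i))"
  have GstT: "Gst \<in> ?T" using Gst r by (simp add: local_class_def emp_norm_def)
  then obtain S where S: "\<And>k. 1 \<le> k \<Longrightarrow> finite (S k)" "\<And>k. 1 \<le> k \<Longrightarrow> S k \<subseteq> ?T"
    "\<And>k. 1 \<le> k \<Longrightarrow> ?T \<subseteq> (\<Union>s\<in>S k. pm_ball ?T (emp_dist n x) s (r / 2 ^ k))"
    "\<And>m. (\<Sum>k=1..m. r / 2 ^ k * sqrt (ln (card (S k)))) \<le> 2 * P"
    using entropy_integral_nets[OF r J] by blast
  define S' where "S' k = (if k = 0 then {Gst} else S k)" for k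
  obtain B where "B \<in> sets M" "measure M B \<le> 2 * exp (- q)"
    "\<And>\<omega> j. \<omega> \<in> space M - B \<Longrightarrow> g j \<in> ?T \<Longrightarrow>
      ?Z (g j) \<omega> - ?Z Gst \<omega> \<le> 2 * sqrt K * sqrt n * (2 * (2 * P) + 4 * r + 2 * r * sqrt q)"
  proof (rule chaining_bound[OF M, where Z = ?Z and d = ?d and T = ?T and S = S' and ?t0.0 = Gst
        and P = "2 * P" and g = g and r = r and q = q and v = "2 * sqrt K * sqrt n"])
    show "?Z a \<in> borel_measurable M" if "a \<in> ?T" for a
      using sg Y that by (intro borel_measurable_sum) (auto simp: subgaussian_functionals_def local_class_def)
    show "measure M {\<omega> \<in> space M. 2 * sqrt K * sqrt n * D * sqrt w \<le> ?Z a \<omega> - ?Z b \<omega>} \<le> exp (- w)"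
      if "a \<in> ?T" "b \<in> ?T" "?d a b \<le> D" "0 < D" "0 \<le> w" for a b D w
    proof -
      have "(\<Sum>i<n. (norm (a (x i) - b (x i)))\<^sup>2) = real n * (?d a b)\<^sup>2"
        using emp_norm_square[OF n, of x "\<lambda>z. a z - b z"] by simp
      also have "\<dots> \<le> (sqrt n * D)\<^sup>2"
        using that by (simp add: power_mult_distrib mult_left_mono power_mono)
      finally show ?thesis
        using subgaussian_functionals_tail[OF M sg K, of "\<lambda>i. a (x i)" "\<lambda>i. b (x i)" "sqrt n * D" w]
          that Y n by (simp add: local_class_def mult_ac)
    qed
    show "\<exists>s\<in>S' k. ?d t s \<le> r / 2 ^ k" if t: "t \<in> ?T" for k t
    proof (cases "k = 0")
      case True
      then show ?thesis using t by (simp add: S'_def local_class_def)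
    next
      case False
      then obtain s where s: "s \<in> S k" "t \<in> pm_ball ?T (emp_dist n x) s (r / 2 ^ k)"
        using S(3)[of k] t by auto
      then have "?d s t < r / 2 ^ k" by (simp add: pm_ball_def emp_dist_def ennreal_less_iff)
      then show ?thesis using s False emp_norm_commute[of n x s t] by (auto simp: S'_def intro!: bexI[of _ s])
    qed
    show "(\<Sum>k=1..m. r / 2 ^ k * sqrt (ln (card (S' k)))) \<le> 2 * P" for m
      using S(4)[of m] by (simp add: S'_def)
  qed (use r q n K S GstT in \<open>auto simp: S'_def\<close>)
  then show thesis using that by simp
qed

text \<open>Peeling over the shells \<open>2 ^ k * R / 8 \<le> emp_norm n x (G - Gst) < 2 ^ (k + 1) * R / 8\<close>.\<close>

lemma noise_term_uniform_bound:
  fixes GG :: "('a \<Rightarrow> 'b :: real_normed_vector) set" and \<Psi> :: "real \<Rightarrow> real"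
  assumes M: "prob_space M" and n: "1 \<le> n" and sg: "subgaussian_functionals M Y n \<epsilon> K" and K: "0 < K"
    and Y: "\<And>G i. G \<in> GG \<Longrightarrow> i < n \<Longrightarrow> G (x i) \<in> Y" and Gst: "Gst \<in> GG"
    and x: "\<And>i. i < n \<Longrightarrow> x i \<in> D" and compact: "compact_space (pm_topology GG (sup_dist D))"
    and J: "\<And>d. 0 < d \<Longrightarrow> entropy_integral (local_class GG Gst n x d) (emp_dist n x) d \<le> ennreal (\<Psi> d)"
    and \<Psi>: "\<And>d. 0 < d \<Longrightarrow> 0 \<le> \<Psi> d" "antimono_on {0<..} (\<lambda>d. \<Psi> d / d\<^sup>2)"
    and \<sigma>: "0 < \<sigma>" and \<delta>: "0 < \<delta>" and C: "C = 2048 * sqrt K" "4 \<le> C"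
    and C\<Psi>: "C * \<sigma> * \<Psi> \<delta> \<le> sqrt n * \<delta>\<^sup>2" and R: "C * \<delta> \<le> R" "C * (\<sigma> / sqrt n) \<le> R"
  obtains B where "B \<in> sets M" "measure M B \<le> exp (- (n * R\<^sup>2 / (C\<^sup>2 * \<sigma>\<^sup>2)))"
    "\<And>\<omega> G. \<omega> \<in> space M - B \<Longrightarrow>
      continuous_map (pm_topology GG (sup_dist D)) euclideanreal (\<lambda>G. \<Sum>i<n. \<epsilon> i \<omega> (G (x i))) \<Longrightarrow>
      G \<in> GG \<Longrightarrow> R / 8 \<le> emp_norm n x (\<lambda>z. G z - Gst z) \<Longrightarrow>
      (\<Sum>i<n. \<epsilon> i \<omega> (G (x i))) - (\<Sum>i<n. \<epsilon> i \<omega> (Gst (x i)))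
        < n * (emp_norm n x (\<lambda>z. G z - Gst z))\<^sup>2 / (4 * \<sigma>)"
proof -
  interpret prob_space M by fact
  let ?top = "pm_topology GG (sup_dist D)"
  let ?d = "\<lambda>G. emp_norm n x (\<lambda>z. G z - Gst z)"
  let ?Z = "\<lambda>G \<omega>. \<Sum>i<n. \<epsilon> i \<omega> (G (x i))"
  define s where "s = sqrt (real n)"
  have s: "0 < s" "s\<^sup>2 = real n" using n by (auto simp: s_def)
  define a where "a = n * R\<^sup>2 / (C\<^sup>2 * \<sigma>\<^sup>2)"
  have R0: "0 < R" using R(1) \<delta> C(2) by (smt (verit) mult_pos_pos)
  have C0: "0 < C" using C(2) by simp
  have sR: "C * \<sigma> \<le> s * R" using R(2) s(1) by (simp add: s_def field_simps)
  have a_sq: "a = (s * R / (C * \<sigma>))\<^sup>2" by (simp add: a_def power_divide power_mult_distrib s)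
  have "1 \<le> s * R / (C * \<sigma>)" using sR mult_pos_pos[OF C0 \<sigma>]
    by (simp add: le_divide_eq)
  \<comment> \<open>This is where R \<ge> C \<sigma> / sqrt n enters: with a \<ge> 1 the sum over
    all shells is absorbed into the first exponent.\<close>
  then have a1: "1 \<le> a" unfolding a_sq by (rule one_le_power)
  obtain g :: "nat \<Rightarrow> 'a \<Rightarrow> 'b" where g: "\<And>U. openin ?top U \<Longrightarrow> U \<noteq> {} \<Longrightarrow> \<exists>j. g j \<in> U"
    using compact_pm_topology_dense_sequence[OF compact] Gst by blast
  \<comment> \<open>\<open>r k\<close> is the outer radius of the k-th shell. The exponent
    \<open>q k\<close> grows like the square of \<open>r k\<close>, so the deviation
    \<open>r k * sqrt (q k)\<close> scales like \<open>r k\<close> squared, exactly as the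
    admissible noise level does.\<close>
  define r where "r k = 2 ^ Suc k * (R / 8)" for k
  define q where "q k = a * 4 ^ Suc k" for k
  define b where "b k = 2 * sqrt K * sqrt n * (4 * \<Psi> (r k) + 4 * r k + 2 * r k * sqrt (q k))" for k
  have r0: "0 < r k" for k using R0 by (simp add: r_def)
  have q0: "0 \<le> q k" for k using a1 by (simp add: q_def)
  have rR: "R / 4 \<le> r k" for k
  proof -
    have "1 * (R / 4) \<le> 2 ^ k * (R / 4)" using R0 by (intro mult_right_mono) auto
    then show ?thesis by (simp add: r_def mult.commute)
  qed
  \<comment> \<open>All terms of the chaining bound are compared with y. Monotonicity of
    \<open>\<Psi> d / d\<^sup>2\<close> carries the condition at \<delta> to \<open>r k\<close> and
    gives \<open>\<Psi> (r k)\<close> \<le> y; the noise-level condition gives \<open>r k\<close>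
    \<le> 4 y; the deviation \<open>r k * sqrt (q k)\<close> is 8 y. So the bracket is at most 4 +
    16 + 16 = 36 times y. The factor 2048 in C has to exceed 16 times 72 = 1152.\<close>
  have b_less: "b k < n * (r k)\<^sup>2 / (16 * \<sigma>)" for k
  proof -
    define y where "y = (r k)\<^sup>2 * s / (C * \<sigma>)"
    have "C * \<delta> / 4 \<le> r k" using R(1) rR[of k] by linarith
    moreover have "4 * \<delta> \<le> C * \<delta>" using C(2) \<delta> by (intro mult_right_mono) auto
    ultimately have "\<delta> \<le> r k" by linarith
    then have "\<Psi> (r k) / (r k)\<^sup>2 \<le> \<Psi> \<delta> / \<delta>\<^sup>2"
      using \<Psi>(2) \<delta> r0[of k] by (auto simp: monotone_on_def)
    also have "\<dots> \<le> s / (C * \<sigma>)" using C\<Psi> C0 \<sigma> \<delta> by (simp add: s_def field_simps)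
    finally have 1: "\<Psi> (r k) \<le> y" using r0[of k] by (simp add: pos_divide_le_eq y_def mult.commute)
    have C\<sigma>: "0 < C * \<sigma>" using C0 \<sigma> by simp
    have "s * R \<le> s * (4 * r k)" using rR[of k] s(1) by (intro mult_left_mono) auto
    then have "r k * (C * \<sigma>) \<le> r k * (s * (4 * r k))" using sR r0[of k] by (intro mult_left_mono) auto
    also have "\<dots> = 4 * y * (C * \<sigma>)" using C0 \<sigma> by (simp add: y_def power2_eq_square)
    finally have 2: "r k \<le> 4 * y" using C\<sigma> by (rule mult_right_le_imp_le)
    have "q k = (2 ^ Suc k * (s * R / (C * \<sigma>)))\<^sup>2"
    proof -
      have "(4 :: real) ^ Suc k = (2 ^ Suc k)\<^sup>2" by (simp only: power_even_eq[symmetric] power_mult) simp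
      then show ?thesis by (simp only: q_def a_sq power_mult_distrib mult.commute)
    qed
    then have "sqrt (q k) = 2 ^ Suc k * (s * R / (C * \<sigma>))"
      using s(1) R0 C0 \<sigma> by (simp only: real_sqrt_abs abs_of_nonneg) simp
    also have "\<dots> = (2 ^ Suc k * R) * s / (C * \<sigma>)" by simp
    also have "2 ^ Suc k * R = 8 * r k" by (simp add: r_def)
    finally have "r k * sqrt (q k) = 8 * y" by (simp add: y_def power2_eq_square)
    then have "4 * \<Psi> (r k) + 4 * r k + 2 * r k * sqrt (q k) \<le> 36 * y" using 1 2 by linarith
    then have "b k \<le> 2 * sqrt K * s * (36 * y)"
      unfolding b_def s_def[symmetric] using K s(1) by (intro mult_left_mono) auto
    also have "\<dots> = 72 / 2048 * (n * (r k)\<^sup>2 / \<sigma>)"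
    proof -
      have K': "sqrt K = C / 2048" using C(1) by simp
      show ?thesis unfolding K' y_def s(2)[symmetric] using C0 \<sigma> by (simp add: power2_eq_square)
    qed
    also have "\<dots> < n * (r k)\<^sup>2 / (16 * \<sigma>)"
      using n r0[of k] \<sigma> by (simp add: field_simps)
    finally show ?thesis .
  qed
  have "\<exists>B. B \<in> sets M \<and> measure M B \<le> 2 * exp (- q k) \<and>
    (\<forall>\<omega> j. \<omega> \<in> space M - B \<longrightarrow> g j \<in> local_class GG Gst n x (r k) \<longrightarrow> ?Z (g j) \<omega> - ?Z Gst \<omega> \<le> b k)" for k
    unfolding b_def
  proof (rule local_class_chaining[where GG = GG and x = x and Y = Y and Gst = Gst and r = "r k"
        and q = "q k" and P = "\<Psi> (r k)" and g = g, OF M n sg K _ Gst r0[of k] q0[of k]])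
    show "G (x i) \<in> Y" if "G \<in> GG" "i < n" for G i using that by (rule Y)
  qed (use J[OF r0[of k]] \<Psi>(1)[OF r0[of k]] in blast)+
  then obtain B where B: "\<And>k. B k \<in> sets M" "\<And>k. measure M (B k) \<le> 2 * exp (- q k)"
    "\<And>k \<omega> j. \<omega> \<in> space M - B k \<Longrightarrow> g j \<in> local_class GG Gst n x (r k) \<Longrightarrow> ?Z (g j) \<omega> - ?Z Gst \<omega> \<le> b k"
    by metis
  show thesis
  proof (rule that[of "\<Union>k. B k"])
    show "(\<Union>k. B k) \<in> sets M" using B(1) by blast
    \<comment> \<open>By Bernoulli 4^(k+1) \<ge> 1 + 3 (k+1), and with a \<ge> 1 this leaves 2 (k+1)
      beyond a in the exponent. That pays for the prefactor 2 and for a geometric series of sum 1,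
      so the total is exp (- a) without any factor.\<close>
    have le: "measure M (B k) \<le> exp (- a) * (1 / 2) ^ Suc k" for k
    proof -
      have "1 + 3 * real k \<le> 4 ^ k" by (induction k) auto
      then have "a * (1 + 3 * real (Suc k)) \<le> q k"
        unfolding q_def using a1 by (intro mult_left_mono) auto
      moreover have "1 * (2 * real (Suc k)) \<le> a * (3 * real (Suc k))" using a1 by (intro mult_mono) auto
      ultimately have "a + 2 * real (Suc k) \<le> q k" by (simp add: algebra_simps)
      then have "exp (- q k) \<le> exp (- a + - (2 * real (Suc k)))" by simp
      also have "\<dots> = exp (- a) * exp (- 2) ^ Suc k"
        by (simp only: exp_add exp_of_nat_mult[symmetric]) (simp add: mult.commute)
      also have "\<dots> \<le> exp (- a) * (1 / 4) ^ Suc k"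
      proof (intro mult_left_mono power_mono)
        have "4 \<le> exp (2 :: real)" using exp_lower_Taylor_quadratic[of 2] by simp
        then show "exp (- 2) \<le> (1 / 4 :: real)" by (simp add: exp_minus field_simps)
      qed auto
      finally have "2 * exp (- q k) \<le> exp (- a) * (2 * (1 / 4) ^ Suc k)" by simp
      also have "2 * (1 / 4) ^ Suc k \<le> (1 / 2 :: real) ^ Suc k"
        using power_mono[of "1 / 4" "1 / 2 :: real" k] by simp
      finally show ?thesis using B(2)[of k] by simp
    qed
    have sm: "(\<lambda>k. exp (- a) * (1 / 2) ^ Suc k) sums (exp (- a) * 1)"
      by (intro sums_mult power_half_series)
    have sm': "summable (\<lambda>k. measure M (B k))"
      by (rule summable_comparison_test'[OF sums_summable[OF sm]]) (use le in simp)
    have "measure M (\<Union>k. B k) \<le> (\<Sum>k. measure M (B k))"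
      by (rule finite_measure_subadditive_countably[OF _ sm']) (use B(1) in auto)
    also have "\<dots> \<le> (\<Sum>k. exp (- a) * (1 / 2) ^ Suc k)" by (rule suminf_le[OF le sm' sums_summable[OF sm]])
    also have "\<dots> = exp (- a)" using sums_unique[OF sm] by simp
    finally show "measure M (\<Union>k. B k) \<le> exp (- (n * R\<^sup>2 / (C\<^sup>2 * \<sigma>\<^sup>2)))" by (simp add: a_def)
  next
    fix \<omega> G assume \<omega>: "\<omega> \<in> space M - (\<Union>k. B k)" and G: "G \<in> GG" "R / 8 \<le> ?d G"
      and cont: "continuous_map ?top euclideanreal (\<lambda>G. ?Z G \<omega>)"
    show "?Z G \<omega> - ?Z Gst \<omega> < n * (?d G)\<^sup>2 / (4 * \<sigma>)"
    proof (rule ccontr)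
      assume large: "\<not> ?thesis"
      \<comment> \<open>The first shell whose outer radius exceeds the distance of G. Its inner
        radius is half of that, for k = 0 because of the assumption R / 8; hence the quadratic bound
        at G is at least the bound on the shell.\<close>
      define k where "k = (LEAST k. ?d G < r k)"
      have "\<exists>k. ?d G < r k"
      proof -
        obtain k where "?d G / (R / 8) < 2 ^ k" using real_arch_pow[of 2] by auto
        then have "?d G < 2 ^ k * (R / 8)" using R0 by (simp add: field_simps)
        also have "\<dots> \<le> r k" using R0 by (simp add: r_def)
        finally show ?thesis by blast
      qed
      then have k: "?d G < r k" unfolding k_def by (rule LeastI_ex)
      have "r k / 2 \<le> ?d G"
      proof (cases k)
        case 0
        then show ?thesis using G by (simp add: r_def)
      next
        case (Suc k')
        then have "\<not> ?d G < r k'" using not_less_Least[of k' "\<lambda>k. ?d G < r k"] by (simp add: k_def)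
        then show ?thesis using Suc by (simp add: r_def)
      qed
      then have "(r k / 2)\<^sup>2 \<le> (?d G)\<^sup>2" using r0[of k] by (intro power_mono) auto
      then have "n * (r k)\<^sup>2 / (16 * \<sigma>) \<le> n * (?d G)\<^sup>2 / (4 * \<sigma>)"
        using n \<sigma> by (simp add: field_simps)
      then have b: "?Z Gst \<omega> + b k < ?Z G \<omega>" using large b_less[of k] by linarith
      \<comment> \<open>Both conditions are strict, so the set of violating maps in the shell is
        open; G lies in it, hence so does some \<open>g j\<close>, for which the chaining bound
        holds outside \<open>B k\<close>.\<close>
      let ?U = "{H \<in> GG. ?d H < r k} \<inter> {H \<in> topspace ?top. ?Z H \<omega> \<in> {?Z Gst \<omega> + b k<..}}"
      have "openin ?top {H \<in> GG. ?d H < r k}"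
        by (rule openin_emp_norm_ball) (rule x)
      moreover have "openin ?top {H \<in> topspace ?top. ?Z H \<omega> \<in> {?Z Gst \<omega> + b k<..}}"
        by (rule openin_continuous_map_preimage[OF cont]) simp
      ultimately have "openin ?top ?U" by (rule openin_Int)
      moreover have "G \<in> ?U" using G k b by simp
      ultimately obtain j where j: "g j \<in> ?U" using g[of ?U] by blast
      then have "g j \<in> local_class GG Gst n x (r k)" by (simp add: local_class_def)
      then show False using B(3)[of \<omega> k j] \<omega> j by auto
    qed
  qed
qed

section \<open>The minimizer\<close>

text \<open>A map far from \<open>G0\<close> in \<open>L2\<close> has a net centre that is far too;
  the lower tail bound at that centre, together with sup-norm closeness at the design points,
  returns the estimate to the map. Positive F makes the entropy condition informative, since 0 times
  infinity is 0 in \<open>ennreal\<close>.\<close>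

lemma design_lower_bound:
  fixes \<gamma> :: "'a measure" and GG :: "('a \<Rightarrow> 'b :: real_normed_vector) set" and n :: nat
    and F C \<delta>' R :: real
  assumes \<gamma>: "prob_space \<gamma>" and D: "AE z in \<gamma>. z \<in> D"
    and meas: "\<And>G. G \<in> GG \<Longrightarrow> (\<lambda>z. norm (G z - G0 z)) \<in> borel_measurable \<gamma>"
    and F: "\<And>G z. G \<in> GG \<Longrightarrow> z \<in> D \<Longrightarrow> norm (G z - G0 z) \<le> F" "0 < F"
    and n: "1 \<le> n" and GG: "GG \<noteq> {}" and C: "10 \<le> C" and \<delta>': "0 < \<delta>'" "C * \<delta>' \<le> R"
    and H: "ennreal (C * F\<^sup>2) * metric_entropy GG (sup_dist D) \<delta>' \<le> ennreal (n * \<delta>'\<^sup>2)"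
  obtains B where "B \<in> sets (Pi\<^sub>M {..<n} (\<lambda>_. \<gamma>))"
    "measure (Pi\<^sub>M {..<n} (\<lambda>_. \<gamma>)) B \<le> exp (- (n * R\<^sup>2 / (C\<^sup>2 * F\<^sup>2)))"
    "\<And>x G. x \<in> space (Pi\<^sub>M {..<n} (\<lambda>_. \<gamma>)) - B \<Longrightarrow> (\<And>i. i < n \<Longrightarrow> x i \<in> D) \<Longrightarrow> G \<in> GG \<Longrightarrow>
      R \<le> L2_norm \<gamma> (\<lambda>z. G z - G0 z) \<Longrightarrow> R / 4 \<le> emp_norm n x (\<lambda>z. G z - G0 z)"
proof -
  interpret g: prob_space \<gamma> by fact
  let ?P = "Pi\<^sub>M {..<n} (\<lambda>_. \<gamma>)"
  interpret P: prob_space ?P by (intro prob_space_PiM \<gamma>)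
  have R: "\<delta>' \<le> R / 10" "0 < R"
  proof -
    have "10 * \<delta>' \<le> C * \<delta>'" using C \<delta>' by (intro mult_right_mono) auto
    then show "\<delta>' \<le> R / 10" "0 < R" using \<delta>' by linarith+
  qed
  have CF: "0 < C * F\<^sup>2" using C F by simp
  have "covering_number GG (sup_dist D) \<delta>' \<noteq> \<infinity>"
  proof
    assume "covering_number GG (sup_dist D) \<delta>' = \<infinity>"
    then have "ennreal (C * F\<^sup>2) * metric_entropy GG (sup_dist D) \<delta>' = \<infinity>"
      using CF by (auto simp: metric_entropy_def ennreal_mult_top)
    then show False using H by (simp add: top_unique)
  qed
  then obtain N where N: "covering_number GG (sup_dist D) \<delta>' = enat N" by auto
  then obtain S where S: "finite S" "S \<subseteq> GG" "GG \<subseteq> (\<Union>s\<in>S. pm_ball GG (sup_dist D) s \<delta>')" "card S = N"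
    by (rule covering_number_attained)
  have "S \<noteq> {}" using S(3) GG by auto
  then have N1: "1 \<le> N" using S(1,4) by (metis One_nat_def Suc_leI card_gt_0_iff)
  have "ennreal (C * F\<^sup>2 * ln (real N)) \<le> ennreal (n * \<delta>'\<^sup>2)"
    using H CF N1 by (simp add: metric_entropy_def N ennreal_mult)
  then have lnN: "C * F\<^sup>2 * ln (real N) \<le> n * \<delta>'\<^sup>2" by simp
  define \<mu> where "\<mu> s = (\<integral>z. (norm (s z - G0 z))\<^sup>2 \<partial>\<gamma>)" for s
  have int: "integrable \<gamma> (\<lambda>z. (norm (G z - G0 z))\<^sup>2)" if "G \<in> GG" for G
  proof (rule g.integrable_const_bound[of _ "F\<^sup>2"])
    show "AE z in \<gamma>. norm ((norm (G z - G0 z))\<^sup>2) \<le> F\<^sup>2"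
      using D by eventually_elim (use F(1)[OF that] in \<open>auto intro: power_mono\<close>)
  qed (use meas[OF that] in measurable)
  define A where "A s = {x \<in> space ?P. (\<Sum>i<n. (norm (s (x i) - G0 (x i)))\<^sup>2) \<le> n * \<mu> s / 2}" for s
  \<comment> \<open>Only centres at a definite distance from \<open>G0\<close> enter the union
    bound: the exponent is proportional to the mean \<open>\<mu> s\<close> and would be void for
    close ones.\<close>
  define S' where "S' = {s \<in> S. R\<^sup>2 / 4 \<le> \<mu> s}"
  have A: "A s \<in> sets ?P" "measure ?P (A s) \<le> exp (- (n * R\<^sup>2 / (40 * F\<^sup>2)))" if s: "s \<in> S'" for s
  proof -
    have sGG: "s \<in> GG" and \<mu>: "R\<^sup>2 / 4 \<le> \<mu> s" using s S(2) by (auto simp: S'_def)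
    note [measurable] = meas[OF sGG]
    have "(\<lambda>x. \<Sum>i<n. (norm (s (x i) - G0 (x i)))\<^sup>2) \<in> borel_measurable ?P"
    proof (rule borel_measurable_sum)
      fix i assume "i \<in> {..<n}"
      then have "(\<lambda>x. x i) \<in> ?P \<rightarrow>\<^sub>M \<gamma>" by (rule measurable_component_singleton)
      from measurable_compose[OF this meas[OF sGG]]
      show "(\<lambda>x. (norm (s (x i) - G0 (x i)))\<^sup>2) \<in> borel_measurable ?P" by measurable
    qed
    then show "A s \<in> sets ?P" unfolding A_def by measurable
    have "measure ?P (A s) \<le> exp (- (n * \<mu> s / (10 * F\<^sup>2)))"
      unfolding A_def \<mu>_def
    proof (rule empirical_mean_lower_tail[OF \<gamma>])
      show "AE z in \<gamma>. (norm (s z - G0 z))\<^sup>2 \<le> F\<^sup>2"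
        using D by eventually_elim (use F(1)[OF sGG] in \<open>auto intro: power_mono\<close>)
    qed (use F in \<open>auto\<close>)
    also have "\<dots> \<le> exp (- (n * (R\<^sup>2 / 4) / (10 * F\<^sup>2)))"
    proof -
      have "n * (R\<^sup>2 / 4) / (10 * F\<^sup>2) \<le> n * \<mu> s / (10 * F\<^sup>2)"
        using \<mu> by (intro divide_right_mono mult_left_mono) auto
      then show ?thesis by simp
    qed
    finally show "measure ?P (A s) \<le> exp (- (n * R\<^sup>2 / (40 * F\<^sup>2)))" by simp
  qed
  show thesis
  proof (rule that[of "\<Union>s\<in>S'. A s"])
    have fin: "finite S'" using S(1) by (simp add: S'_def)
    show "(\<Union>s\<in>S'. A s) \<in> sets ?P" using A(1) fin by auto
    have "measure ?P (\<Union>s\<in>S'. A s) \<le> (\<Sum>s\<in>S'. measure ?P (A s))"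
      using A(1) fin by (intro P.finite_measure_subadditive_finite) auto
    also have "\<dots> \<le> real (card S') * exp (- (n * R\<^sup>2 / (40 * F\<^sup>2)))"
      using A(2) by (rule sum_bounded_above)
    also have "\<dots> \<le> real N * exp (- (n * R\<^sup>2 / (40 * F\<^sup>2)))"
      using card_mono[OF S(1), of S'] S(4) by (intro mult_right_mono) (auto simp: S'_def)
    also have "\<dots> = exp (ln (real N) - n * R\<^sup>2 / (40 * F\<^sup>2))"
      using N1 by (simp add: diff_conv_add_uminus exp_add del: add_uminus_conv_diff)
    also have "\<dots> \<le> exp (- (n * R\<^sup>2 / (C\<^sup>2 * F\<^sup>2)))"
    proof -
      \<comment> \<open>From C \<ge> 10 and \<delta>' \<le> R / 10 the entropy costs at most w /
        1000, and w / 40 - w / 1000 still exceeds w / 100, hence w / C^2.\<close>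
      define w where "w = n * R\<^sup>2 / F\<^sup>2"
      have w: "0 \<le> w" by (simp add: w_def)
      have "\<delta>'\<^sup>2 \<le> (R / 10)\<^sup>2" using R \<delta>' by (intro power_mono) auto
      then have "n * \<delta>'\<^sup>2 \<le> n * (R / 10)\<^sup>2" by (intro mult_left_mono) auto
      then have "C * F\<^sup>2 * ln (real N) \<le> n * (R / 10)\<^sup>2" using lnN by linarith
      moreover have "10 * (F\<^sup>2 * ln (real N)) \<le> C * (F\<^sup>2 * ln (real N))"
        using C N1 by (intro mult_right_mono) auto
      ultimately have "F\<^sup>2 * ln (real N) * 1000 \<le> n * R\<^sup>2" by (simp add: power_divide)
      then have "ln (real N) \<le> w / 1000" using F(2) by (simp add: w_def field_simps)
      moreover have "n * R\<^sup>2 / (C\<^sup>2 * F\<^sup>2) \<le> w / 100"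
      proof -
        have "10\<^sup>2 \<le> C\<^sup>2" using C by (intro power_mono) auto
        then have "w / C\<^sup>2 \<le> w / 100" using w by (intro divide_left_mono) auto
        then show ?thesis by (simp add: w_def mult.commute)
      qed
      moreover have "n * R\<^sup>2 / (40 * F\<^sup>2) = w / 40" by (simp add: w_def)
      ultimately show ?thesis using w by simp
    qed
    finally show "measure ?P (\<Union>s\<in>S'. A s) \<le> exp (- (n * R\<^sup>2 / (C\<^sup>2 * F\<^sup>2)))" .
  next
    fix x G assume x: "x \<in> space ?P - (\<Union>s\<in>S'. A s)" and xD: "\<And>i. i < n \<Longrightarrow> x i \<in> D"
      and G: "G \<in> GG" "R \<le> L2_norm \<gamma> (\<lambda>z. G z - G0 z)"
    obtain s where s: "s \<in> S" "sup_dist D s G < ennreal \<delta>'" using S(3) G(1) by (auto simp: pm_ball_def)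
    have sGG: "s \<in> GG" using s S(2) by blast
    have near: "norm (s z - G z) \<le> \<delta>'" if "z \<in> D" for z
      using norm_le_of_sup_norm[of D "\<lambda>z. s z - G z" \<delta>' z] s(2) \<delta>'(1) that by (simp add: sup_dist_def)
    have "R\<^sup>2 \<le> (L2_norm \<gamma> (\<lambda>z. G z - G0 z))\<^sup>2" using G(2) R(2) by (intro power_mono) auto
    also have "\<dots> = \<mu> G" by (simp add: L2_norm_def \<mu>_def)
    also have "\<mu> G \<le> (\<integral>z. 2 * (norm (s z - G0 z))\<^sup>2 + 2 * \<delta>'\<^sup>2 \<partial>\<gamma>)"
      unfolding \<mu>_def
    proof (rule integral_mono_AE)
      show "AE z in \<gamma>. (norm (G z - G0 z))\<^sup>2 \<le> 2 * (norm (s z - G0 z))\<^sup>2 + 2 * \<delta>'\<^sup>2"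
        using D
      proof eventually_elim
        case (elim z)
        have "norm (G z - G0 z) \<le> norm (s z - G0 z) + \<delta>'"
          using norm_triangle_ineq4[of "s z - G0 z" "s z - G z"] near[OF elim] by simp
        then have "(norm (G z - G0 z))\<^sup>2 \<le> (norm (s z - G0 z) + \<delta>')\<^sup>2" by (intro power_mono) auto
        also have "\<dots> \<le> 2 * (norm (s z - G0 z))\<^sup>2 + 2 * \<delta>'\<^sup>2"
          using zero_le_power2[of "norm (s z - G0 z) - \<delta>'"] by (simp add: power2_sum power2_diff)
        finally show ?case .
      qed
    qed (use int[OF G(1)] int[OF sGG] in auto)
    also have "\<dots> = 2 * \<mu> s + 2 * \<delta>'\<^sup>2" using int[OF sGG] by (simp add: \<mu>_def g.prob_space)
    finally have "R\<^sup>2 \<le> 2 * \<mu> s + 2 * \<delta>'\<^sup>2" .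
    moreover have "\<delta>'\<^sup>2 \<le> (R / 10)\<^sup>2" using R \<delta>' by (intro power_mono) auto
    then have "\<delta>'\<^sup>2 \<le> R\<^sup>2 / 100" by (simp add: power_divide)
    ultimately have \<mu>: "R\<^sup>2 / 4 \<le> \<mu> s" using zero_le_power2[of R] by linarith
    then have "s \<in> S'" using s by (simp add: S'_def)
    then have "x \<notin> A s" using x by blast
    then have "n * \<mu> s / 2 < (\<Sum>i<n. (norm (s (x i) - G0 (x i)))\<^sup>2)" using x by (auto simp: A_def)
    also have "\<dots> = n * (emp_norm n x (\<lambda>z. s z - G0 z))\<^sup>2"
      using emp_norm_square[OF n, of x "\<lambda>z. s z - G0 z"] by simp
    finally have "\<mu> s / 2 < (emp_norm n x (\<lambda>z. s z - G0 z))\<^sup>2" using n by simp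
    \<comment> \<open>The squared empirical norm exceeds \<open>\<mu> s / 2\<close> \<ge> R^2 / 8 =
      50/400 R^2. The value 7/20 is chosen below the square root so that subtracting \<delta>' \<le>
      R / 10 leaves exactly R / 4.\<close>
    moreover have "(7 * R / 20)\<^sup>2 = 49 / 400 * R\<^sup>2" by (simp add: power_divide power_mult_distrib)
    ultimately have "(7 * R / 20)\<^sup>2 \<le> (emp_norm n x (\<lambda>z. s z - G0 z))\<^sup>2"
      using \<mu> zero_le_power2[of R] by linarith
    then have "7 * R / 20 \<le> emp_norm n x (\<lambda>z. s z - G0 z)" by (rule power2_le_imp_le) simp
    moreover have "emp_norm n x (\<lambda>z. s z - G z) \<le> \<delta>'" using near xD \<delta>' by (intro emp_norm_le) auto
    ultimately show "R / 4 \<le> emp_norm n x (\<lambda>z. G z - G0 z)"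
      using emp_norm_triangle[of n x s G0 G] R by linarith
  qed
qed

text \<open>Completing the square turns the risk into the squared distance from \<open>G0\<close>, a
  term free of G that cancels in comparisons, and the noise term.\<close>

lemma empirical_risk_observation:
  fixes G G0 :: "'a \<Rightarrow> 'b :: real_inner"
  assumes n: "1 \<le> n"
  shows "empirical_risk n x (observation G0 \<sigma> \<epsilon> (x, \<omega>)) G
    = (emp_norm n x (\<lambda>z. G z - G0 z))\<^sup>2 - (emp_norm n x G0)\<^sup>2 - 2 * \<sigma> / n * (\<Sum>i<n. \<epsilon> i \<omega> (G (x i)))"
proof -
  have "n * empirical_risk n x (observation G0 \<sigma> \<epsilon> (x, \<omega>)) G
      = (\<Sum>i<n. - 2 * (inner (G0 (x i)) (G (x i)) + \<sigma> * \<epsilon> i \<omega> (G (x i))) + (norm (G (x i)))\<^sup>2)"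
    using n by (simp add: empirical_risk_def observation_def)
  also have "\<dots> = (\<Sum>i<n. (norm (G (x i) - G0 (x i)))\<^sup>2 - (norm (G0 (x i)))\<^sup>2 - 2 * \<sigma> * \<epsilon> i \<omega> (G (x i)))"
    by (intro sum.cong refl)
       (simp add: power2_norm_eq_inner inner_diff_left inner_diff_right inner_commute algebra_simps)
  also have "\<dots> = n * ((emp_norm n x (\<lambda>z. G z - G0 z))\<^sup>2 - (emp_norm n x G0)\<^sup>2
      - 2 * \<sigma> / n * (\<Sum>i<n. \<epsilon> i \<omega> (G (x i))))"
    using n by (simp add: sum_subtractf sum_distrib_left right_diff_distrib emp_norm_square
        emp_norm_square[of n x "\<lambda>z. G z - G0 z"])
  finally show ?thesis using n by simp
qed

text \<open>For noise with values in the Hilbert space, path continuity, which the white noise model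
  has to postulate, is automatic: by Cauchy-Schwarz the noise term is Lipschitz in the sup
  distance.\<close>

lemma subgaussian_noise_continuous:
  fixes GG :: "('a \<Rightarrow> 'b :: {real_inner, banach, second_countable_topology}) set"
  assumes sg: "subgaussian_noise M Y n \<epsilon>" and \<omega>: "\<omega> \<in> space M" and x: "\<And>i. i < n \<Longrightarrow> x i \<in> D"
    and Y: "\<And>G i. G \<in> GG \<Longrightarrow> i < n \<Longrightarrow> G (x i) \<in> Y"
  shows "continuous_map (pm_topology GG (sup_dist D)) euclideanreal (\<lambda>G. \<Sum>i<n. \<epsilon> i \<omega> (G (x i)))"
proof -
  obtain e where e: "\<And>i y. i < n \<Longrightarrow> y \<in> Y \<Longrightarrow> \<epsilon> i \<omega> y = inner (e i \<omega>) y"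
    using sg \<omega> unfolding subgaussian_noise_def by blast
  let ?Z = "\<lambda>G. \<Sum>i<n. \<epsilon> i \<omega> (G (x i))"
  \<comment> \<open>The summand 1 keeps c positive when all noise vectors vanish and makes the
    Lipschitz estimate strict.\<close>
  define c where "c = 1 + (\<Sum>i<n. norm (e i \<omega>))"
  have c: "0 < c" unfolding c_def by (smt (verit) norm_ge_zero sum_nonneg)
  have lip: "\<bar>?Z H - ?Z G\<bar> < c * \<rho>" if G: "G \<in> GG" and H: "H \<in> GG" "sup_dist D G H < ennreal \<rho>" "0 < \<rho>" for G H \<rho>
  proof -
    have "?Z H - ?Z G = (\<Sum>i<n. inner (e i \<omega>) (H (x i) - G (x i)))"
      using Y G H by (simp add: e inner_diff_right sum_subtractf)
    then have "\<bar>?Z H - ?Z G\<bar> \<le> (\<Sum>i<n. \<bar>inner (e i \<omega>) (H (x i) - G (x i))\<bar>)" by simp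
    also have "\<dots> \<le> (\<Sum>i<n. norm (e i \<omega>) * \<rho>)"
    proof (rule sum_mono)
      fix i assume "i \<in> {..<n}"
      then have "norm (G (x i) - H (x i)) \<le> \<rho>"
        using norm_le_of_sup_norm[of D "\<lambda>z. G z - H z" \<rho> "x i"] H x by (simp add: sup_dist_def)
      then show "\<bar>inner (e i \<omega>) (H (x i) - G (x i))\<bar> \<le> norm (e i \<omega>) * \<rho>"
        by (intro order_trans[OF Cauchy_Schwarz_ineq2] mult_left_mono) (auto simp: norm_minus_commute)
    qed
    also have "\<dots> < c * \<rho>" using H by (simp add: c_def sum_distrib_right[symmetric])
    finally show ?thesis .
  qed
  show ?thesis
    unfolding continuous_map_def
  proof (intro conjI allI impI)
    fix U assume "openin euclideanreal U"
    then have U: "open U" by simp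
    show "openin (pm_topology GG (sup_dist D)) {G \<in> topspace (pm_topology GG (sup_dist D)). ?Z G \<in> U}"
      unfolding openin_pm_topology topspace_pm_topology
    proof (intro conjI ballI)
      fix G assume G: "G \<in> {G \<in> GG. ?Z G \<in> U}"
      then obtain \<eta> where \<eta>: "0 < \<eta>" "ball (?Z G) \<eta> \<subseteq> U" using U by (auto elim: openE)
      show "\<exists>\<rho>>0. pm_ball GG (sup_dist D) G \<rho> \<subseteq> {G \<in> GG. ?Z G \<in> U}"
      proof (intro exI[of _ "\<eta> / c"] conjI subsetI)
        show "0 < \<eta> / c" using \<eta> c by simp
        fix H assume H: "H \<in> pm_ball GG (sup_dist D) G (\<eta> / c)"
        then have "\<bar>?Z H - ?Z G\<bar> < c * (\<eta> / c)"
          using G \<open>0 < \<eta> / c\<close> by (intro lip) (auto simp: pm_ball_def)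
        then have "?Z H \<in> ball (?Z G) \<eta>" using c by (simp add: dist_real_def abs_minus_commute)
        then show "H \<in> {G \<in> GG. ?Z G \<in> U}" using H \<eta> by (auto simp: pm_ball_def)
      qed
    qed auto
  qed auto
qed

text \<open>The theorem with its constant made explicit and over arbitrary types; of the structure
  of the design space it uses only that open sets have measurable traces.\<close>

lemma empirical_risk_minimizer_deviation:
  fixes \<gamma> :: "'a :: second_countable_topology measure" and M :: "'w measure"
    and GG :: "('a \<Rightarrow> 'b :: {real_inner, banach, second_countable_topology}) set"
    and Ghat :: "(nat \<Rightarrow> 'a) \<times> 'w \<Rightarrow> 'a \<Rightarrow> 'b" and \<Psi> :: "real \<Rightarrow> real" and n :: nat
    and \<sigma> F \<delta> \<delta>' R C :: real
  defines "D \<equiv> measure_support \<gamma>"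
  assumes \<gamma>: "prob_space \<gamma>" "\<And>U. open U \<Longrightarrow> U \<inter> space \<gamma> \<in> sets \<gamma>"
    and \<sigma>: "0 < \<sigma>" and G0: "G0 \<in> \<gamma> \<rightarrow>\<^sub>M restrict_space borel Y" and n: "1 \<le> n"
    and noise: "white_noise M Y n \<epsilon> \<and> continuous_noise_paths n \<gamma> M \<epsilon> GG \<or> subgaussian_noise M Y n \<epsilon>"
    and GG: "GG \<subseteq> \<gamma> \<rightarrow>\<^sub>M restrict_space borel Y" and Gst: "Gst \<in> GG"
    and compact: "compact_space (pm_topology GG (sup_dist D))"
    and \<Psi>: "\<forall>d>0. 0 \<le> \<Psi> d" "antimono_on {0<..} (\<lambda>d. \<Psi> d / d\<^sup>2)"
    and J: "AE x in Pi\<^sub>M {..<n} (\<lambda>_. \<gamma>). \<forall>d>0.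
        entropy_integral (local_class GG Gst n x d) (emp_dist n x) d \<le> ennreal (\<Psi> d)"
    and F: "0 \<le> F" "(SUP G\<in>GG. sup_norm D (\<lambda>x. G x - G0 x)) \<le> ennreal F"
    and Ghat: "risk_minimizer n \<gamma> M \<epsilon> G0 \<sigma> GG Ghat"
    and C: "C = 2048 * sqrt (16 * exp 3)"
    and \<delta>: "0 < \<delta>" "C * \<sigma> * \<Psi> \<delta> \<le> sqrt n * \<delta>\<^sup>2"
    and \<delta>': "0 < \<delta>'" "ennreal (C * F\<^sup>2) * metric_entropy GG (sup_dist D) \<delta>' \<le> ennreal (n * \<delta>'\<^sup>2)"
    and R: "C * \<delta> \<le> R" "C * \<delta>' \<le> R" "C * enn2real (sup_norm D (\<lambda>x. Gst x - G0 x)) \<le> R"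
      "C * ((\<sigma> + F) / sqrt n) \<le> R"
  shows "measure (sample_measure n \<gamma> M)
        {p \<in> space (sample_measure n \<gamma> M). R \<le> L2_norm \<gamma> (\<lambda>x. Ghat p x - G0 x)}
      \<le> 2 * exp (- (n * R\<^sup>2 / (C\<^sup>2 * (\<sigma>\<^sup>2 + F\<^sup>2))))"
proof (cases "{p \<in> space (sample_measure n \<gamma> M). R \<le> L2_norm \<gamma> (\<lambda>x. Ghat p x - G0 x)}
    \<in> sets (sample_measure n \<gamma> M)")
  \<comment> \<open>The event is not known to be measurable; outside the sigma-algebra
    \<open>measure\<close> has the value 0.\<close>
  case False
  then show ?thesis by (simp add: measure_notin_sets)
next
  case E_sets: True
  let ?P = "Pi\<^sub>M {..<n} (\<lambda>_. \<gamma>)"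
  let ?Z = "\<lambda>x G \<omega>. \<Sum>i<n. \<epsilon> i \<omega> (G (x i))"
  define E where "E = {p \<in> space (sample_measure n \<gamma> M). R \<le> L2_norm \<gamma> (\<lambda>x. Ghat p x - G0 x)}"
  define K :: real where "K = 16 * exp 3"
  have K: "0 < K" "1 / 2 \<le> K" "C = 2048 * sqrt K"
    unfolding K_def C using exp_ge_add_one_self[of 3] by auto
  have C64: "64 \<le> C"
  proof -
    have "sqrt 1 \<le> sqrt K" unfolding K_def using exp_ge_add_one_self[of 3] by (intro real_sqrt_le_mono) linarith
    then show ?thesis unfolding K(3) real_sqrt_one by linarith
  qed
  then have C0: "0 < C" by simp
  have R0: "0 < R" using R(1) \<delta>(1) C0 by (smt (verit) mult_pos_pos)
  have M: "prob_space M" using noise by (auto simp: white_noise_def subgaussian_noise_def)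
  have sg: "subgaussian_functionals M Y n \<epsilon> K"
    using noise white_noise_subgaussian[OF _ K(2)] subgaussian_noise_subgaussian unfolding K_def by blast
  interpret g: prob_space \<gamma> by fact
  interpret M: prob_space M by fact
  interpret P: prob_space ?P by (intro prob_space_PiM \<gamma>)
  interpret pair_sigma_finite ?P M ..
  have D: "AE z in \<gamma>. z \<in> D" unfolding D_def by (rule AE_measure_support[OF \<gamma>(2)])
  have xD: "AE x in ?P. \<forall>i\<in>{..<n}. x i \<in> D"
    using D \<gamma>(1) by (intro AE_finite_allI AE_PiM_component) auto
  have GY: "G z \<in> Y" if "G \<in> GG" "z \<in> space \<gamma>" for G z
    using measurable_space[of G \<gamma> "restrict_space borel Y" z] GG that by (auto simp: space_restrict_space)
  have GxY: "G (x i) \<in> Y" if "x \<in> space ?P" "G \<in> GG" "i < n" for x G i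
    using that by (intro GY) (auto simp: space_PiM)
  have meas: "(\<lambda>z. norm (G z - G0 z)) \<in> borel_measurable \<gamma>" if "G \<in> GG" for G
  proof -
    have [measurable]: "G \<in> borel_measurable \<gamma>" "G0 \<in> borel_measurable \<gamma>"
      using GG G0 that by (auto simp: measurable_restrict_space2_iff)
    show ?thesis by measurable
  qed
  have bound: "norm (G z - G0 z) \<le> F" if "G \<in> GG" "z \<in> D" for G z
  proof (rule norm_le_of_sup_norm[OF _ F(1) that(2)])
    have "sup_norm D (\<lambda>z. G z - G0 z) \<le> (SUP G\<in>GG. sup_norm D (\<lambda>x. G x - G0 x))"
      using that(1) by (rule SUP_upper)
    then show "sup_norm D (\<lambda>z. G z - G0 z) \<le> ennreal F" using F(2) by (rule order_trans)
  qed
  \<comment> \<open>\<open>enn2real\<close> sends infinity to 0; the bound by F ensures that \<eta>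
    is the true sup norm.\<close>
  define \<eta> where "\<eta> = enn2real (sup_norm D (\<lambda>x. Gst x - G0 x))"
  have \<eta>: "0 \<le> \<eta>" "\<And>z. z \<in> D \<Longrightarrow> norm (Gst z - G0 z) \<le> \<eta>"
  proof -
    show \<eta>0: "0 \<le> \<eta>" by (simp add: \<eta>_def)
    have "sup_norm D (\<lambda>x. Gst x - G0 x) \<le> ennreal F"
      unfolding sup_norm_def using bound[OF Gst] by (intro SUP_least ennreal_leI)
    then have "sup_norm D (\<lambda>x. Gst x - G0 x) < top" by (rule order.strict_trans1) simp
    then have "sup_norm D (\<lambda>x. Gst x - G0 x) = ennreal \<eta>" by (simp add: \<eta>_def)
    then show "norm (Gst z - G0 z) \<le> \<eta>" if "z \<in> D" for z
      using norm_le_of_sup_norm[of D "\<lambda>x. Gst x - G0 x", OF _ \<eta>0 that] by simp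
  qed
  have Ghat_in: "Ghat p \<in> GG" if "p \<in> space (sample_measure n \<gamma> M)" for p
  proof -
    have "Ghat p \<in> space (pm_borel GG (sup_dist (measure_support \<gamma>)))"
      using Ghat that unfolding risk_minimizer_def by (blast intro: measurable_space)
    then show ?thesis by (simp add: pm_borel_def space_measure_of_conv)
  qed
  have space: "(x, \<omega>) \<in> space (sample_measure n \<gamma> M)" if "x \<in> space ?P" "\<omega> \<in> space M" for x \<omega>
    using that by (simp add: sample_measure_def space_pair_measure)
  show ?thesis
  \<comment> \<open>The design bound divides by F. For F = 0 every map of the class agrees with
    \<open>G0\<close> on the support, and the event is empty because R > 0.\<close>
  proof (cases "F = 0")
    case True
    have "L2_norm \<gamma> (\<lambda>x. Ghat p x - G0 x) = 0" if "p \<in> space (sample_measure n \<gamma> M)" for p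
    proof -
      have "(\<integral>z. (norm (Ghat p z - G0 z))\<^sup>2 \<partial>\<gamma>) = (\<integral>z. 0 \<partial>\<gamma>)"
      proof (rule integral_cong_AE)
        show "AE z in \<gamma>. (norm (Ghat p z - G0 z))\<^sup>2 = 0"
          using D by eventually_elim (use bound[OF Ghat_in[OF that]] True in simp)
      qed (use meas[OF Ghat_in[OF that]] in measurable)
      then show ?thesis by (simp add: L2_norm_def)
    qed
    then have "{p \<in> space (sample_measure n \<gamma> M). R \<le> L2_norm \<gamma> (\<lambda>x. Ghat p x - G0 x)} = {}"
      using R0 by auto
    then show ?thesis by (simp only: measure_empty) simp
  next
    case False
    then have F0: "0 < F" using F(1) by simp
    have R\<sigma>: "C * (\<sigma> / sqrt n) \<le> R"
    proof -
      have "C * (\<sigma> / sqrt n) \<le> C * ((\<sigma> + F) / sqrt n)"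
        using C0 F0 by (intro mult_left_mono divide_right_mono) auto
      then show ?thesis using R(4) by linarith
    qed
    obtain B where B: "B \<in> sets ?P" "measure ?P B \<le> exp (- (n * R\<^sup>2 / (C\<^sup>2 * F\<^sup>2)))"
      "\<And>x G. x \<in> space ?P - B \<Longrightarrow> (\<And>i. i < n \<Longrightarrow> x i \<in> D) \<Longrightarrow> G \<in> GG \<Longrightarrow>
        R \<le> L2_norm \<gamma> (\<lambda>z. G z - G0 z) \<Longrightarrow> R / 4 \<le> emp_norm n x (\<lambda>z. G z - G0 z)"
    proof (rule design_lower_bound[where \<gamma> = \<gamma> and D = D and GG = GG and ?G0.0 = G0 and F = F and n = n
          and C = C and \<delta>' = \<delta>' and R = R])
      show "GG \<noteq> {}" using Gst by blast
    qed (use \<gamma>(1) D meas bound F0 n C64 \<delta>' R(2) in auto)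
    have AE_noise: "AE x in ?P. AE \<omega> in M.
        continuous_map (pm_topology GG (sup_dist D)) euclideanreal (\<lambda>G. ?Z x G \<omega>)"
      using noise
    proof (elim disjE conjE)
      assume "continuous_noise_paths n \<gamma> M \<epsilon> GG"
      then show ?thesis
        unfolding continuous_noise_paths_def sample_measure_def D_def by (drule_tac AE_pair) simp
    next
      assume sgn: "subgaussian_noise M Y n \<epsilon>"
      show ?thesis
        using xD AE_space
      proof eventually_elim
        case (elim x)
        show ?case
          by (rule AE_I2, rule subgaussian_noise_continuous[OF sgn]) (use elim GxY[OF elim(2)] in auto)
      qed
    qed
    have AE_min: "AE x in ?P. AE \<omega> in M. empirical_risk n x (observation G0 \<sigma> \<epsilon> (x, \<omega>)) (Ghat (x, \<omega>))
        \<le> empirical_risk n x (observation G0 \<sigma> \<epsilon> (x, \<omega>)) Gst"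
    proof -
      have "AE p in ?P \<Otimes>\<^sub>M M. \<forall>G\<in>GG. empirical_risk n (fst p) (observation G0 \<sigma> \<epsilon> p) (Ghat p)
        \<le> empirical_risk n (fst p) (observation G0 \<sigma> \<epsilon> p) G"
        using Ghat unfolding risk_minimizer_def sample_measure_def by (rule conjunct2)
      from AE_pair[OF this] show ?thesis
        by eventually_elim (erule eventually_mono, use Gst in auto)
    qed
    define a where "a = exp (- (n * R\<^sup>2 / (C\<^sup>2 * \<sigma>\<^sup>2)))"
    \<comment> \<open>With a good design point fixed, only the noise is random; its exceptional set
      may depend on x, which is harmless since the bound a does not.\<close>
    have slice: "emeasure M (Pair x -` E) \<le> ennreal a"
      if x: "x \<in> space ?P - B" "\<forall>i\<in>{..<n}. x i \<in> D"
        and Jx: "\<forall>d>0. entropy_integral (local_class GG Gst n x d) (emp_dist n x) d \<le> ennreal (\<Psi> d)"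
        and cont: "AE \<omega> in M. continuous_map (pm_topology GG (sup_dist D)) euclideanreal (\<lambda>G. ?Z x G \<omega>)"
        and risk: "AE \<omega> in M. empirical_risk n x (observation G0 \<sigma> \<epsilon> (x, \<omega>)) (Ghat (x, \<omega>))
          \<le> empirical_risk n x (observation G0 \<sigma> \<epsilon> (x, \<omega>)) Gst" for x
    proof -
      have xP: "x \<in> space ?P" using x by blast
      obtain B' where B': "B' \<in> sets M" "measure M B' \<le> exp (- (n * R\<^sup>2 / (C\<^sup>2 * \<sigma>\<^sup>2)))"
        "\<And>\<omega> G. \<omega> \<in> space M - B' \<Longrightarrow>
          continuous_map (pm_topology GG (sup_dist D)) euclideanreal (\<lambda>G. ?Z x G \<omega>) \<Longrightarrow>
          G \<in> GG \<Longrightarrow> R / 8 \<le> emp_norm n x (\<lambda>z. G z - Gst z) \<Longrightarrow>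
          ?Z x G \<omega> - ?Z x Gst \<omega> < n * (emp_norm n x (\<lambda>z. G z - Gst z))\<^sup>2 / (4 * \<sigma>)"
      proof (rule noise_term_uniform_bound[where M = M and n = n and Y = Y and \<epsilon> = \<epsilon> and K = K
            and GG = GG and x = x and Gst = Gst and D = D and \<Psi> = \<Psi> and \<sigma> = \<sigma> and \<delta> = \<delta> and C = C and R = R])
        show "G (x i) \<in> Y" if "G \<in> GG" "i < n" for G i using GxY[OF xP that] .
      qed (use M n sg K Gst x(2) compact Jx \<Psi> \<sigma> \<delta> C64 R(1) R\<sigma> in auto)
      have "AE \<omega> in M. \<omega> \<in> Pair x -` E \<longrightarrow> \<omega> \<in> B'"
        using cont risk AE_space
      proof eventually_elim
        case (elim \<omega>)
        show ?case
        proof (intro impI, rule ccontr)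
          assume "\<omega> \<in> Pair x -` E" "\<omega> \<notin> B'"
          define G where "G = Ghat (x, \<omega>)"
          have G: "G \<in> GG" "R \<le> L2_norm \<gamma> (\<lambda>z. G z - G0 z)"
            using \<open>\<omega> \<in> Pair x -` E\<close> Ghat_in[OF space[OF xP elim(3)]] by (auto simp: E_def G_def)
          define \<tau> where "\<tau> = emp_norm n x (\<lambda>z. G z - G0 z)"
          define u where "u = emp_norm n x (\<lambda>z. G z - Gst z)"
          define t where "t = emp_norm n x (\<lambda>z. Gst z - G0 z)"
          have "t \<le> \<eta>" unfolding t_def using \<eta> x(2) by (intro emp_norm_le) auto
          then have "C * t \<le> C * \<eta>" using C0 by simp
          moreover have "64 * t \<le> C * t" using C64 by (intro mult_right_mono) (auto simp: t_def)
          ultimately have t: "64 * t \<le> R" "0 \<le> t" using R(3) by (auto simp: \<eta>_def t_def)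
          have \<tau>: "R / 4 \<le> \<tau>" unfolding \<tau>_def using B(3)[OF x(1) _ G] x(2) by auto
          have "\<tau> \<le> u + t" unfolding \<tau>_def u_def t_def by (rule emp_norm_triangle)
          then have u: "R / 8 \<le> u" using \<tau> t R0 by linarith
          have "u \<le> \<tau> + t"
            unfolding \<tau>_def u_def t_def emp_norm_commute[of n x Gst G0] by (rule emp_norm_triangle)
          \<comment> \<open>t \<le> R / 64 and R / 8 \<le> u give t \<le> u / 8. Then \<tau>^2 - t^2
            is at least (49 - 1) / 64 u^2, more than the u^2 / 2 that the noise term has to reach;
            the denominator 4 \<sigma> of the uniform bound is matched to this value.\<close>
          then have "7 * u / 8 \<le> \<tau>" "t \<le> u / 8" using t u by linarith+
          then have "(7 * u / 8)\<^sup>2 \<le> \<tau>\<^sup>2" "t\<^sup>2 \<le> (u / 8)\<^sup>2" using u R0 t by (auto intro!: power_mono)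
          moreover have "(7 * u / 8)\<^sup>2 = 49 / 64 * u\<^sup>2" "(u / 8)\<^sup>2 = u\<^sup>2 / 64"
            by (simp_all add: power_divide power_mult_distrib)
          ultimately have gap: "u\<^sup>2 / 2 \<le> \<tau>\<^sup>2 - t\<^sup>2" using zero_le_power2[of u] by linarith
          have "\<tau>\<^sup>2 - t\<^sup>2 \<le> 2 * \<sigma> / n * (?Z x G \<omega> - ?Z x Gst \<omega>)"
            using elim(2) unfolding empirical_risk_observation[OF n] G_def[symmetric] \<tau>_def t_def
            by (simp add: right_diff_distrib)
          moreover have "?Z x G \<omega> - ?Z x Gst \<omega> < n * u\<^sup>2 / (4 * \<sigma>)"
            unfolding u_def using B'(3)[OF _ elim(1) G(1)] elim(3) \<open>\<omega> \<notin> B'\<close> u by (auto simp: u_def)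
          then have "2 * \<sigma> / n * (?Z x G \<omega> - ?Z x Gst \<omega>) < 2 * \<sigma> / n * (n * u\<^sup>2 / (4 * \<sigma>))"
            using \<sigma> n by (intro mult_strict_left_mono) auto
          moreover have "2 * \<sigma> / n * (n * u\<^sup>2 / (4 * \<sigma>)) = u\<^sup>2 / 2" using \<sigma> n by simp
          ultimately show False using gap by linarith
        qed
      qed
      then have "emeasure M (Pair x -` E) \<le> emeasure M B'" using B'(1) by (rule emeasure_mono_AE)
      also have "\<dots> \<le> ennreal a" using B'(2) by (simp add: M.emeasure_eq_measure a_def ennreal_leI)
      finally show ?thesis .
    qed
    have E: "E \<in> sets (?P \<Otimes>\<^sub>M M)" using E_sets by (simp add: E_def sample_measure_def)
    have "emeasure (sample_measure n \<gamma> M) E = (\<integral>\<^sup>+x. emeasure M (Pair x -` E) \<partial>?P)"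
      unfolding sample_measure_def by (rule M.emeasure_pair_measure_alt[OF E])
    \<comment> \<open>On B the slice is bounded trivially by 1, off B by the noise bound.\<close>
    also have "\<dots> \<le> (\<integral>\<^sup>+x. indicator B x + ennreal a \<partial>?P)"
    proof (rule nn_integral_mono_AE)
      show "AE x in ?P. emeasure M (Pair x -` E) \<le> indicator B x + ennreal a"
        using xD J AE_noise AE_min AE_space
      proof eventually_elim
        case (elim x)
        show ?case
        proof (cases "x \<in> B")
          case True
          then show ?thesis using M.emeasure_le_1[of "Pair x -` E"] by (simp add: add_increasing2)
        next
          case False
          then show ?thesis using slice[of x] elim by simp
        qed
      qed
    qed
    also have "\<dots> = emeasure ?P B + ennreal a"
      using B(1) by (simp add: nn_integral_add P.emeasure_space_1)
    also have "\<dots> = ennreal (measure ?P B + a)"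
      by (simp add: P.emeasure_eq_measure a_def ennreal_plus)
    finally have "measure (sample_measure n \<gamma> M) E \<le> measure ?P B + a"
      unfolding measure_def by (intro enn2real_leI) (auto simp: a_def)
    also have "\<dots> \<le> exp (- (n * R\<^sup>2 / (C\<^sup>2 * F\<^sup>2))) + exp (- (n * R\<^sup>2 / (C\<^sup>2 * \<sigma>\<^sup>2)))"
      using B(2) by (simp add: a_def)
    also have "\<dots> \<le> exp (- (n * R\<^sup>2 / (C\<^sup>2 * (\<sigma>\<^sup>2 + F\<^sup>2)))) + exp (- (n * R\<^sup>2 / (C\<^sup>2 * (\<sigma>\<^sup>2 + F\<^sup>2))))"
    proof -
      have "n * R\<^sup>2 / (C\<^sup>2 * (\<sigma>\<^sup>2 + F\<^sup>2)) \<le> n * R\<^sup>2 / (C\<^sup>2 * w)" if "0 < w" "w \<le> \<sigma>\<^sup>2 + F\<^sup>2" for w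
        using that C0 by (intro divide_left_mono mult_left_mono mult_pos_pos) auto
      from this[of "F\<^sup>2"] this[of "\<sigma>\<^sup>2"] show ?thesis using F0 \<sigma> by (intro add_mono) auto
    qed
    finally show ?thesis by (simp add: E_def)
  qed
qed

theorem theorem2p6:
  shows "\<exists>C::real. 0 < C \<and>
    (\<forall>(X :: l2 set) (Y :: l2 set) (\<gamma> :: l2 measure) (\<sigma> :: real) (G0 :: l2 \<Rightarrow> l2) (n :: nat)
      (M :: noise_sample measure) (\<epsilon> :: nat \<Rightarrow> noise_sample \<Rightarrow> l2 \<Rightarrow> real)
      (GG :: (l2 \<Rightarrow> l2) set) (Gst :: l2 \<Rightarrow> l2) (\<Psi> :: real \<Rightarrow> real) (F :: real)
      (Ghat :: (nat \<Rightarrow> l2) \<times> noise_sample \<Rightarrow> l2 \<Rightarrow> l2) (\<delta> :: real) (\<delta>' :: real) (R :: real).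
      subspace X \<and> closed X \<and> subspace Y \<and> closed Y \<and>
      prob_space \<gamma> \<and> sets \<gamma> = sets (restrict_space borel X) \<and>
      0 < \<sigma> \<and>
      G0 \<in> \<gamma> \<rightarrow>\<^sub>M restrict_space borel Y \<and> sup_norm (measure_support \<gamma>) G0 < \<infinity> \<and>
      1 \<le> n \<and>
      (white_noise M Y n \<epsilon> \<and> continuous_noise_paths n \<gamma> M \<epsilon> GG \<or> subgaussian_noise M Y n \<epsilon>) \<and>
      GG \<subseteq> \<gamma> \<rightarrow>\<^sub>M restrict_space borel Y \<and> Gst \<in> GG \<and>
      compact_space (pm_topology GG (sup_dist (measure_support \<gamma>))) \<and>
      (\<forall>d>0. 0 \<le> \<Psi> d) \<and>
      (AE x in Pi\<^sub>M {..<n} (\<lambda>_. \<gamma>). \<forall>d>0.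
        entropy_integral (local_class GG Gst n x d) (emp_dist n x) d \<le> ennreal (\<Psi> d)) \<and>
      antimono_on {0<..} (\<lambda>d. \<Psi> d / d\<^sup>2) \<and>
      0 \<le> F \<and> (SUP G\<in>GG. sup_norm (measure_support \<gamma>) (\<lambda>x. G x - G0 x)) \<le> ennreal F \<and>
      risk_minimizer n \<gamma> M \<epsilon> G0 \<sigma> GG Ghat \<and>
      0 < \<delta> \<and> C * \<sigma> * \<Psi> \<delta> \<le> sqrt n * \<delta>\<^sup>2 \<and>
      0 < \<delta>' \<and>
      ennreal (C * F\<^sup>2) * metric_entropy GG (sup_dist (measure_support \<gamma>)) \<delta>'
        \<le> ennreal (n * \<delta>'\<^sup>2) \<and>
      C * Max {\<delta>, \<delta>', enn2real (sup_norm (measure_support \<gamma>) (\<lambda>x. Gst x - G0 x)),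
               (\<sigma> + F) / sqrt n} \<le> R
      \<longrightarrow>
      measure (sample_measure n \<gamma> M)
        {p \<in> space (sample_measure n \<gamma> M). R \<le> L2_norm \<gamma> (\<lambda>x. Ghat p x - G0 x)}
      \<le> 2 * exp (- (n * R\<^sup>2 / (C\<^sup>2 * (\<sigma>\<^sup>2 + F\<^sup>2)))))"
proof -
  \<comment> \<open>16 exp 3 is the increment constant of sub-Gaussian noise, which also covers the
    Gaussian 1/2; 2048 comes from chaining and peeling. Neither depends on the spaces, the class or
    n.\<close>
  define C :: real where "C = 2048 * sqrt (16 * exp 3)"
  have "0 < C" by (simp add: C_def)
  show ?thesis
  proof (intro exI[of _ C] conjI allI impI, fact \<open>0 < C\<close>, elim conjE)
    fix X Y :: "l2 set" and \<gamma> :: "l2 measure" and \<sigma> :: real and G0 :: "l2 \<Rightarrow> l2" and n :: nat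
      and M :: "noise_sample measure" and \<epsilon> :: "nat \<Rightarrow> noise_sample \<Rightarrow> l2 \<Rightarrow> real"
      and GG :: "(l2 \<Rightarrow> l2) set" and Gst :: "l2 \<Rightarrow> l2" and \<Psi> :: "real \<Rightarrow> real" and F :: real
      and Ghat :: "(nat \<Rightarrow> l2) \<times> noise_sample \<Rightarrow> l2 \<Rightarrow> l2" and \<delta> \<delta>' R :: real
    let ?m = "{\<delta>, \<delta>', enn2real (sup_norm (measure_support \<gamma>) (\<lambda>x. Gst x - G0 x)), (\<sigma> + F) / sqrt n}"
    assume \<gamma>: "prob_space \<gamma>" "sets \<gamma> = sets (restrict_space borel X)" and R: "C * Max ?m \<le> R"
      and rest: "0 < \<sigma>" "G0 \<in> \<gamma> \<rightarrow>\<^sub>M restrict_space borel Y" "1 \<le> n"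
        "white_noise M Y n \<epsilon> \<and> continuous_noise_paths n \<gamma> M \<epsilon> GG \<or> subgaussian_noise M Y n \<epsilon>"
        "GG \<subseteq> \<gamma> \<rightarrow>\<^sub>M restrict_space borel Y" "Gst \<in> GG"
        "compact_space (pm_topology GG (sup_dist (measure_support \<gamma>)))"
        "\<forall>d>0. 0 \<le> \<Psi> d" "antimono_on {0<..} (\<lambda>d. \<Psi> d / d\<^sup>2)"
        "AE x in Pi\<^sub>M {..<n} (\<lambda>_. \<gamma>). \<forall>d>0.
          entropy_integral (local_class GG Gst n x d) (emp_dist n x) d \<le> ennreal (\<Psi> d)"
        "0 \<le> F" "(SUP G\<in>GG. sup_norm (measure_support \<gamma>) (\<lambda>x. G x - G0 x)) \<le> ennreal F"
        "risk_minimizer n \<gamma> M \<epsilon> G0 \<sigma> GG Ghat"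
      and small: "0 < \<delta>" "C * \<sigma> * \<Psi> \<delta> \<le> sqrt n * \<delta>\<^sup>2" "0 < \<delta>'"
        "ennreal (C * F\<^sup>2) * metric_entropy GG (sup_dist (measure_support \<gamma>)) \<delta>' \<le> ennreal (n * \<delta>'\<^sup>2)"
    \<comment> \<open>\<gamma> lives on the subspace X with the trace of the Borel sets, so an open
      set of \<open>l2\<close> is measurable only after intersection with X.\<close>
    have open_sets: "U \<inter> space \<gamma> \<in> sets \<gamma>" if "open U" for U
    proof -
      have "space \<gamma> = X" using sets_eq_imp_space_eq[OF \<gamma>(2)] by (simp add: space_restrict_space)
      then show ?thesis
        unfolding \<gamma>(2) sets_restrict_space by (intro image_eqI[where x = U]) (use that in auto)
    qed
    have R': "C * w \<le> R" if "w \<in> ?m" for w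
    proof -
      have "C * w \<le> C * Max ?m" using that \<open>0 < C\<close> by (intro mult_left_mono Max_ge) auto
      then show ?thesis using R by linarith
    qed
    show "measure (sample_measure n \<gamma> M)
        {p \<in> space (sample_measure n \<gamma> M). R \<le> L2_norm \<gamma> (\<lambda>x. Ghat p x - G0 x)}
      \<le> 2 * exp (- (n * R\<^sup>2 / (C\<^sup>2 * (\<sigma>\<^sup>2 + F\<^sup>2))))"
    proof (rule empirical_risk_minimizer_deviation)
      show "C = 2048 * sqrt (16 * exp 3)" by (rule C_def)
      show "U \<inter> space \<gamma> \<in> sets \<gamma>" if "open U" for U using that by (rule open_sets)
      show "C * \<delta> \<le> R" "C * \<delta>' \<le> R" "C * ((\<sigma> + F) / sqrt n) \<le> R"
        "C * enn2real (sup_norm (measure_support \<gamma>) (\<lambda>x. Gst x - G0 x)) \<le> R"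
        by (rule R', simp)+
    qed (fact \<gamma>(1) rest small)+
  qed
qed

end
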